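(* Let $n\ge1$. There is a one-to-one correspondence between $n$-dimensional non-degenerate representations of the algebras $U(\mathcal L)$ associated with $M$-structures $\mathcal L$, taken up to equivalence of $M$-structures, and associative products $\circ$ on $Mat_n(\mathbb C)$ compatible with the usual matrix product. Explicitly, the correspondence assigns to an $M$-structure $\mathcal L$ with adapted basis $1,A_i,B^i,C$ and a non-degenerate representation $A_i\mapsto a_i$, $B^i\mapsto b^i$, $C\mapsto c$ ($1\le i\le p$) the product $$x\circ y=\sum_{i=1}^p\big(a_i\,x\,b^i\,y+x\,a_i\,y\,b^i-a_i\,x\,y\,b^i\big)+x\,c\,y .$$
   Context: Two associative products $\star,\circ$ on a vector space are compatible if $a\star b+\lambda\,a\circ b$ is associative for every $\lambda\in\mathbb C$. A weak $M$-structure on a finite-dimensional complex vector space $\mathcal L$ consists of: two subspaces $\mathcal A,\mathcal B\subset\mathcal L$ and an element $1\in\mathcal A\cap\mathcal B$; a non-degenerate symmetric bilinear form $(\cdot,\cdot)$ on $\mathcal L$; associative products on $\mathcal A$ and on $\mathcal B$, both with unity $1$; a left (unital) action of $\mathcal B$ on $\mathcal L$ and a right (unital) action of $\mathcal A$ on $\mathcal L$ that commute with each other; such that (1) $\mathcal A\cap\mathcal B=\mathbb C\,1$ is one-dimensional and $\dim\mathcal L/(\mathcal A+\mathcal B)=1$; (2) the action of $\mathcal B$ restricted to $\mathcal B\subset\mathcal L$ is the product of $\mathcal B$, and the action of $\mathcal A$ restricted to $\mathcal A\subset\mathcal L$ is the product of $\mathcal A$; (3) $(a_1,a_2)=(b_1,b_2)=0$,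 $(b_1b_2,v)=(b_1,b_2v)$, $(v,a_1a_2)=(va_1,a_2)$ for all $a_1,a_2\in\mathcal A$, $b_1,b_2\in\mathcal B$, $v\in\mathcal L$. The weak $M$-algebra $U(\mathcal L)$ is the associative algebra with unit $1\in\mathcal L$ such that $\mathcal L\subset U(\mathcal L)$, the products $bv$ and $va$ ($b\in\mathcal B$, $a\in\mathcal A$, $v\in\mathcal L$) in $U(\mathcal L)$ are the given actions, and which is universal: for any associative algebra $X$ with these properties there is a unique algebra homomorphism $U(\mathcal L)\to X$ that is the identity on $\mathcal L$. Adapted basis: $\{1,A_1,\dots,A_p\}$ is a basis of $\mathcal A$ ($p\ge0$), $\{1,B^1,\dots,B^p\}$ a basis of $\mathcal B$ with $(A_i,B^j)=\delta_i^j$, and $C\in\mathcal L$ is the unique element with $(1,C)=1$ and $(C,C)=(C,A_i)=(C,B^j)=0$ for all $i,j$. Put $K=\sum_iA_iB^i+C\in U(\mathcal L)$ (independent of the choice of adapted basis). A weak $M$-structure is called an $M$-structure if $K$ is central in $U(\mathcal L)$. An $n$-dimensional representation is a unital algebra homomorphism $\rho:U(\mathcal L)\to Mat_n(\mathbb C)$ (not taken up to conjugation). It is non-degenerate if the matrices $\rho(A_1),\dots,\rho(A_p),1$ are linearly independent and $\rho(B^1),\dots,\rho(B^p),1$ are linearly independent. Equivalence: two $M$-structures are equivalent if the defining relations of one algebra are obtained from those of the other by a transformation $A_i\to g_i^kA_k+u_i$, $B^i\to h^i_kB^k+v^i$, $C\to C-u_ih^i_kB^k-v^ig_i^kA_k-u_iv^i$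 with constants $u_i,v^i$ and $g_i^kh_k^j=\delta_i^j$ (summation over repeated indices). Accordingly, two pairs ($M$-structure, representation) $(\mathcal L,\rho)$ and $(\mathcal L',\rho')$ are identified if one can choose adapted bases of $\mathcal L$ and $\mathcal L'$ in which all products $A_iA_j$, $B^iB^j$, $B^iA_j$, $B^iC$, $CA_j$ are given by the same structure constants and in which $\rho(A_i)=\rho'(A_i')$, $\rho(B^i)=\rho'(B'^i)$, $\rho(C)=\rho'(C')$. *)

theory Defs
  imports
    "HOL-Analysis.Analysis"
    "HOL-Algebra.QuotRing"
    "HOL-Library.Poly_Mapping"
begin

section \<open>Linear algebra conventions\<close>

definition lin_indep_family ::
    "(complex \<Rightarrow> 'v::ab_group_add \<Rightarrow> 'v) \<Rightarrow> 'i set \<Rightarrow> ('i \<Rightarrow> 'v) \<Rightarrow> bool" where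
  "lin_indep_family sc I f \<longleftrightarrow> inj_on f I \<and> \<not> module.dependent sc (f ` I)"

definition bilinear_on ::
    "(complex \<Rightarrow> 'a::ab_group_add \<Rightarrow> 'a) \<Rightarrow> (complex \<Rightarrow> 'b::ab_group_add \<Rightarrow> 'b) \<Rightarrow>
     (complex \<Rightarrow> 'c::ab_group_add \<Rightarrow> 'c) \<Rightarrow> 'a set \<Rightarrow> 'b set \<Rightarrow> ('a \<Rightarrow> 'b \<Rightarrow> 'c) \<Rightarrow> bool" where
  "bilinear_on s1 s2 s3 S T f \<longleftrightarrow>
     (\<forall>x\<in>S. \<forall>x'\<in>S. \<forall>y\<in>T. f (x + x') y = f x y + f x' y) \<and>
     (\<forall>x\<in>S. \<forall>y\<in>T. \<forall>y'\<in>T. f x (y + y') = f x y + f x y') \<and>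
     (\<forall>c. \<forall>x\<in>S. \<forall>y\<in>T. f (s1 c x) y = s3 c (f x y) \<and> f x (s2 c y) = s3 c (f x y))"

definition assoc_on :: "'a set \<Rightarrow> ('a \<Rightarrow> 'a \<Rightarrow> 'a) \<Rightarrow> bool" where
  "assoc_on S f \<longleftrightarrow> (\<forall>x\<in>S. \<forall>y\<in>S. \<forall>z\<in>S. f (f x y) z = f x (f y z))"

definition mat_scale :: "complex \<Rightarrow> complex^'n^'n \<Rightarrow> complex^'n^'n" where
  "mat_scale c X = (\<chi> i j. c * X $ i $ j)"

section \<open>Weak M-structures\<close>

text \<open>
  The finite-dimensional vector spaces underlying M-structures are taken to be
  subspaces of an ambient complex vector space \<open>(\<^typ>\<open>'v\<close>, sc)\<close>. If the ambient space
  is infinite-dimensional, every finite-dimensional complex vector space occurs up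
  to isomorphism. The values of the operations outside the relevant subspaces
  carry no meaning, and no notion below depends on them.
\<close>

record 'v M_data =
  Lsp :: "'v set"                         \<comment> \<open>the space \<open>\<L>\<close>\<close>
  Asp :: "'v set"                         \<comment> \<open>the subspace \<open>\<A>\<close>\<close>
  Bsp :: "'v set"                         \<comment> \<open>the subspace \<open>\<B>\<close>\<close>
  unit :: "'v"
  form :: "'v \<Rightarrow> 'v \<Rightarrow> complex"
  mulA :: "'v \<Rightarrow> 'v \<Rightarrow> 'v"
  mulB :: "'v \<Rightarrow> 'v \<Rightarrow> 'v"
  lact :: "'v \<Rightarrow> 'v \<Rightarrow> 'v"                \<comment> \<open>\<open>lact L b v\<close> is \<open>b v\<close>\<close>
  ract :: "'v \<Rightarrow> 'v \<Rightarrow> 'v"                \<comment> \<open>\<open>ract L v a\<close> is \<open>v a\<close>\<close>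

locale weak_M_structure = vector_space sc
  for sc :: "complex \<Rightarrow> 'v::ab_group_add \<Rightarrow> 'v" +
  fixes L :: "'v M_data"
  assumes subspace_L: "subspace (Lsp L)"
    and finite_dim: "\<exists>S. finite S \<and> span S = Lsp L"
    and subspace_A: "subspace (Asp L)" "Asp L \<subseteq> Lsp L"
    and subspace_B: "subspace (Bsp L)" "Bsp L \<subseteq> Lsp L"
    and unit_mem: "unit L \<in> Asp L \<inter> Bsp L"
    and form_bilinear: "bilinear_on sc sc (*) (Lsp L) (Lsp L) (form L)"
    and form_sym: "\<lbrakk>v \<in> Lsp L; w \<in> Lsp L\<rbrakk> \<Longrightarrow> form L v w = form L w v"
    and form_nondeg: "\<lbrakk>v \<in> Lsp L; \<And>w. w \<in> Lsp L \<Longrightarrow> form L v w = 0\<rbrakk> \<Longrightarrow> v = 0"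
    and mulA_closed: "\<lbrakk>a \<in> Asp L; a' \<in> Asp L\<rbrakk> \<Longrightarrow> mulA L a a' \<in> Asp L"
    and mulA_bilinear: "bilinear_on sc sc sc (Asp L) (Asp L) (mulA L)"
    and mulA_assoc: "assoc_on (Asp L) (mulA L)"
    and mulA_unit: "a \<in> Asp L \<Longrightarrow> mulA L (unit L) a = a"
                   "a \<in> Asp L \<Longrightarrow> mulA L a (unit L) = a"
    and mulB_closed: "\<lbrakk>b \<in> Bsp L; b' \<in> Bsp L\<rbrakk> \<Longrightarrow> mulB L b b' \<in> Bsp L"
    and mulB_bilinear: "bilinear_on sc sc sc (Bsp L) (Bsp L) (mulB L)"
    and mulB_assoc: "assoc_on (Bsp L) (mulB L)"
    and mulB_unit: "b \<in> Bsp L \<Longrightarrow> mulB L (unit L) b = b"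
                   "b \<in> Bsp L \<Longrightarrow> mulB L b (unit L) = b"
    and lact_closed: "\<lbrakk>b \<in> Bsp L; v \<in> Lsp L\<rbrakk> \<Longrightarrow> lact L b v \<in> Lsp L"
    and lact_bilinear: "bilinear_on sc sc sc (Bsp L) (Lsp L) (lact L)"
    and lact_unit: "v \<in> Lsp L \<Longrightarrow> lact L (unit L) v = v"
    and lact_mul: "\<lbrakk>b \<in> Bsp L; b' \<in> Bsp L; v \<in> Lsp L\<rbrakk> \<Longrightarrow>
                     lact L (mulB L b b') v = lact L b (lact L b' v)"
    and ract_closed: "\<lbrakk>v \<in> Lsp L; a \<in> Asp L\<rbrakk> \<Longrightarrow> ract L v a \<in> Lsp L"
    and ract_bilinear: "bilinear_on sc sc sc (Lsp L) (Asp L) (ract L)"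
    and ract_unit: "v \<in> Lsp L \<Longrightarrow> ract L v (unit L) = v"
    and ract_mul: "\<lbrakk>v \<in> Lsp L; a \<in> Asp L; a' \<in> Asp L\<rbrakk> \<Longrightarrow>
                     ract L v (mulA L a a') = ract L (ract L v a) a'"
    and actions_commute: "\<lbrakk>b \<in> Bsp L; v \<in> Lsp L; a \<in> Asp L\<rbrakk> \<Longrightarrow>
                     ract L (lact L b v) a = lact L b (ract L v a)"
    and inter_AB: "Asp L \<inter> Bsp L = span {unit L}" "dim (Asp L \<inter> Bsp L) = 1"
    \<comment> \<open>\<open>\<L>/(\<A>+\<B>)\<close> is one-dimensional; all spaces involved are finite-dimensional\<close>
    and codim_AB: "dim (Lsp L) = dim {a + b |a b. a \<in> Asp L \<and> b \<in> Bsp L} + 1"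
    and lact_B: "\<lbrakk>b \<in> Bsp L; b' \<in> Bsp L\<rbrakk> \<Longrightarrow> lact L b b' = mulB L b b'"
    and ract_A: "\<lbrakk>a \<in> Asp L; a' \<in> Asp L\<rbrakk> \<Longrightarrow> ract L a a' = mulA L a a'"
    and form_AA: "\<lbrakk>a \<in> Asp L; a' \<in> Asp L\<rbrakk> \<Longrightarrow> form L a a' = 0"
    and form_BB: "\<lbrakk>b \<in> Bsp L; b' \<in> Bsp L\<rbrakk> \<Longrightarrow> form L b b' = 0"
    and form_lact: "\<lbrakk>b \<in> Bsp L; b' \<in> Bsp L; v \<in> Lsp L\<rbrakk> \<Longrightarrow>
                     form L (mulB L b b') v = form L b (lact L b' v)"
    and form_ract: "\<lbrakk>v \<in> Lsp L; a \<in> Asp L; a' \<in> Asp L\<rbrakk> \<Longrightarrow>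
                     form L v (mulA L a a') = form L (ract L v a) a'"

text \<open>
  A basis \<open>1, A\<^sub>1, \<dots>, A\<^sub>p\<close> of \<open>\<A>\<close> is a family on \<open>{0..p}\<close> whose entry at \<open>0\<close> is
  the unit, and likewise for \<open>\<B>\<close>.
\<close>

definition adapted_basis ::
    "(complex \<Rightarrow> 'v::ab_group_add \<Rightarrow> 'v) \<Rightarrow> 'v M_data \<Rightarrow>
     nat \<Rightarrow> (nat \<Rightarrow> 'v) \<Rightarrow> (nat \<Rightarrow> 'v) \<Rightarrow> 'v \<Rightarrow> bool" where
  "adapted_basis sc L p A B C \<longleftrightarrow>
     A 0 = unit L \<and> lin_indep_family sc {0..p} A \<and> module.span sc (A ` {0..p}) = Asp L \<and>
     B 0 = unit L \<and> lin_indep_family sc {0..p} B \<and> module.span sc (B ` {0..p}) = Bsp L \<and>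
     (\<forall>i\<in>{1..p}. \<forall>j\<in>{1..p}. form L (A i) (B j) = (if i = j then 1 else 0)) \<and>
     C \<in> Lsp L \<and> form L (unit L) C = 1 \<and> form L C C = 0 \<and>
     (\<forall>i\<in>{1..p}. form L C (A i) = 0 \<and> form L C (B i) = 0)"

section \<open>The weak M-algebra\<close>

text \<open>Words form the free monoid; the monoid algebra below needs it in additive notation.\<close>

instantiation list :: (type) monoid_add
begin
definition zero_list :: "'a list" where "zero_list = []"
definition plus_list :: "'a list \<Rightarrow> 'a list \<Rightarrow> 'a list" where "plus_list u w = u @ w"
instance by standard (simp_all add: zero_list_def plus_list_def)
end

text \<open>
  \<open>U(\<L>)\<close> is realised as the free unital algebra on the set \<open>\<L>\<close> modulo the two-sided
  ideal forcing that \<open>\<L> \<rightarrow> U(\<L>)\<close> is linear, maps \<open>1\<close> to the unit, and turns the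
  two actions into products. This is the algebra with the universal property: a map from
  \<open>\<L>\<close> to a unital algebra with these properties extends uniquely to the quotient. The relations rewrite words in
  \<open>A\<^sub>i, B\<^sup>i, C\<close> to normal forms \<open>[A\<^sub>i] C\<^sup>k [B\<^sup>j]\<close> (outer letters optional) and all overlaps
  resolve by the axioms above, so \<open>\<L> \<rightarrow> U(\<L>)\<close> is injective.
\<close>

definition free_alg :: "'v M_data \<Rightarrow> ('v list \<Rightarrow>\<^sub>0 complex) ring" where
  "free_alg L = \<lparr>carrier = {f. \<forall>w\<in>Poly_Mapping.keys f. set w \<subseteq> Lsp L},
                 mult = (*), one = 1, zero = 0, add = (+)\<rparr>"

definition gen :: "'v \<Rightarrow> 'v list \<Rightarrow>\<^sub>0 complex" where
  "gen v = Poly_Mapping.single [v] 1"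

definition scalar :: "complex \<Rightarrow> 'v list \<Rightarrow>\<^sub>0 complex" where
  "scalar c = Poly_Mapping.single [] c"

definition U_rels ::
    "(complex \<Rightarrow> 'v::ab_group_add \<Rightarrow> 'v) \<Rightarrow> 'v M_data \<Rightarrow> ('v list \<Rightarrow>\<^sub>0 complex) set" where
  "U_rels sc L =
     {gen (v + w) - (gen v + gen w) |v w. v \<in> Lsp L \<and> w \<in> Lsp L} \<union>
     {gen (sc c v) - scalar c * gen v |c v. v \<in> Lsp L} \<union>
     {gen (unit L) - 1} \<union>
     {gen b * gen v - gen (lact L b v) |b v. b \<in> Bsp L \<and> v \<in> Lsp L} \<union>
     {gen v * gen a - gen (ract L v a) |v a. v \<in> Lsp L \<and> a \<in> Asp L}"

definition U_ideal ::
    "(complex \<Rightarrow> 'v::ab_group_add \<Rightarrow> 'v) \<Rightarrow> 'v M_data \<Rightarrow> ('v list \<Rightarrow>\<^sub>0 complex) set" where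
  "U_ideal sc L = genideal (free_alg L) (U_rels sc L)"

definition U_alg ::
    "(complex \<Rightarrow> 'v::ab_group_add \<Rightarrow> 'v) \<Rightarrow> 'v M_data \<Rightarrow> ('v list \<Rightarrow>\<^sub>0 complex) set ring" where
  "U_alg sc L = free_alg L Quot U_ideal sc L"

definition U_proj ::
    "(complex \<Rightarrow> 'v::ab_group_add \<Rightarrow> 'v) \<Rightarrow> 'v M_data \<Rightarrow>
     ('v list \<Rightarrow>\<^sub>0 complex) \<Rightarrow> ('v list \<Rightarrow>\<^sub>0 complex) set" where
  "U_proj sc L f = U_ideal sc L +>\<^bsub>free_alg L\<^esub> f"

definition U_incl ::
    "(complex \<Rightarrow> 'v::ab_group_add \<Rightarrow> 'v) \<Rightarrow> 'v M_data \<Rightarrow> 'v \<Rightarrow> ('v list \<Rightarrow>\<^sub>0 complex) set" where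
  "U_incl sc L v = U_proj sc L (gen v)"

definition U_scale ::
    "(complex \<Rightarrow> 'v::ab_group_add \<Rightarrow> 'v) \<Rightarrow> 'v M_data \<Rightarrow> complex \<Rightarrow>
     ('v list \<Rightarrow>\<^sub>0 complex) set \<Rightarrow> ('v list \<Rightarrow>\<^sub>0 complex) set" where
  "U_scale sc L c u = U_proj sc L (scalar c) \<otimes>\<^bsub>U_alg sc L\<^esub> u"

section \<open>M-structures\<close>

definition K_elem ::
    "(complex \<Rightarrow> 'v::ab_group_add \<Rightarrow> 'v) \<Rightarrow> 'v M_data \<Rightarrow>
     nat \<Rightarrow> (nat \<Rightarrow> 'v) \<Rightarrow> (nat \<Rightarrow> 'v) \<Rightarrow> 'v \<Rightarrow> ('v list \<Rightarrow>\<^sub>0 complex) set" where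
  "K_elem sc L p A B C = U_proj sc L ((\<Sum>i=1..p. gen (A i) * gen (B i)) + gen C)"

definition U_central ::
    "(complex \<Rightarrow> 'v::ab_group_add \<Rightarrow> 'v) \<Rightarrow> 'v M_data \<Rightarrow> ('v list \<Rightarrow>\<^sub>0 complex) set \<Rightarrow> bool" where
  "U_central sc L k \<longleftrightarrow>
     k \<in> carrier (U_alg sc L) \<and>
     (\<forall>u\<in>carrier (U_alg sc L). k \<otimes>\<^bsub>U_alg sc L\<^esub> u = u \<otimes>\<^bsub>U_alg sc L\<^esub> k)"

text \<open>
  Adapted bases always exist, and \<open>K\<close> does not depend on the choice, so the quantifier over
  adapted bases could equivalently be universal; the same holds for non-degeneracy below.
\<close>

definition M_structure :: "(complex \<Rightarrow> 'v::ab_group_add \<Rightarrow> 'v) \<Rightarrow> 'v M_data \<Rightarrow> bool" where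
  "M_structure sc L \<longleftrightarrow>
     weak_M_structure sc L \<and>
     (\<exists>p A B C. adapted_basis sc L p A B C \<and> U_central sc L (K_elem sc L p A B C))"

section \<open>Representations\<close>

definition mat_ring :: "(complex^'n^'n) ring" where
  "mat_ring = \<lparr>carrier = UNIV, mult = (**), one = mat 1, zero = 0, add = (+)\<rparr>"

type_synonym ('v, 'n) rep = "('v list \<Rightarrow>\<^sub>0 complex) set \<Rightarrow> complex^'n^'n"

definition representation ::
    "(complex \<Rightarrow> 'v::ab_group_add \<Rightarrow> 'v) \<Rightarrow> 'v M_data \<Rightarrow> ('v, 'n::finite) rep \<Rightarrow> bool" where
  "representation sc L \<rho> \<longleftrightarrow>
     \<rho> \<in> ring_hom (U_alg sc L) mat_ring \<and>
     (\<forall>c. \<forall>u\<in>carrier (U_alg sc L). \<rho> (U_scale sc L c u) = mat_scale c (\<rho> u))"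

definition nondegenerate_rep ::
    "(complex \<Rightarrow> 'v::ab_group_add \<Rightarrow> 'v) \<Rightarrow> 'v M_data \<Rightarrow> ('v, 'n::finite) rep \<Rightarrow> bool" where
  "nondegenerate_rep sc L \<rho> \<longleftrightarrow>
     representation sc L \<rho> \<and>
     (\<exists>p A B C. adapted_basis sc L p A B C \<and>
        lin_indep_family mat_scale {0..p} (\<lambda>i. \<rho> (U_incl sc L (A i))) \<and>
        lin_indep_family mat_scale {0..p} (\<lambda>i. \<rho> (U_incl sc L (B i))))"

definition M_rep_pairs ::
    "(complex \<Rightarrow> 'v::ab_group_add \<Rightarrow> 'v) \<Rightarrow> ('v M_data \<times> ('v, 'n::finite) rep) set" where
  "M_rep_pairs sc = {(L, \<rho>). M_structure sc L \<and> nondegenerate_rep sc L \<rho>}"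

section \<open>Equivalence of pairs\<close>

text \<open>
  \<open>v\<close> has the same coordinates in the basis \<open>1, A\<^sub>i, B\<^sup>i, C\<close> as \<open>v'\<close> in
  \<open>1, A'\<^sub>i, B'\<^sup>i, C'\<close>. The coordinate of \<open>1\<close> is \<open>\<beta> 0\<close>, as \<open>B 0\<close> is the unit.
\<close>

definition same_coords ::
    "(complex \<Rightarrow> 'v::ab_group_add \<Rightarrow> 'v) \<Rightarrow> nat \<Rightarrow> (nat \<Rightarrow> 'v) \<Rightarrow> (nat \<Rightarrow> 'v) \<Rightarrow> 'v \<Rightarrow>
     (nat \<Rightarrow> 'v) \<Rightarrow> (nat \<Rightarrow> 'v) \<Rightarrow> 'v \<Rightarrow> 'v \<Rightarrow> 'v \<Rightarrow> bool" where
  "same_coords sc p A B C A' B' C' v v' \<longleftrightarrow>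
     (\<exists>\<alpha> \<beta> \<gamma>.
        v = (\<Sum>k=1..p. sc (\<alpha> k) (A k)) + (\<Sum>k=0..p. sc (\<beta> k) (B k)) + sc \<gamma> C \<and>
        v' = (\<Sum>k=1..p. sc (\<alpha> k) (A' k)) + (\<Sum>k=0..p. sc (\<beta> k) (B' k)) + sc \<gamma> C')"

definition same_structure_constants ::
    "(complex \<Rightarrow> 'v::ab_group_add \<Rightarrow> 'v) \<Rightarrow> nat \<Rightarrow>
     'v M_data \<Rightarrow> (nat \<Rightarrow> 'v) \<Rightarrow> (nat \<Rightarrow> 'v) \<Rightarrow> 'v \<Rightarrow>
     'v M_data \<Rightarrow> (nat \<Rightarrow> 'v) \<Rightarrow> (nat \<Rightarrow> 'v) \<Rightarrow> 'v \<Rightarrow> bool" where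
  "same_structure_constants sc p L A B C L' A' B' C' \<longleftrightarrow>
     (\<forall>i\<in>{1..p}. \<forall>j\<in>{1..p}.
        same_coords sc p A B C A' B' C' (mulA L (A i) (A j)) (mulA L' (A' i) (A' j)) \<and>
        same_coords sc p A B C A' B' C' (mulB L (B i) (B j)) (mulB L' (B' i) (B' j)) \<and>
        same_coords sc p A B C A' B' C' (lact L (B i) (A j)) (lact L' (B' i) (A' j))) \<and>
     (\<forall>i\<in>{1..p}.
        same_coords sc p A B C A' B' C' (lact L (B i) C) (lact L' (B' i) C') \<and>
        same_coords sc p A B C A' B' C' (ract L C (A i)) (ract L' C' (A' i)))"

definition pair_equiv ::
    "(complex \<Rightarrow> 'v::ab_group_add \<Rightarrow> 'v) \<Rightarrow>
     (('v M_data \<times> ('v, 'n::finite) rep) \<times> ('v M_data \<times> ('v, 'n) rep)) set" where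
  "pair_equiv sc =
     {((L, \<rho>), (L', \<rho>')). (L, \<rho>) \<in> M_rep_pairs sc \<and> (L', \<rho>') \<in> M_rep_pairs sc \<and>
        (\<exists>p A B C A' B' C'.
           adapted_basis sc L p A B C \<and> adapted_basis sc L' p A' B' C' \<and>
           same_structure_constants sc p L A B C L' A' B' C' \<and>
           (\<forall>i\<in>{1..p}. \<rho> (U_incl sc L (A i)) = \<rho>' (U_incl sc L' (A' i)) \<and>
                       \<rho> (U_incl sc L (B i)) = \<rho>' (U_incl sc L' (B' i))) \<and>
           \<rho> (U_incl sc L C) = \<rho>' (U_incl sc L' C'))}"

section \<open>Products on matrices\<close>

definition compatible_products ::
    "(complex^'n^'n \<Rightarrow> complex^'n^'n \<Rightarrow> complex^'n^'n) \<Rightarrow>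
     (complex^'n^'n \<Rightarrow> complex^'n^'n \<Rightarrow> complex^'n^'n) \<Rightarrow> bool" where
  "compatible_products f g \<longleftrightarrow> (\<forall>c. assoc_on UNIV (\<lambda>x y. f x y + mat_scale c (g x y)))"

definition assoc_products_compatible_with_mult ::
    "(complex^'n^'n \<Rightarrow> complex^'n^'n \<Rightarrow> complex^'n^'n) set" where
  "assoc_products_compatible_with_mult =
     {f. bilinear_on mat_scale mat_scale mat_scale UNIV UNIV f \<and> assoc_on UNIV f \<and>
         compatible_products (**) f}"

definition M_product ::
    "nat \<Rightarrow> (nat \<Rightarrow> complex^'n^'n) \<Rightarrow> (nat \<Rightarrow> complex^'n^'n) \<Rightarrow> complex^'n^'n \<Rightarrow>
     complex^'n^'n \<Rightarrow> complex^'n^'n \<Rightarrow> complex^'n^'n" where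
  "M_product p a b c x y =
     (\<Sum>i=1..p. a i ** x ** b i ** y + x ** a i ** y ** b i - a i ** x ** y ** b i) + x ** c ** y"

end

theory Submission
  imports Defs
begin

text \<open>
  An associative product \<open>\<circ>\<close> is compatible with the matrix product iff it is a Hochschild 2-cocycle of
  \<open>Mat\<^sub>n\<close>. Such a cocycle is a coboundary \<open>x \<circ> y = T x y + x T y - T (x y)\<close>, and writing \<open>T\<close> as
  \<open>x \<mapsto> \<Sum> a\<^sub>i x b\<^sup>i + c x\<close> with the smallest possible number of terms makes \<open>1, a\<^sub>i\<close> and \<open>1, b\<^sup>i\<close>
  linearly independent, uniquely up to the transformations that define equivalence of M-structures.
  Contracting the associativity of \<open>\<circ>\<close> with functionals dual to these families gives quadratic
  relations between \<open>a\<^sub>i, b\<^sup>i, c\<close>: precisely those which a representation of \<open>U(\<L>)\<close> satisfies when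
  \<open>K\<close> is central. Conversely these relations imply associativity, and their coefficients define an
  M-structure on the abstract span of \<open>1, A\<^sub>i, B\<^sup>i, C\<close>. Its axioms need not be verified on structure
  constants: an element of this span is determined by its matrix together with its scalar products with
  \<open>\<B>\<close> (or with \<open>\<A>\<close>), and both kinds of data turn the axioms into identities between matrices.
\<close>

section \<open>Bimodule contractions on matrices\<close>

text \<open>The families \<open>1, a i\<close> and \<open>1, b i\<close> are independent separately,
  but all of \<open>1, a i, b i, c\<close> together may be dependent: for n = 1 already p = 0 and c
  is a scalar. So coefficients cannot be compared in an identity that contains both families, and
  the M-structure cannot be found inside the matrices. This is why associativity is exploited slot
  by slot. Read as a threefold tensor, the defect \<open>T x ** T y - T (x \<circ> y)\<close> has
  two outer slots, which functionals turn into numbers; what remains is an identity for the middle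
  slot, where one family can be isolated. The numbers
  \<open>contraction p \<phi> \<psi> t i j\<close> arise twice. A weak M-structure leaves free the
  coefficients of \<open>C A_j\<close> along the \<open>A_k\<close> and of \<open>B^i C\<close>
  along the \<open>B^k\<close>. If they are minus these numbers, the commutators of K with
  \<open>A_j\<close> and \<open>B^i\<close> vanish; a non-degenerate representation forces the
  converse. The contraction of associativity yields the same values: their part quadratic in \<phi>
  and \<psi> is the coefficient of \<open>a i ** z ** b j\<close> in the double sum contained in
  \<open>T (T z)\<close>.\<close>

definition clin :: "(complex^'n^'n \<Rightarrow> complex) \<Rightarrow> bool" where
  "clin f \<longleftrightarrow> (\<forall>X Y. f (X + Y) = f X + f Y) \<and> (\<forall>c X. f (mat_scale c X) = c * f X)"

definition mlin :: "(complex^'n^'n \<Rightarrow> complex^'n^'n) \<Rightarrow> bool" where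
  "mlin T \<longleftrightarrow> (\<forall>X Y. T (X + Y) = T X + T Y) \<and> (\<forall>c X. T (mat_scale c X) = mat_scale c (T X))"

interpretation mat: vector_space mat_scale
  by unfold_locales (simp_all add: mat_scale_def vec_eq_iff algebra_simps)

lemma vector_space_complex: "vector_space ((*) :: complex \<Rightarrow> complex \<Rightarrow> complex)"
  by unfold_locales (simp_all add: algebra_simps)

lemma vector_space_pair_mat: "vector_space_pair mat_scale ((*) :: complex \<Rightarrow> complex \<Rightarrow> complex)"
  by (simp add: vector_space_pair_def vector_space_complex mat.vector_space_axioms)

lemma clin_iff_linear: "clin f \<longleftrightarrow> Vector_Spaces.linear mat_scale (*) f"
  by (simp add: clin_def Vector_Spaces.linear_iff vector_space_complex mat.vector_space_axioms)

lemma matmul_scale_left: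
  fixes X Y Z :: "complex^'n^'n"
  shows "mat_scale c X ** Y = mat_scale c (X ** Y)"
  by (simp add: mat_scale_def vec_eq_iff matrix_matrix_mult_def sum_distrib_left mult.assoc)

lemma matmul_scale_right:
  fixes X Y Z :: "complex^'n^'n"
  shows "X ** mat_scale c Y = mat_scale c (X ** Y)"
  by (simp add: mat_scale_def vec_eq_iff matrix_matrix_mult_def sum_distrib_left mult_ac)

lemma matmul_add_left:
  fixes X Y Z :: "complex^'n^'n"
  shows "(X + Y) ** Z = X ** Z + Y ** Z"
  by (simp add: vec_eq_iff matrix_matrix_mult_def algebra_simps sum.distrib)

lemma matmul_add_right:
  fixes X Y Z :: "complex^'n^'n"
  shows "Z ** (X + Y) = Z ** X + Z ** Y"
  by (simp add: vec_eq_iff matrix_matrix_mult_def algebra_simps sum.distrib)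

lemma matmul_zero [simp]:
  fixes X Y Z :: "complex^'n^'n"
  shows "0 ** X = 0" "X ** 0 = 0"
  by (simp_all add: vec_eq_iff matrix_matrix_mult_def)

lemma matmul_uminus_left:
  fixes X Y Z :: "complex^'n^'n"
  shows "(- X) ** Y = - (X ** Y)"
  by (metis add_eq_0_iff matmul_add_left matmul_zero(1))

lemma matmul_uminus_right:
  fixes X Y Z :: "complex^'n^'n"
  shows "X ** (- Y) = - (X ** Y)"
  by (metis add_eq_0_iff matmul_add_right matmul_zero(2))

lemma matmul_diff_left:
  fixes X Y Z :: "complex^'n^'n"
  shows "(X - Y) ** Z = X ** Z - Y ** Z"
  using matmul_add_left[of X "-Y" Z] by (simp add: matmul_uminus_left)

lemma matmul_diff_right:
  fixes X Y Z :: "complex^'n^'n"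
  shows "Z ** (X - Y) = Z ** X - Z ** Y"
  using matmul_add_right[of Z X "-Y"] by (simp add: matmul_uminus_right)

lemma matmul_sum_left:
  fixes Y :: "complex^'n^'n" and f :: "'i \<Rightarrow> complex^'n^'n"
  shows "sum f I ** Y = (\<Sum>i\<in>I. f i ** Y)"
  by (induction I rule: infinite_finite_induct) (auto simp: matmul_add_left)

lemma matmul_sum_right:
  fixes Y :: "complex^'n^'n" and f :: "'i \<Rightarrow> complex^'n^'n"
  shows "Y ** sum f I = (\<Sum>i\<in>I. Y ** f i)"
  by (induction I rule: infinite_finite_induct) (auto simp: matmul_add_right)

lemmas matmul_assoc = matrix_mul_assoc[symmetric]

lemmas matmul_distribs = matmul_add_left matmul_add_right matmul_diff_left matmul_diff_right
  matmul_sum_left matmul_sum_right matmul_uminus_left matmul_uminus_right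

lemmas matmul_expand = matmul_distribs matmul_scale_left matmul_scale_right matmul_assoc

lemmas mat_scale_expand = mat.scale_right_distrib mat.scale_right_diff_distrib mat.scale_sum_right
  mat.scale_minus_right

lemma mat_one_neq_zero [simp]: "mat 1 \<noteq> (0::complex^'n^'n)"
  by (auto simp: vec_eq_iff mat_def)

lemma clin_add: "clin f \<Longrightarrow> f (X + Y) = f X + f Y"
  and clin_scale: "clin f \<Longrightarrow> f (mat_scale c X) = c * f X"
  by (auto simp: clin_def)

lemma clin_zero: "clin f \<Longrightarrow> f 0 = 0"
  using clin_scale[of f 0 0] by simp

lemma clin_uminus: "clin f \<Longrightarrow> f (- X) = - f X"
  using clin_scale[of f "-1" X] by simp

lemma clin_diff: "clin f \<Longrightarrow> f (X - Y) = f X - f Y"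
  using clin_add[of f X "-Y"] clin_uminus[of f Y] by simp

lemma clin_sum: "clin f \<Longrightarrow> f (sum g I) = (\<Sum>i\<in>I. f (g i))"
  by (induction I rule: infinite_finite_induct) (auto simp: clin_add clin_zero)

lemmas clin_simps = clin_add clin_scale clin_zero clin_uminus clin_diff clin_sum

lemma mlin_add: "mlin T \<Longrightarrow> T (X + Y) = T X + T Y"
  and mlin_scale: "mlin T \<Longrightarrow> T (mat_scale c X) = mat_scale c (T X)"
  by (auto simp: mlin_def)

lemma mlin_zero: "mlin f \<Longrightarrow> f 0 = 0"
  using mlin_scale[of f 0 0] by simp

lemma mlin_uminus: "mlin f \<Longrightarrow> f (- X) = - f X"
  using mlin_scale[of f "-1" X] by simp

lemma mlin_diff: "mlin f \<Longrightarrow> f (X - Y) = f X - f Y"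
  using mlin_add[of f X "-Y"] mlin_uminus[of f Y] by simp

lemma mlin_sum: "mlin f \<Longrightarrow> f (sum g I) = (\<Sum>i\<in>I. f (g i))"
  by (induction I rule: infinite_finite_induct) (auto simp: mlin_add mlin_zero)

lemmas mlin_simps = mlin_add mlin_scale mlin_zero mlin_uminus mlin_diff mlin_sum

section \<open>Matrix units and contractions\<close>

definition munit :: "'n \<Rightarrow> 'n \<Rightarrow> complex^'n^'n" where
  "munit i j = (\<chi> k l. if k = i \<and> l = j then 1 else 0)"

lemma munit_nth: "munit i j $ k $ l = (if k = i \<and> l = j then 1 else 0)"
  by (simp add: munit_def)

lemma mat_decomp: "(X::complex^'n^'n) = (\<Sum>i\<in>UNIV. \<Sum>j\<in>UNIV. mat_scale (X $ i $ j) (munit i j))"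
proof -
  have "(\<Sum>i\<in>UNIV. \<Sum>j\<in>UNIV. X $ i $ j * munit i j $ k $ l)
      = (\<Sum>i\<in>UNIV. \<Sum>j\<in>UNIV. if j = l then (if i = k then X $ k $ l else 0) else 0)" for k l
    by (intro sum.cong) (auto simp: munit_nth)
  then show ?thesis
    by (simp add: vec_eq_iff mat_scale_def)
qed

lemma if_one_zero_mult: "(if P then 1 else 0) * x = (if P then x else (0::'a::semiring_1))"
  and mult_if_one_zero: "x * (if P then 1 else 0) = (if P then x else (0::'a::semiring_1))"
  by simp_all

lemma munit_mult_nth: "(munit i j ** X) $ k $ l = (if k = i then X $ j $ l else 0)"
  by (cases "k = i") (simp_all add: matrix_matrix_mult_def munit_nth if_one_zero_mult)

lemma mult_munit_nth: "(X ** munit i j) $ k $ l = (if l = j then X $ k $ i else 0)"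
  by (cases "l = j") (simp_all add: matrix_matrix_mult_def munit_nth mult_if_one_zero)

lemma mat_scale_nth: "mat_scale c X $ i $ j = c * X $ i $ j"
  by (simp add: mat_scale_def)

lemma munit_sandwich: "munit s j ** X ** munit i r = mat_scale (X $ j $ i) (munit s r)"
  by (simp add: vec_eq_iff munit_mult_nth mult_munit_nth mat_scale_nth munit_nth)

lemma munit_mult_munit: "munit i j ** munit k l = (if j = k then munit i l else 0)"
  by (simp add: vec_eq_iff munit_mult_nth munit_nth)

lemma sum_munit_diag: "(\<Sum>s\<in>UNIV. munit s s) = (mat 1 :: complex^'n^'n)"
proof -
  have "(\<Sum>s\<in>UNIV. munit s s $ k $ l) = (\<Sum>s\<in>UNIV. if s = k then (if k = l then 1 else 0::complex) else 0)" for k l :: 'n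
    by (intro sum.cong) (auto simp: munit_nth)
  then show ?thesis unfolding vec_eq_iff by (simp add: mat_def)
qed

text \<open>Summing over \<open>s\<close> turns a single entry of X into a multiple of 1, which
  commutes with everything. Both the contraction of tensors and the expansion of a linear map into
  maps \<open>l ** x ** m\<close> rest on this.\<close>

lemma sum_munit_sandwich: "(\<Sum>s\<in>UNIV. munit s j ** X ** munit i s) = mat_scale (X $ j $ i) (mat 1)"
  by (simp add: munit_sandwich sum_munit_diag flip: mat.scale_sum_right)

text \<open>
  Contraction of one tensor slot: a map \<open>x \<mapsto> \<Sum> l x m\<close> is sent to \<open>\<Sum> f(l) m\<close>, respectively \<open>\<Sum> f(m) l\<close>.
\<close>

definition lcontr :: "(complex^'n^'n \<Rightarrow> complex) \<Rightarrow> (complex^'n^'n \<Rightarrow> complex^'n^'n) \<Rightarrow> complex^'n^'n" where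
  "lcontr f T = (\<Sum>j\<in>UNIV. \<Sum>i\<in>UNIV. \<Sum>s\<in>UNIV. mat_scale (f (munit j i)) (munit s j ** T (munit i s)))"

definition rcontr :: "(complex^'n^'n \<Rightarrow> complex) \<Rightarrow> (complex^'n^'n \<Rightarrow> complex^'n^'n) \<Rightarrow> complex^'n^'n" where
  "rcontr f T = (\<Sum>j\<in>UNIV. \<Sum>i\<in>UNIV. \<Sum>s\<in>UNIV. mat_scale (f (munit j i)) (T (munit s j) ** munit i s))"

lemma clin_decomp: "clin f \<Longrightarrow> f X = (\<Sum>j\<in>UNIV. \<Sum>i\<in>UNIV. X $ j $ i * f (munit j i))"
  by (subst mat_decomp) (simp add: clin_simps)

text \<open>The left factor \<open>l\<close> ends up between \<open>munit s j\<close> and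
  \<open>munit i s\<close>; the sum over \<open>s\<close> extracts its entry, \<open>f l\<close> is
  reassembled from the values of \<open>f\<close> on matrix units, and \<open>m\<close> splits off
  on the right. As \<open>lcontr\<close> is defined on maps, the result does not depend on how a map
  is written as a sum of such terms.\<close>

lemma lcontr_mult: "clin f \<Longrightarrow> lcontr f (\<lambda>x. l ** (x ** m)) = mat_scale (f l) m"
proof -
  assume f: "clin f"
  have "lcontr f (\<lambda>x. l ** (x ** m)) = (\<Sum>j\<in>UNIV. \<Sum>i\<in>UNIV. mat_scale (f (munit j i))
     ((\<Sum>s\<in>UNIV. munit s j ** l ** munit i s) ** m))"
    by (simp add: lcontr_def matmul_sum_left mat.scale_sum_right matmul_assoc)
  also have "\<dots> = mat_scale (f l) m"
    by (subst clin_decomp[OF f, of l])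
      (simp add: sum_munit_sandwich matmul_scale_left mat.scale_sum_left mult.commute)
  finally show ?thesis .
qed

lemma rcontr_mult: "clin f \<Longrightarrow> rcontr f (\<lambda>x. l ** (x ** m)) = mat_scale (f m) l"
proof -
  assume f: "clin f"
  have "rcontr f (\<lambda>x. l ** (x ** m)) = (\<Sum>j\<in>UNIV. \<Sum>i\<in>UNIV. mat_scale (f (munit j i))
     (l ** (\<Sum>s\<in>UNIV. munit s j ** m ** munit i s)))"
    by (simp add: rcontr_def matmul_sum_right mat.scale_sum_right matmul_assoc)
  also have "\<dots> = mat_scale (f m) l"
    by (subst clin_decomp[OF f, of m])
      (simp add: sum_munit_sandwich matmul_scale_right mat.scale_sum_left mult.commute)
  finally show ?thesis .
qed

lemma lcontr_mult':
  assumes "clin f"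
  shows "lcontr f (\<lambda>x. x ** m) = mat_scale (f (mat 1)) m"
    and "lcontr f (\<lambda>x. l ** x) = mat_scale (f l) (mat 1)"
    and "lcontr f (\<lambda>x. x) = mat_scale (f (mat 1)) (mat 1)"
  using lcontr_mult[OF assms, of "mat 1" m] lcontr_mult[OF assms, of l "mat 1"]
    lcontr_mult[OF assms, of "mat 1" "mat 1"] by simp_all

lemma rcontr_mult':
  assumes "clin f"
  shows "rcontr f (\<lambda>x. x ** m) = mat_scale (f m) (mat 1)"
    and "rcontr f (\<lambda>x. l ** x) = mat_scale (f (mat 1)) l"
    and "rcontr f (\<lambda>x. x) = mat_scale (f (mat 1)) (mat 1)"
  using rcontr_mult[OF assms, of "mat 1" m] rcontr_mult[OF assms, of l "mat 1"]
    rcontr_mult[OF assms, of "mat 1" "mat 1"] by simp_all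

lemma lcontr_lin:
  "lcontr f (\<lambda>x. T x + U x) = lcontr f T + lcontr f U"
  "lcontr f (\<lambda>x. T x - U x) = lcontr f T - lcontr f U"
  "lcontr f (\<lambda>x. mat_scale c (T x)) = mat_scale c (lcontr f T)"
  "lcontr f (\<lambda>x. 0) = 0"
  unfolding lcontr_def
  by (simp_all add: matmul_distribs mat.scale_right_distrib mat.scale_right_diff_distrib sum.distrib sum_subtractf
      matmul_scale_left matmul_scale_right mat.scale_sum_right mult.commute[of c])

lemma lcontr_sum: "lcontr f (\<lambda>x. \<Sum>i\<in>I. V i x) = (\<Sum>i\<in>I. lcontr f (V i))"
  by (induction I rule: infinite_finite_induct) (simp_all add: lcontr_lin)

lemma rcontr_lin:
  "rcontr f (\<lambda>x. T x + U x) = rcontr f T + rcontr f U"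
  "rcontr f (\<lambda>x. T x - U x) = rcontr f T - rcontr f U"
  "rcontr f (\<lambda>x. mat_scale c (T x)) = mat_scale c (rcontr f T)"
  "rcontr f (\<lambda>x. 0) = 0"
  unfolding rcontr_def
  by (simp_all add: matmul_distribs mat.scale_right_distrib mat.scale_right_diff_distrib sum.distrib sum_subtractf
      matmul_scale_left matmul_scale_right mat.scale_sum_right mult.commute[of c])

lemma rcontr_sum: "rcontr f (\<lambda>x. \<Sum>i\<in>I. V i x) = (\<Sum>i\<in>I. rcontr f (V i))"
  by (induction I rule: infinite_finite_induct) (simp_all add: rcontr_lin)

section \<open>Linear maps as tensors, cocycles as coboundaries\<close>

lemma sum_UNIV_prod: "(\<Sum>p\<in>UNIV. g p) = (\<Sum>a\<in>UNIV. \<Sum>b\<in>UNIV. g (a, b))"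
  by (simp add: sum.cartesian_product)

text \<open>The coefficient \<open>x $ k $ i\<close> of \<open>T (munit k i)\<close> is a sum of
  sandwiches \<open>munit s k ** x ** munit i s\<close>; placed to the right of
  \<open>T (munit k i)\<close>, it gives one term for each triple (k, i, s). So Mat tensored with
  its opposite maps onto the endomorphisms of Mat.\<close>

lemma mlin_tensor:
  fixes T :: "complex^'n^'n \<Rightarrow> complex^'n^'n"
  assumes "mlin T"
  shows "\<exists>l m :: 'n \<times> 'n \<times> 'n \<Rightarrow> complex^'n^'n. \<forall>x. T x = (\<Sum>q\<in>UNIV. l q ** x ** m q)"
proof -
  define l where "l q = (case q of (k, i, s) \<Rightarrow> T (munit k i) ** munit s k)" for q :: "'n \<times> 'n \<times> 'n"
  define m where "m q = (case q of (k, i, s) \<Rightarrow> (munit i s :: complex^'n^'n))" for q :: "'n \<times> 'n \<times> 'n"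
  have "T x = (\<Sum>q\<in>UNIV. l q ** x ** m q)" for x
  proof -
    have "T x = T (\<Sum>k\<in>UNIV. \<Sum>i\<in>UNIV. mat_scale (x $ k $ i) (munit k i))"
      by (rule arg_cong[OF mat_decomp])
    also have "\<dots> = (\<Sum>k\<in>UNIV. \<Sum>i\<in>UNIV. mat_scale (x $ k $ i) (T (munit k i)))"
      by (simp only: mlin_sum[OF assms] mlin_scale[OF assms])
    also have "\<dots> = (\<Sum>k\<in>UNIV. \<Sum>i\<in>UNIV. T (munit k i) ** (\<Sum>s\<in>UNIV. munit s k ** x ** munit i s))"
      by (simp add: sum_munit_sandwich matmul_scale_right)
    also have "\<dots> = (\<Sum>q\<in>UNIV. l q ** x ** m q)"
      unfolding sum_UNIV_prod l_def m_def by (simp add: matmul_sum_right matmul_assoc)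
    finally show ?thesis .
  qed
  then have "\<forall>x. T x = (\<Sum>q\<in>UNIV. l q ** x ** m q)" by simp
  from exI[of "\<lambda>m. \<forall>x. T x = (\<Sum>q\<in>UNIV. l q ** x ** m q)", OF this]
  show ?thesis by (rule exI[of _ l])
qed

definition mbilin :: "(complex^'n^'n \<Rightarrow> complex^'n^'n \<Rightarrow> complex^'n^'n) \<Rightarrow> bool" where
  "mbilin F \<longleftrightarrow> (\<forall>x. mlin (F x)) \<and> (\<forall>y. mlin (\<lambda>x. F x y))"

text \<open>
  The second Hochschild cohomology of the matrix algebra vanishes: contract the cocycle
  with the separability idempotent \<open>\<Sum>\<^sub>i e\<^sub>i\<^sub>o \<otimes> e\<^sub>o\<^sub>i\<close>.
\<close>

lemma matrix_cocycle_coboundary: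
  fixes F :: "complex^'n^'n \<Rightarrow> complex^'n^'n \<Rightarrow> complex^'n^'n"
  assumes F: "mbilin F"
    and cocycle: "\<And>x y z. F (x ** y) z + F x y ** z = F x (y ** z) + x ** F y z"
  shows "\<exists>T. mlin T \<and> (\<forall>x y. F x y = T x ** y + x ** T y - T (x ** y))"
proof -
  \<comment> \<open>The column \<open>undefined\<close> is an arbitrary fixed index:
    \<open>e i ** d i\<close> is the diagonal unit at \<open>i\<close> whatever it is.\<close>
  define e where "e i = munit i (undefined::'n)" for i
  define d where "d i = munit (undefined::'n) i" for i
  define T where "T x = (\<Sum>i\<in>UNIV. F x (e i) ** d i)" for x
  have F1: "mlin (\<lambda>x. F x y)" and F2: "mlin (F x)" for x y
    using F by (auto simp: mbilin_def)
  have lin: "mlin T"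
    unfolding mlin_def T_def
    by (simp add: mlin_simps[OF F1] matmul_expand sum.distrib mat_scale_expand)
  have ed: "(\<Sum>i\<in>UNIV. e i ** d i) = mat 1"
    by (simp add: e_def d_def munit_mult_munit sum_munit_diag)
  have ye: "y ** e i = (\<Sum>k\<in>UNIV. mat_scale (y $ k $ i) (e k))" for y i
  proof -
    have "(\<Sum>k\<in>UNIV. y $ k $ i * e k $ m $ l) = (\<Sum>k\<in>UNIV. if k = m then (y ** e i) $ m $ l else 0)" for m l
      by (intro sum.cong) (auto simp: e_def mult_munit_nth munit_nth)
    then show ?thesis by (simp add: vec_eq_iff mat_scale_nth)
  qed
  have dy: "d k ** y = (\<Sum>i\<in>UNIV. mat_scale (y $ k $ i) (d i))" for y k
  proof -
    have "(\<Sum>i\<in>UNIV. y $ k $ i * d i $ m $ l) = (\<Sum>i\<in>UNIV. if i = l then (d k ** y) $ m $ l else 0)" for m l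
      by (intro sum.cong) (auto simp: d_def munit_mult_nth munit_nth)
    then show ?thesis by (simp add: vec_eq_iff mat_scale_nth)
  qed
  \<comment> \<open>The idempotent commutes with \<open>y\<close>: a factor \<open>y\<close> to the
    left of the \<open>e i\<close> may be moved to the right of the \<open>d i\<close>, even after
    \<open>F x\<close> is applied to the first tensor factor.\<close>
  have swap: "(\<Sum>i\<in>UNIV. F x (y ** e i) ** d i) = T x ** y" for x y
  proof -
    have "(\<Sum>i\<in>UNIV. F x (y ** e i) ** d i)
        = (\<Sum>i\<in>UNIV. \<Sum>k\<in>UNIV. mat_scale (y $ k $ i) (F x (e k) ** d i))"
      by (simp add: ye mlin_simps[OF F2] matmul_expand)
    also have "\<dots> = (\<Sum>k\<in>UNIV. \<Sum>i\<in>UNIV. mat_scale (y $ k $ i) (F x (e k) ** d i))"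
      by (rule sum.swap)
    also have "\<dots> = T x ** y"
      by (simp add: T_def matmul_expand dy)
    finally show ?thesis .
  qed
  have "F x y = T x ** y + x ** T y - T (x ** y)" for x y
  proof -
    \<comment> \<open>The cocycle identity at \<open>z = e i\<close>, multiplied by
      \<open>d i\<close> on the right and summed over \<open>i\<close>.\<close>
    have "(\<Sum>i\<in>UNIV. (F (x ** y) (e i) + F x y ** e i) ** d i)
        = (\<Sum>i\<in>UNIV. (F x (y ** e i) + x ** F y (e i)) ** d i)"
      by (simp add: cocycle)
    then have "T (x ** y) + F x y ** (\<Sum>i\<in>UNIV. e i ** d i) = T x ** y + x ** T y"
      by (simp add: T_def[of "x ** y"] T_def[of y] swap[symmetric] matmul_expand sum.distrib)
    then show ?thesis by (simp add: ed algebra_simps)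
  qed
  with lin show ?thesis by blast
qed

section \<open>Independent families, dual functionals and spans\<close>

lemma lin_indep_family_iff:
  assumes "vector_space sc" and "finite I"
  shows "lin_indep_family sc I f \<longleftrightarrow> (\<forall>u. (\<Sum>i\<in>I. sc (u i) (f i)) = 0 \<longrightarrow> (\<forall>i\<in>I. u i = 0))"
proof -
  interpret vector_space sc by fact
  show ?thesis
  proof
    assume "lin_indep_family sc I f"
    then have inj: "inj_on f I" and ind: "\<not> dependent (f ` I)" by (auto simp: lin_indep_family_def)
    show "\<forall>u. (\<Sum>i\<in>I. sc (u i) (f i)) = 0 \<longrightarrow> (\<forall>i\<in>I. u i = 0)"
    proof (intro allI impI ballI)
      fix u i
      assume u: "(\<Sum>i\<in>I. sc (u i) (f i)) = 0" and i: "i \<in> I"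
      have "(\<Sum>v\<in>f ` I. sc (u (the_inv_into I f v)) v) = 0"
        using u by (simp add: sum.reindex[OF inj] the_inv_into_f_f[OF inj])
      then have "u (the_inv_into I f (f i)) = 0"
        using independentD[OF ind, of "f ` I" "\<lambda>v. u (the_inv_into I f v)" "f i"] assms(2) i by auto
      then show "u i = 0" by (simp add: the_inv_into_f_f[OF inj i])
    qed
  next
    assume R: "\<forall>u. (\<Sum>i\<in>I. sc (u i) (f i)) = 0 \<longrightarrow> (\<forall>i\<in>I. u i = 0)"
    have inj: "inj_on f I"
    proof (rule inj_onI, rule ccontr)
      fix i j assume ij: "i \<in> I" "j \<in> I" "f i = f j" "i \<noteq> j"
      \<comment> \<open>A value taken twice is itself a relation, with coefficients 1 and
        -1.\<close>
      define u where "u k = (if k = i then 1 else if k = j then -1 else 0 :: complex)" for k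
      have "(\<Sum>k\<in>I. sc (u k) (f k)) = (\<Sum>k\<in>{i, j}. sc (u k) (f k))"
        by (rule sum.mono_neutral_right) (use assms(2) ij in \<open>auto simp: u_def\<close>)
      also have "\<dots> = 0" using ij by (simp add: u_def)
      finally have "u i = 0" using R ij by blast
      then show False by (simp add: u_def)
    qed
    moreover have "\<not> dependent (f ` I)"
    proof
      assume "dependent (f ` I)"
      then obtain u where u: "(\<Sum>v\<in>f ` I. sc (u v) v) = 0" "\<exists>v\<in>f ` I. u v \<noteq> 0"
        by (auto simp: dependent_finite[OF finite_imageI[OF assms(2)]])
      then have "(\<Sum>i\<in>I. sc (u (f i)) (f i)) = 0" by (simp add: sum.reindex[OF inj])
      from R[rule_format, OF this] u(2) show False by auto
    qed
    ultimately show "lin_indep_family sc I f" by (simp add: lin_indep_family_def)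
  qed
qed

lemma span_family:
  assumes "vector_space sc" and "finite I"
  shows "v \<in> module.span sc (f ` I) \<longleftrightarrow> (\<exists>u. v = (\<Sum>i\<in>I. sc (u i) (f i)))"
proof -
  interpret vector_space sc by fact
  show ?thesis
  proof
    assume "v \<in> span (f ` I)"
    then show "\<exists>u. v = (\<Sum>i\<in>I. sc (u i) (f i))"
    proof (induction rule: span_induct_alt)
      case base
      show ?case by (rule exI[of _ "\<lambda>_. 0"]) simp
    next
      case (step c x y)
      then obtain u i where "y = (\<Sum>i\<in>I. sc (u i) (f i))" "i \<in> I" "x = f i" by auto
      moreover have "(\<Sum>k\<in>I. sc (u k + (if k = i then c else 0)) (f k)) =
         (\<Sum>k\<in>I. sc (u k) (f k)) + (\<Sum>k\<in>I. if k = i then sc c (f i) else 0)"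
        unfolding sum.distrib[symmetric] by (intro sum.cong) (auto simp: scale_left_distrib)
      ultimately show ?case
        by (intro exI[of _ "\<lambda>k. u k + (if k = i then c else 0)"]) (simp add: assms(2))
    qed
  next
    show "v \<in> span (f ` I)" if "\<exists>u. v = (\<Sum>i\<in>I. sc (u i) (f i))"
    proof -
      from that obtain u where "v = (\<Sum>i\<in>I. sc (u i) (f i))" by blast
      then show ?thesis by (simp add: span_sum span_scale span_base)
    qed
  qed
qed

lemma dual_functionals:
  assumes "lin_indep_family mat_scale {0..p::nat} a"
  shows "\<exists>f. (\<forall>k. clin (f k)) \<and> (\<forall>k. \<forall>i\<in>{0..p}. f k (a i) = (if k = i then 1 else 0))"
proof -
  interpret vector_space_pair mat_scale "(*) :: complex \<Rightarrow> complex \<Rightarrow> complex"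
    by (rule vector_space_pair_mat)
  have inj: "inj_on a {0..p}" and ind: "mat.independent (a ` {0..p})"
    using assms by (auto simp: lin_indep_family_def)
  have "\<exists>g. clin g \<and> (\<forall>i\<in>{0..p}. g (a i) = (if k = i then 1 else 0))" for k
  proof -
    obtain g where "Vector_Spaces.linear mat_scale (*) g"
        "\<forall>x\<in>a ` {0..p}. g x = (if k = the_inv_into {0..p} a x then 1 else 0)"
      using linear_independent_extend[OF ind, of "\<lambda>x. if k = the_inv_into {0..p} a x then 1 else 0"] by blast
    then show ?thesis by (intro exI[of _ g]) (simp add: clin_iff_linear the_inv_into_f_f[OF inj])
  qed
  then have "\<forall>k. \<exists>g. clin g \<and> (\<forall>i\<in>{0..p}. g (a i) = (if k = i then 1 else 0))" by blast
  from choice[OF this] show ?thesis by blast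
qed

text \<open>If z were outside the span, it could be added to a basis of the span chosen in S, and
  the functional that is 1 at z and 0 on this basis would kill S but not z. Membership in a span
  thus becomes a question about functionals, which is the form of information that contracted
  identities provide.\<close>

lemma in_span_if_functionals:
  assumes "\<And>f. clin f \<Longrightarrow> (\<And>s. s \<in> S \<Longrightarrow> f s = 0) \<Longrightarrow> f z = 0"
  shows "z \<in> mat.span S"
proof (rule ccontr)
  assume z: "z \<notin> mat.span S"
  interpret vector_space_pair mat_scale "(*) :: complex \<Rightarrow> complex \<Rightarrow> complex"
    by (rule vector_space_pair_mat)
  obtain B where B: "B \<subseteq> S" "mat.independent B" "S \<subseteq> mat.span B"
    by (rule mat.maximal_independent_subset[of S])
  then have zB: "z \<notin> mat.span B"
    using z mat.span_mono[OF B(1)] by blast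
  then have "mat.independent (insert z B)"
    using B(2) by (simp add: mat.independent_insertI)
  then obtain g where g: "Vector_Spaces.linear mat_scale (*) g"
      "\<forall>x\<in>insert z B. g x = (if x = z then 1 else 0)"
    using linear_independent_extend[of "insert z B" "\<lambda>x. if x = z then 1 else 0"] by blast
  have "z \<notin> B" using zB mat.span_base by blast
  then have "\<forall>x\<in>B. g x = 0" using g(2) by auto
  then have "g x = 0" if "x \<in> mat.span B" for x
    using linear_eq_0_on_span[OF g(1) _ that] by blast
  then have "g z = 0"
    using assms[of g] g(1) B(3) by (auto simp: clin_iff_linear)
  then show False using g(2) by auto
qed

lemma eq_zero_if_functionals:
  assumes "\<And>f. clin f \<Longrightarrow> f z = 0"
  shows "z = 0"
proof -
  have "z \<in> mat.span {}"
    by (rule in_span_if_functionals) (rule assms)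
  then show ?thesis by simp
qed

section \<open>Matrix relations and associativity\<close>

text \<open>The sum starts at 1: index 0 is reserved for the unit, whose contribution is carried by
  \<open>c\<close>.\<close>

definition tensor_op :: "nat \<Rightarrow> (nat \<Rightarrow> complex^'n^'n) \<Rightarrow> (nat \<Rightarrow> complex^'n^'n) \<Rightarrow> complex^'n^'n \<Rightarrow>
    complex^'n^'n \<Rightarrow> complex^'n^'n" where
  "tensor_op p a b c x = (\<Sum>i=1..p. a i ** x ** b i) + c ** x"

lemma mlin_tensor_op: "mlin (tensor_op p a b c)"
  by (simp add: mlin_def tensor_op_def matmul_expand sum.distrib mat_scale_expand)

lemma M_product_coboundary:
  "M_product p a b c x y =
    tensor_op p a b c x ** y + x ** tensor_op p a b c y - tensor_op p a b c (x ** y)"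
  by (simp add: M_product_def tensor_op_def matmul_expand sum.distrib sum_subtractf)

text \<open>N measures how far T is from being a homomorphism from F to the matrix product, and the
  right-hand side is its Hochschild differential. So F is associative exactly when N is a cocycle.
  That F, being a coboundary, is a cocycle enters through the term
  \<open>T (F x y ** z - x ** F y z)\<close>.\<close>

lemma coboundary_associator:
  assumes T: "mlin T"
    and F: "\<And>x y. F x y = T x ** y + x ** T y - T (x ** y)"
    and N: "\<And>x y. N x y = T x ** T y - T (F x y)"
  shows "F (F x y) z - F x (F y z) = x ** N y z - N (x ** y) z + N x (y ** z) - N x y ** z"
proof -
  have cocycle: "F x y ** z - x ** F y z = F x (y ** z) - F (x ** y) z"
    by (simp add: F matmul_expand algebra_simps)
  have "F (F x y) z - F x (F y z) = T (F x y) ** z + F x y ** T z - T x ** F y z - x ** T (F y z)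
      - T (F x y ** z - x ** F y z)"
    by (simp only: F[of "F x y" z] F[of x "F y z"] mlin_diff[OF T]) (simp add: algebra_simps)
  also have "\<dots> = T (F x y) ** z + F x y ** T z - T x ** F y z - x ** T (F y z)
      - (T (F x (y ** z)) - T (F (x ** y) z))"
    by (simp only: cocycle mlin_diff[OF T])
  also have "\<dots> = x ** N y z - N (x ** y) z + N x (y ** z) - N x y ** z"
    by (simp only: N F matmul_expand) (simp add: algebra_simps F matmul_expand)
  finally show ?thesis .
qed

text \<open>The associator of the product combined with the parameter c is a polynomial in c: the
  constant term vanishes for matrices, the linear coefficient is the cocycle defect, the quadratic
  one is the associator of F. Once F is associative, the single value c = 1 decides.\<close>

lemma assoc_product_compatible_iff:
  "F \<in> assoc_products_compatible_with_mult \<longleftrightarrow> mbilin F \<and>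
     (\<forall>x y z. F (F x y) z = F x (F y z)) \<and>
     (\<forall>x y z. F (x ** y) z + F x y ** z = F x (y ** z) + x ** F y z)"
  (is "_ \<longleftrightarrow> _ \<and> ?assoc \<and> ?cocycle")
proof -
  have bil: "bilinear_on mat_scale mat_scale mat_scale UNIV UNIV F \<longleftrightarrow> mbilin F"
    by (auto simp: bilinear_on_def mbilin_def mlin_def)
  have "compatible_products (**) F \<longleftrightarrow> ?cocycle" if F: "mbilin F" and assoc: ?assoc
  proof -
    have F1: "mlin (\<lambda>x. F x y)" and F2: "mlin (F x)" for x y
      using F by (auto simp: mbilin_def)
    define G where "G c x y = x ** y + mat_scale c (F x y)" for c x y
    have G: "G c (G c x y) z - G c x (G c y z)
        = mat_scale c (F (x ** y) z + F x y ** z - (F x (y ** z) + x ** F y z))" for c x y z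
      unfolding G_def
      by (simp add: mlin_add[OF F1] mlin_add[OF F2] mlin_scale[OF F1] mlin_scale[OF F2]
          matmul_expand mat_scale_expand assoc)
    show ?thesis
    proof
      assume "compatible_products (**) F"
      then have "G 1 (G 1 x y) z = G 1 x (G 1 y z)" for x y z
        unfolding compatible_products_def assoc_on_def G_def by blast
      then show ?cocycle using G[of 1] by (simp add: algebra_simps)
    next
      assume ?cocycle
      then have "G c (G c x y) z - G c x (G c y z) = 0" for c x y z
        unfolding G by simp
      then show "compatible_products (**) F"
        by (simp add: compatible_products_def assoc_on_def G_def)
    qed
  qed
  then show ?thesis
    by (auto simp: assoc_products_compatible_with_mult_def bil assoc_on_def)
qed

lemma sum_atLeast0_atMost: "sum f {0..p} = f 0 + sum f {1..p::nat}"
  by (simp add: sum.atLeast_Suc_atMost)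

lemma sum_rotate3:
  "(\<Sum>i\<in>I. \<Sum>k\<in>K. \<Sum>l\<in>L. g i k l) = (\<Sum>k\<in>K. \<Sum>l\<in>L. \<Sum>i\<in>I. g i k l)"
  by (subst sum.swap) (intro sum.cong refl sum.swap)

lemma sum_rotate4:
  "(\<Sum>j\<in>J. \<Sum>i\<in>I. \<Sum>k\<in>K. \<Sum>l\<in>L. g j i k l) = (\<Sum>k\<in>K. \<Sum>l\<in>L. \<Sum>j\<in>J. \<Sum>i\<in>I. g j i k l)"
proof -
  have "(\<Sum>j\<in>J. \<Sum>i\<in>I. \<Sum>k\<in>K. \<Sum>l\<in>L. g j i k l) = (\<Sum>j\<in>J. \<Sum>k\<in>K. \<Sum>l\<in>L. \<Sum>i\<in>I. g j i k l)"
    by (rule sum.cong[OF refl], rule sum_rotate3)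
  also have "\<dots> = (\<Sum>k\<in>K. \<Sum>l\<in>L. \<Sum>j\<in>J. \<Sum>i\<in>I. g j i k l)"
    by (rule sum_rotate3)
  finally show ?thesis .
qed

text \<open>All terms in which \<open>c\<close> has an \<open>a j\<close> or another
  \<open>c\<close> to its left cancel, and so do the two copies of \<open>c ** x ** T y\<close>. The
  rest is sorted by slots: products \<open>b i ** a j\<close> and \<open>b i ** c\<close> between x
  and y, products \<open>a j ** a i\<close> and \<open>c ** a i\<close> on the left, products
  \<open>b i ** b j\<close> on the right.\<close>

lemma tensor_op_defect:
  fixes x y :: "complex^'n^'n" and p a b c
  defines "T \<equiv> tensor_op p a b c"
  shows "T x ** T y - T (M_product p a b c x y) = (\<Sum>i\<in>{1..p}. \<Sum>j\<in>{1..p}. a i ** x ** (b i ** a j) ** y ** b j)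
        - (\<Sum>j\<in>{1..p}. \<Sum>i\<in>{1..p}. (a j ** a i) ** x ** b i ** y ** b j)
        - (\<Sum>j\<in>{1..p}. \<Sum>i\<in>{1..p}. a j ** x ** a i ** y ** (b i ** b j))
        - (\<Sum>j\<in>{1..p}. a j ** x ** c ** y ** b j) + (\<Sum>i\<in>{1..p}. a i ** x ** (b i ** c) ** y)
        - (\<Sum>i\<in>{1..p}. (c ** a i) ** x ** b i ** y)
        + (\<Sum>j\<in>{1..p}. \<Sum>i\<in>{1..p}. (a j ** a i) ** (x ** y) ** (b i ** b j))
        + (\<Sum>i\<in>{1..p}. (c ** a i) ** (x ** y) ** b i)"
proof -
  let ?I = "{1..p}"
  have T: "mlin T" by (simp add: T_def mlin_tensor_op)
  have R1: "T x ** T y = (\<Sum>i\<in>?I. \<Sum>j\<in>?I. a i ** x ** (b i ** a j) ** y ** b j)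
      + (\<Sum>i\<in>?I. a i ** x ** (b i ** c) ** y) + c ** x ** T y"
    unfolding T_def tensor_op_def matmul_add_left matmul_add_right
    by (simp add: matmul_sum_left) (simp add: matmul_sum_right matmul_assoc)
  have R2: "T (T x ** y) = (\<Sum>j\<in>?I. \<Sum>i\<in>?I. (a j ** a i) ** x ** b i ** y ** b j)
      + (\<Sum>j\<in>?I. a j ** c ** x ** y ** b j) + (\<Sum>i\<in>?I. (c ** a i) ** x ** b i ** y) + c ** c ** x ** y"
    by (simp add: T_def tensor_op_def matmul_expand sum.distrib)
  have R3: "T (x ** T y) = (\<Sum>j\<in>?I. \<Sum>i\<in>?I. a j ** x ** a i ** y ** (b i ** b j))
      + (\<Sum>j\<in>?I. a j ** x ** c ** y ** b j) + c ** x ** T y"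
    by (simp add: T_def tensor_op_def matmul_expand sum.distrib)
  have R4: "T (T (x ** y)) = (\<Sum>j\<in>?I. \<Sum>i\<in>?I. (a j ** a i) ** (x ** y) ** (b i ** b j))
      + (\<Sum>j\<in>?I. a j ** c ** x ** y ** b j) + (\<Sum>i\<in>?I. (c ** a i) ** (x ** y) ** b i) + c ** c ** x ** y"
    by (simp add: T_def tensor_op_def matmul_expand sum.distrib)
  show ?thesis
    unfolding M_product_coboundary T_def[symmetric] mlin_add[OF T] mlin_diff[OF T] R1 R2 R3 R4
    by (simp only: algebra_simps)
qed

text \<open>Minus the coefficient of \<open>a i\<close> in \<open>c ** a j\<close> and of
  \<open>b j\<close> in \<open>b i ** c\<close>. The double sum is the coefficient of
  \<open>a i ** z ** b j\<close> in the sum of all \<open>a k ** a l ** z ** b l ** b k\<close>.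
  Index 0 stands for the unit; \<open>t\<close> has a meaning for positive indices only, hence the
  case distinction.\<close>

definition contraction :: "nat \<Rightarrow> (nat \<Rightarrow> nat \<Rightarrow> nat \<Rightarrow> complex) \<Rightarrow> (nat \<Rightarrow> nat \<Rightarrow> nat \<Rightarrow> complex) \<Rightarrow>
    (nat \<Rightarrow> nat \<Rightarrow> complex) \<Rightarrow> nat \<Rightarrow> nat \<Rightarrow> complex" where
  "contraction p \<phi> \<psi> t i j = (if i = 0 \<or> j = 0 then 0 else t i j) + (\<Sum>k=1..p. \<Sum>l=1..p. \<phi> k l i * \<psi> l k j)"

text \<open>
  In the notation of the paper \<open>\<phi> i j k\<close> is \<open>\<phi>\<^sub>i\<^sub>j\<^sup>k\<close> for \<open>k \<ge> 1\<close> and \<open>\<mu>\<^sub>i\<^sub>j\<close> for \<open>k = 0\<close>,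
  \<open>\<psi> i j k\<close> is \<open>\<psi>\<^sup>i\<^sup>j\<^sub>k\<close> for \<open>k \<ge> 1\<close> and \<open>\<lambda>\<^sup>i\<^sup>j\<close> for \<open>k = 0\<close>.
\<close>

locale matrix_relations =
  fixes p :: nat and a b :: "nat \<Rightarrow> complex^'n^'n" and c :: "complex^'n^'n"
    and \<phi> \<psi> :: "nat \<Rightarrow> nat \<Rightarrow> nat \<Rightarrow> complex" and t :: "nat \<Rightarrow> nat \<Rightarrow> complex"
  assumes a0: "a 0 = mat 1" and b0: "b 0 = mat 1"
    and aa: "\<lbrakk>i \<in> {1..p}; j \<in> {1..p}\<rbrakk> \<Longrightarrow> a i ** a j = (\<Sum>k=0..p. mat_scale (\<phi> i j k) (a k))"
    and bb: "\<lbrakk>i \<in> {1..p}; j \<in> {1..p}\<rbrakk> \<Longrightarrow> b i ** b j = (\<Sum>k=0..p. mat_scale (\<psi> i j k) (b k))"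
    and ba: "\<lbrakk>i \<in> {1..p}; j \<in> {1..p}\<rbrakk> \<Longrightarrow> b i ** a j = (\<Sum>k=1..p. mat_scale (\<psi> k i j) (a k))
        + (\<Sum>k=1..p. mat_scale (\<phi> j k i) (b k)) + mat_scale (t i j) (mat 1) + (if i = j then c else 0)"
    and bc: "i \<in> {1..p} \<Longrightarrow> b i ** c = (\<Sum>k=1..p. mat_scale (\<psi> k i 0) (a k))
        - (\<Sum>j=0..p. mat_scale (contraction p \<phi> \<psi> t i j) (b j))"
    and ca: "j \<in> {1..p} \<Longrightarrow> c ** a j = (\<Sum>k=1..p. mat_scale (\<phi> j k 0) (b k))
        - (\<Sum>k=0..p. mat_scale (contraction p \<phi> \<psi> t k j) (a k))"
begin

text \<open>Once the relations are inserted, the defect N is the coboundary of \<open>- E\<close>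
  plus a multiple of the matrix product, which is the coboundary of the identity. Its differential
  vanishes, and with it the associator.\<close>

lemma associative_compatible: "M_product p a b c \<in> assoc_products_compatible_with_mult"
proof -
  let ?I = "{1..p}"
  define T where "T = tensor_op p a b c"
  define F where "F = M_product p a b c"
  define w where "w = contraction p \<phi> \<psi> t"
  \<comment> \<open>E collects the terms of N that contain x and y only through
    \<open>x ** y\<close>, apart from those in which an outer factor is 1.\<close>
  define E where "E x = (\<Sum>j\<in>?I. c ** a j ** x ** b j) + (\<Sum>j\<in>?I. \<Sum>k\<in>?I. mat_scale (w k j) (a k ** x ** b j))" for x
  define N where "N x y = T x ** T y - T (F x y)" for x y
  note ex = matmul_expand mat_scale_expand sum_atLeast0_atMost a0 b0 sum.distrib sum_subtractf
  have T: "mlin T" by (simp add: T_def mlin_tensor_op)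
  have F: "F x y = T x ** y + x ** T y - T (x ** y)" for x y
    by (simp add: F_def T_def M_product_coboundary)
  have E: "mlin E"
    by (simp add: mlin_def E_def matmul_expand mat_scale_expand sum.distrib mult.commute)
  have Nform: "N x y = E (x ** y) - E x ** y - x ** E y + mat_scale (w 0 0) (x ** y)" for x y
  proof -
    \<comment> \<open>Groups of terms that occur twice and cancel: \<open>U1\<close> in the products
      \<open>b a\<close> and \<open>b b\<close>, \<open>U2\<close> in \<open>b a\<close> and
      \<open>a a\<close>, \<open>L\<close> in \<open>b c\<close> and \<open>b b\<close>,
      \<open>Q\<close> in \<open>a a\<close> and in \<open>x ** E y\<close>.\<close>
    define U1 where "U1 = (\<Sum>i\<in>?I. \<Sum>j\<in>?I. \<Sum>k\<in>?I. mat_scale (\<psi> k i j) (a i ** x ** a k ** y ** b j))"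
    define U2 where "U2 = (\<Sum>i\<in>?I. \<Sum>j\<in>?I. \<Sum>k\<in>?I. mat_scale (\<phi> j k i) (a i ** x ** b k ** y ** b j))"
    define L where "L = (\<Sum>i\<in>?I. \<Sum>k\<in>?I. mat_scale (\<psi> k i 0) (a i ** x ** a k ** y))"
    define Q where "Q = (\<Sum>j\<in>?I. \<Sum>k\<in>?I. mat_scale (\<phi> j k 0) (x ** b k ** y ** b j))"
    have N1: "N x y = (\<Sum>i\<in>?I. \<Sum>j\<in>?I. a i ** x ** (b i ** a j) ** y ** b j)
        - (\<Sum>j\<in>?I. \<Sum>i\<in>?I. (a j ** a i) ** x ** b i ** y ** b j)
        - (\<Sum>j\<in>?I. \<Sum>i\<in>?I. a j ** x ** a i ** y ** (b i ** b j))
        - (\<Sum>j\<in>?I. a j ** x ** c ** y ** b j) + (\<Sum>i\<in>?I. a i ** x ** (b i ** c) ** y)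
        - (\<Sum>i\<in>?I. (c ** a i) ** x ** b i ** y)
        + (\<Sum>j\<in>?I. \<Sum>i\<in>?I. (a j ** a i) ** (x ** y) ** (b i ** b j))
        + (\<Sum>i\<in>?I. (c ** a i) ** (x ** y) ** b i)"
      unfolding N_def F_def T_def by (rule tensor_op_defect)
    have ba': "(\<Sum>i\<in>?I. \<Sum>j\<in>?I. a i ** x ** (b i ** a j) ** y ** b j) = U1 + U2
        + (\<Sum>i\<in>?I. \<Sum>j\<in>?I. mat_scale (t i j) (a i ** (x ** y) ** b j)) + (\<Sum>j\<in>?I. a j ** x ** c ** y ** b j)"
    proof -
      have "(\<Sum>i\<in>?I. \<Sum>j\<in>?I. a i ** x ** (if i = j then c else 0) ** y ** b j) = (\<Sum>i\<in>?I. a i ** x ** c ** y ** b i)"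
      proof (rule sum.cong[OF refl])
        fix i assume "i \<in> ?I"
        have "(\<Sum>j\<in>?I. a i ** x ** (if i = j then c else 0) ** y ** b j)
            = (\<Sum>j\<in>?I. if j = i then a i ** x ** c ** y ** b i else 0)"
          by (rule sum.cong) auto
        then show "(\<Sum>j\<in>?I. a i ** x ** (if i = j then c else 0) ** y ** b j) = a i ** x ** c ** y ** b i"
          using \<open>i \<in> ?I\<close> by simp
      qed
      then show ?thesis by (simp add: ba U1_def U2_def ex)
    qed
    have aa': "(\<Sum>j\<in>?I. \<Sum>i\<in>?I. (a j ** a i) ** x ** b i ** y ** b j) = U2 + Q"
    proof -
      have "(\<Sum>j\<in>?I. \<Sum>i\<in>?I. (a j ** a i) ** x ** b i ** y ** b j)
          = Q + (\<Sum>j\<in>?I. \<Sum>i\<in>?I. \<Sum>k\<in>?I. mat_scale (\<phi> j i k) (a k ** x ** b i ** y ** b j))"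
        by (simp add: aa ex Q_def)
      also have "(\<Sum>j\<in>?I. \<Sum>i\<in>?I. \<Sum>k\<in>?I. mat_scale (\<phi> j i k) (a k ** x ** b i ** y ** b j)) = U2"
        unfolding U2_def
        by (rule sym, subst sum.swap) (rule sum.cong[OF refl], rule sum.swap)
      finally show ?thesis by simp
    qed
    have bb': "(\<Sum>j\<in>?I. \<Sum>i\<in>?I. a j ** x ** a i ** y ** (b i ** b j)) = U1 + L"
    proof -
      have "(\<Sum>j\<in>?I. \<Sum>i\<in>?I. a j ** x ** a i ** y ** (b i ** b j))
          = L + (\<Sum>j\<in>?I. \<Sum>i\<in>?I. \<Sum>k\<in>?I. mat_scale (\<psi> i j k) (a j ** x ** a i ** y ** b k))"
        by (simp add: bb ex L_def)
      also have "(\<Sum>j\<in>?I. \<Sum>i\<in>?I. \<Sum>k\<in>?I. mat_scale (\<psi> i j k) (a j ** x ** a i ** y ** b k)) = U1"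
        unfolding U1_def by (rule sum.cong[OF refl], rule sum.swap)
      finally show ?thesis by simp
    qed
    have bc': "(\<Sum>i\<in>?I. a i ** x ** (b i ** c) ** y) = L - (\<Sum>i\<in>?I. mat_scale (w i 0) (a i ** x ** y))
        - (\<Sum>j\<in>?I. \<Sum>i\<in>?I. mat_scale (w i j) (a i ** x ** b j ** y))"
    proof -
      have "(\<Sum>j\<in>?I. \<Sum>i\<in>?I. mat_scale (w i j) (a i ** x ** b j ** y))
          = (\<Sum>i\<in>?I. \<Sum>j\<in>?I. mat_scale (w i j) (a i ** x ** b j ** y))"
        by (rule sum.swap)
      then show ?thesis by (simp add: bc L_def w_def ex)
    qed
    have f: "(\<Sum>j\<in>?I. \<Sum>i\<in>?I. (a j ** a i) ** z ** (b i ** b j))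
        = (\<Sum>k=0..p. \<Sum>l=0..p. mat_scale (\<Sum>j\<in>?I. \<Sum>i\<in>?I. \<phi> j i k * \<psi> i j l) (a k ** z ** b l))" for z
    proof -
      have "(\<Sum>j\<in>?I. \<Sum>i\<in>?I. (a j ** a i) ** z ** (b i ** b j))
          = (\<Sum>j\<in>?I. \<Sum>i\<in>?I. \<Sum>k=0..p. \<Sum>l=0..p. mat_scale (\<phi> j i k * \<psi> i j l) (a k ** z ** b l))"
        by (intro sum.cong refl) (simp add: aa bb matmul_sum_left, simp add: matmul_expand mat_scale_expand mult.commute)
      also have "\<dots> = (\<Sum>k=0..p. \<Sum>l=0..p. \<Sum>j\<in>?I. \<Sum>i\<in>?I. mat_scale (\<phi> j i k * \<psi> i j l) (a k ** z ** b l))"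
        by (rule sum_rotate4)
      finally show ?thesis by (simp add: mat.scale_sum_left)
    qed
    have g: "(\<Sum>i\<in>?I. \<Sum>j\<in>?I. mat_scale (t i j) (a i ** z ** b j))
        + (\<Sum>j\<in>?I. \<Sum>i\<in>?I. (a j ** a i) ** z ** (b i ** b j)) =
          (\<Sum>j\<in>?I. \<Sum>k\<in>?I. mat_scale (w k j) (a k ** z ** b j)) + (\<Sum>k\<in>?I. mat_scale (w k 0) (a k ** z))
          + (\<Sum>l\<in>?I. mat_scale (w 0 l) (z ** b l)) + mat_scale (w 0 0) z" for z
    proof -
      have "(\<Sum>k\<in>?I. \<Sum>j\<in>?I. mat_scale (t k j) (a k ** z ** b j))
        + (\<Sum>k\<in>?I. \<Sum>l\<in>?I. mat_scale (\<Sum>j\<in>?I. \<Sum>i\<in>?I. \<phi> j i k * \<psi> i j l) (a k ** z ** b l))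
        = (\<Sum>k\<in>?I. \<Sum>j\<in>?I. mat_scale (w k j) (a k ** z ** b j))"
        unfolding sum.distrib[symmetric] mat.scale_left_distrib[symmetric]
        by (intro sum.cong refl arg_cong2[of _ _ _ _ mat_scale]) (auto simp: w_def contraction_def)
      also have "\<dots> = (\<Sum>j\<in>?I. \<Sum>k\<in>?I. mat_scale (w k j) (a k ** z ** b j))"
        by (rule sum.swap)
      finally show ?thesis
        unfolding f by (simp add: sum_atLeast0_atMost a0 b0 sum.distrib w_def contraction_def)
    qed
    \<comment> \<open>The relation for \<open>c ** a j\<close> turns the left factor of each term of
      \<open>E y\<close> into a combination of the \<open>b k\<close> and 1, so that nothing remains
      to the left of x in \<open>x ** E y\<close>.\<close>
    have h: "x ** E y = Q - (\<Sum>l\<in>?I. mat_scale (w 0 l) (x ** y ** b l))"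
    proof -
      have "E y = (\<Sum>j\<in>?I. (c ** a j + (\<Sum>k\<in>?I. mat_scale (w k j) (a k))) ** y ** b j)"
        unfolding E_def by (simp add: ex)
      also have "\<dots> = (\<Sum>j\<in>?I. ((\<Sum>k\<in>?I. mat_scale (\<phi> j k 0) (b k)) - mat_scale (w 0 j) (mat 1)) ** y ** b j)"
        by (intro sum.cong refl arg_cong[of _ _ "\<lambda>u. u ** y ** b _"]) (simp add: ca sum_atLeast0_atMost a0 w_def)
      finally show ?thesis by (simp add: Q_def ex)
    qed
    have e: "E x ** y = (\<Sum>i\<in>?I. (c ** a i) ** x ** b i ** y) + (\<Sum>j\<in>?I. \<Sum>i\<in>?I. mat_scale (w i j) (a i ** x ** b j ** y))"
      by (simp add: E_def ex)
    have Ez: "E (x ** y) = (\<Sum>i\<in>?I. (c ** a i) ** (x ** y) ** b i) + (\<Sum>j\<in>?I. \<Sum>k\<in>?I. mat_scale (w k j) (a k ** (x ** y) ** b j))"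
      by (simp add: E_def)
    show ?thesis
      using g[of "x ** y"] unfolding N1 ba' aa' bb' bc' h e Ez
      by (simp add: matmul_assoc algebra_simps)
  qed
  have assoc: "F (F x y) z = F x (F y z)" for x y z
  proof -
    have "F (F x y) z - F x (F y z) = 0"
      unfolding coboundary_associator[OF T F N_def]
      unfolding Nform by (simp add: matmul_expand)
    then show ?thesis by simp
  qed
  have bil: "mbilin F"
    unfolding mbilin_def mlin_def
    by (simp add: F mlin_simps[OF T] matmul_expand mat_scale_expand)
  have "F (x ** y) z + F x y ** z = F x (y ** z) + x ** F y z" for x y z
    by (simp add: F matmul_expand)
  with assoc bil show ?thesis
    unfolding assoc_product_compatible_iff F_def[symmetric] by blast
qed

end

section \<open>Presentations with the fewest terms\<close>

definition left_right_term :: "complex^'n^'n \<Rightarrow> complex^'n^'n \<Rightarrow> complex^'n^'n \<Rightarrow> complex^'n^'n \<Rightarrow> complex^'n^'n" where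
  "left_right_term \<alpha> \<beta> x y = \<alpha> ** x ** \<beta> ** y + x ** \<alpha> ** y ** \<beta> - \<alpha> ** x ** y ** \<beta>"

lemma M_product_eq_sum: "M_product p a b c x y = (\<Sum>i=1..p. left_right_term (a i) (b i) x y) + x ** c ** y"
  by (simp add: M_product_def left_right_term_def)

text \<open>Apart from bilinearity, what matters are the last two rules: if one of the two matrices
  is 1, the term collapses to the other one placed between x and y. Unit components can therefore
  always be absorbed in \<open>c\<close>.\<close>

lemma left_right_term_lin:
  "left_right_term (\<alpha> + \<alpha>') \<beta> x y = left_right_term \<alpha> \<beta> x y + left_right_term \<alpha>' \<beta> x y"
  "left_right_term \<alpha> (\<beta> + \<beta>') x y = left_right_term \<alpha> \<beta> x y + left_right_term \<alpha> \<beta>' x y"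
  "left_right_term (mat_scale s \<alpha>) \<beta> x y = mat_scale s (left_right_term \<alpha> \<beta> x y)"
  "left_right_term \<alpha> (mat_scale s \<beta>) x y = mat_scale s (left_right_term \<alpha> \<beta> x y)"
  "left_right_term (mat 1) \<beta> x y = x ** \<beta> ** y"
  "left_right_term \<alpha> (mat 1) x y = x ** \<alpha> ** y"
  by (simp_all add: left_right_term_def matmul_expand mat_scale_expand)

lemma left_right_term_sum:
  "left_right_term (sum f I) \<beta> x y = (\<Sum>i\<in>I. left_right_term (f i) \<beta> x y)"
  "left_right_term \<alpha> (sum f I) x y = (\<Sum>i\<in>I. left_right_term \<alpha> (f i) x y)"
  by (simp_all add: left_right_term_def matmul_expand sum.distrib sum_subtractf)

lemma M_product_reindex:
  assumes "bij_betw h {1..q} J"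
  shows "(\<Sum>i\<in>J. left_right_term (a i) (b i) x y) + x ** c ** y = M_product q (a \<circ> h) (b \<circ> h) c x y"
  unfolding M_product_eq_sum sum.reindex_bij_betw[OF assms, symmetric] by simp

text \<open>Bilinearity spreads the \<open>k\<close>-th summand over the others: replacing
  \<open>a k\<close> by its combination adds multiples of \<open>b k\<close> to the other
  \<open>b i\<close>, and its unit part adds a multiple of \<open>b k\<close> to \<open>c\<close>.
  The same holds with the families exchanged.\<close>

lemma M_product_drop:
  fixes a b :: "nat \<Rightarrow> complex^'n^'n"
  assumes k: "k \<in> {1..p}"
    and dep: "a k = (\<Sum>i\<in>{1..p}-{k}. mat_scale (v i) (a i)) + mat_scale v0 (mat 1) \<or>
              b k = (\<Sum>i\<in>{1..p}-{k}. mat_scale (v i) (b i)) + mat_scale v0 (mat 1)"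
  shows "\<exists>a' b' c' :: _. M_product p a b c = M_product (p - 1) a' b' c'"
proof -
  let ?J = "{1..p} - {k}"
  have "card {1..p - 1} = card ?J" using k by simp
  then obtain h where h: "bij_betw h {1..p - 1} ?J"
    by (metis finite_Diff finite_atLeastAtMost finite_same_card_bij)
  have split: "M_product p a b c x y
      = left_right_term (a k) (b k) x y + (\<Sum>i\<in>?J. left_right_term (a i) (b i) x y) + x ** c ** y" for x y
    using k by (simp add: M_product_eq_sum sum.remove[of _ k])
  from dep show ?thesis
  proof
    assume ak: "a k = (\<Sum>i\<in>?J. mat_scale (v i) (a i)) + mat_scale v0 (mat 1)"
    have "M_product p a b c x y = (\<Sum>i\<in>?J. left_right_term (a i) (b i + mat_scale (v i) (b k)) x y)
        + x ** (c + mat_scale v0 (b k)) ** y" for x y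
      by (simp add: split ak left_right_term_lin left_right_term_sum sum.distrib matmul_expand)
    then have "M_product p a b c
        = M_product (p - 1) (a \<circ> h) ((\<lambda>i. b i + mat_scale (v i) (b k)) \<circ> h) (c + mat_scale v0 (b k))"
      unfolding M_product_reindex[OF h] by (intro ext)
    then show ?thesis by blast
  next
    assume bk: "b k = (\<Sum>i\<in>?J. mat_scale (v i) (b i)) + mat_scale v0 (mat 1)"
    have "M_product p a b c x y = (\<Sum>i\<in>?J. left_right_term (a i + mat_scale (v i) (a k)) (b i) x y)
        + x ** (c + mat_scale v0 (a k)) ** y" for x y
      by (simp add: split bk left_right_term_lin left_right_term_sum sum.distrib matmul_expand)
    then have "M_product p a b c
        = M_product (p - 1) ((\<lambda>i. a i + mat_scale (v i) (a k)) \<circ> h) (b \<circ> h) (c + mat_scale v0 (a k))"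
      unfolding M_product_reindex[OF h] by (intro ext)
    then show ?thesis by blast
  qed
qed

lemma dependent_unit_family:
  fixes a :: "nat \<Rightarrow> complex^'n^'n"
  assumes dep: "\<not> lin_indep_family mat_scale {0..p} a" and a0: "a 0 = mat 1"
  shows "\<exists>k\<in>{1..p}. \<exists>v v0. a k = (\<Sum>i\<in>{1..p}-{k}. mat_scale (v i) (a i)) + mat_scale v0 (mat 1)"
proof -
  obtain u j where u: "(\<Sum>i=0..p. mat_scale (u i) (a i)) = 0" and j: "j \<in> {0..p}" "u j \<noteq> 0"
    using dep by (auto simp: lin_indep_family_iff[OF mat.vector_space_axioms])
  have u': "mat_scale (u 0) (mat 1) + (\<Sum>i=1..p. mat_scale (u i) (a i)) = 0"
    using u by (simp add: sum_atLeast0_atMost a0)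
  \<comment> \<open>The unit alone satisfies no relation, so some matrix of positive index occurs
    and can be eliminated.\<close>
  have "\<exists>k\<in>{1..p}. u k \<noteq> 0"
  proof (rule ccontr)
    assume "\<not> ?thesis"
    then have z: "\<forall>k\<in>{1..p}. u k = 0" by blast
    then have "mat_scale (u 0) (mat 1 :: complex^'n^'n) = 0" using u' by simp
    then have "u 0 = 0" by simp
    with z j show False by (cases "j = 0") auto
  qed
  then obtain k where k: "k \<in> {1..p}" "u k \<noteq> 0" by blast
  have "mat_scale (u 0) (mat 1) + (mat_scale (u k) (a k) + (\<Sum>i\<in>{1..p}-{k}. mat_scale (u i) (a i))) = 0"
    using u' k(1) by (simp add: sum.remove[of _ k])
  then have "mat_scale (u k) (a k) = - (\<Sum>i\<in>{1..p}-{k}. mat_scale (u i) (a i)) - mat_scale (u 0) (mat 1)"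
    by (simp add: eq_neg_iff_add_eq_0 algebra_simps)
  then have "mat_scale (1 / u k) (mat_scale (u k) (a k))
      = mat_scale (1 / u k) (- (\<Sum>i\<in>{1..p}-{k}. mat_scale (u i) (a i)) - mat_scale (u 0) (mat 1))"
    by simp
  then have "a k = (\<Sum>i\<in>{1..p}-{k}. mat_scale (- (u i / u k)) (a i)) + mat_scale (- (u 0 / u k)) (mat 1)"
    using k(2) by (simp add: mat_scale_expand sum_negf)
  then show ?thesis
    by (intro bexI[OF _ k(1)] exI[of _ "\<lambda>i. - (u i / u k)"] exI[of _ "- (u 0 / u k)"])
qed

lemma M_product_exists:
  fixes T :: "complex^'n^'n \<Rightarrow> complex^'n^'n"
  assumes "mlin T" and F: "\<And>x y. F x y = T x ** y + x ** T y - T (x ** y)"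
  shows "\<exists>p a b c. F = M_product p a b c"
proof -
  obtain l m :: "'n \<times> 'n \<times> 'n \<Rightarrow> complex^'n^'n" where T: "\<And>x. T x = (\<Sum>q\<in>UNIV. l q ** x ** m q)"
    using mlin_tensor[OF assms(1)] by blast
  define N where "N = card (UNIV :: ('n \<times> 'n \<times> 'n) set)"
  obtain h where h: "bij_betw h {1..N} (UNIV :: ('n \<times> 'n \<times> 'n) set)"
    unfolding N_def using ex_bij_betw_nat_finite_1[of "UNIV :: ('n \<times> 'n \<times> 'n) set"] by auto
  have "T = tensor_op N (l \<circ> h) (m \<circ> h) 0"
    unfolding T tensor_op_def fun_eq_iff sum.reindex_bij_betw[OF h, symmetric] by simp
  then have "F = M_product N (l \<circ> h) (m \<circ> h) 0"
    by (intro ext) (simp only: F M_product_coboundary)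
  then show ?thesis by blast
qed

lemma M_product_minimal:
  fixes F :: "complex^'n^'n \<Rightarrow> complex^'n^'n \<Rightarrow> complex^'n^'n"
  assumes ex: "\<exists>p a b c. F = M_product p a b c"
  shows "\<exists>p a b c. F = M_product p a b c \<and> a 0 = mat 1 \<and> b 0 = mat 1 \<and>
    lin_indep_family mat_scale {0..p} a \<and> lin_indep_family mat_scale {0..p} b"
proof -
  define p where "p = (LEAST p. \<exists>a b c. F = M_product p a b c)"
  have "\<exists>a b c. F = M_product p a b c"
    unfolding p_def using ex by (rule LeastI_ex)
  then obtain a b c where F0: "F = M_product p a b c" by blast
  \<comment> \<open>Index 0 does not enter the product and is free to hold the unit.\<close>
  define a' where "a' = a(0 := mat 1)"
  define b' where "b' = b(0 := mat 1)"
  have F: "F = M_product p a' b' c"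
    unfolding F0 by (intro ext) (auto simp: M_product_eq_sum a'_def b'_def intro!: sum.cong)
  \<comment> \<open>A \<open>k\<close> in this range makes \<open>p\<close> positive, so that
    \<open>p - 1\<close> is really smaller.\<close>
  have min: "\<not> (\<exists>a b c. F = M_product (p - 1) a b c)" if "k \<in> {1..p}" for k
    using that not_less_Least[of "p - 1" "\<lambda>p. \<exists>a b c. F = M_product p a b c"] by (simp add: p_def[symmetric])
  have 1: "a' 0 = mat 1" "b' 0 = mat 1" by (simp_all add: a'_def b'_def)
  have "lin_indep_family mat_scale {0..p} a'"
  proof (rule ccontr)
    assume "\<not> ?thesis"
    from dependent_unit_family[OF this 1(1)] obtain k v v0 where k: "k \<in> {1..p}"
      and eq: "a' k = (\<Sum>i\<in>{1..p}-{k}. mat_scale (v i) (a' i)) + mat_scale v0 (mat 1)" by blast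
    then have "\<exists>a b d :: _. M_product p a' b' c = M_product (p - 1) a b d"
      by (intro M_product_drop[OF k disjI1[OF eq]])
    then show False using min[OF k] F by simp
  qed
  moreover have "lin_indep_family mat_scale {0..p} b'"
  proof (rule ccontr)
    assume "\<not> ?thesis"
    from dependent_unit_family[OF this 1(2)] obtain k v v0 where k: "k \<in> {1..p}"
      and eq: "b' k = (\<Sum>i\<in>{1..p}-{k}. mat_scale (v i) (b' i)) + mat_scale v0 (mat 1)" by blast
    then have "\<exists>a b d :: _. M_product p a' b' c = M_product (p - 1) a b d"
      by (intro M_product_drop[OF k disjI2[OF eq]])
    then show False using min[OF k] F by simp
  qed
  ultimately show ?thesis using F 1 by blast
qed

section \<open>From associativity to the quadratic relations\<close>

lemma lcontr_mult2:
  assumes "clin f"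
  shows "lcontr f (\<lambda>x. k ** (l ** (x ** m))) = mat_scale (f (k ** l)) m"
    and "lcontr f (\<lambda>x. k ** (l ** x)) = mat_scale (f (k ** l)) (mat 1)"
  using lcontr_mult[OF assms, of "k ** l" m] lcontr_mult'(2)[OF assms, of "k ** l"]
  by (simp_all add: matmul_assoc)

lemma rcontr_mult2:
  assumes "clin f"
  shows "rcontr f (\<lambda>x. k ** (l ** (x ** m))) = mat_scale (f m) (k ** l)"
    and "rcontr f (\<lambda>x. k ** (l ** x)) = mat_scale (f (mat 1)) (k ** l)"
  using rcontr_mult[OF assms, of "k ** l" m] rcontr_mult'(2)[OF assms, of "k ** l"]
  by (simp_all add: matmul_assoc)

text \<open>
  The associativity of the product says that its defect is a cocycle, hence the coboundary of some
  \<open>S = \<Sum> s \<otimes> r\<close>; here this tensor identity is contracted with \<open>f\<close> on the left and \<open>g\<close> on the right.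
\<close>

lemma contracted_associativity:
  fixes a b :: "nat \<Rightarrow> complex^'n^'n"
  assumes assoc: "\<And>x y z. M_product p a b c (M_product p a b c x y) z = M_product p a b c x (M_product p a b c y z)"
  shows "\<exists>Sl Sr. \<forall>f g. clin f \<longrightarrow> clin g \<longrightarrow>
    (\<Sum>i=1..p. \<Sum>j=1..p. mat_scale (f (a i) * g (b j)) (b i ** a j))
    - (\<Sum>j=1..p. \<Sum>i=1..p. mat_scale (f (a j ** a i) * g (b j)) (b i))
    - (\<Sum>j=1..p. \<Sum>i=1..p. mat_scale (f (a j) * g (b i ** b j)) (a i))
    - (\<Sum>j=1..p. mat_scale (f (a j) * g (b j)) c)
    + (\<Sum>i=1..p. mat_scale (f (a i) * g (mat 1)) (b i ** c))
    - (\<Sum>i=1..p. mat_scale (f (c ** a i) * g (mat 1)) (b i))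
    + mat_scale ((\<Sum>j=1..p. \<Sum>i=1..p. f (a j ** a i) * g (b i ** b j)) + (\<Sum>i=1..p. f (c ** a i) * g (b i))) (mat 1)
    = mat_scale (g (mat 1)) (Sl f) + mat_scale (f (mat 1)) (Sr g) - mat_scale (f (Sr g)) (mat 1)
    \<and> g (Sl f) = f (Sr g)"
proof -
  let ?I = "{1..p}"
  define T where "T = tensor_op p a b c"
  define F where "F = M_product p a b c"
  define N where "N x y = T x ** T y - T (F x y)" for x y
  have T: "mlin T" by (simp add: T_def mlin_tensor_op)
  have F: "F x y = T x ** y + x ** T y - T (x ** y)" for x y
    by (simp add: F_def T_def M_product_coboundary)
  have bil: "mbilin N"
    unfolding mbilin_def mlin_def N_def F
    by (simp add: mlin_simps[OF T] matmul_expand mat_scale_expand)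
  have "x ** N y z - N (x ** y) z + N x (y ** z) - N x y ** z = 0" for x y z
    unfolding coboundary_associator[OF T F N_def, symmetric] by (simp add: F_def assoc)
  then have "N (x ** y) z + N x y ** z = N x (y ** z) + x ** N y z" for x y z
    by (simp add: algebra_simps)
  from matrix_cocycle_coboundary[OF bil this] obtain S where S: "mlin S"
    and NS: "\<And>x y. N x y = S x ** y + x ** S y - S (x ** y)" by blast
  obtain s r :: "'n \<times> 'n \<times> 'n \<Rightarrow> complex^'n^'n" where sr: "\<And>x. S x = (\<Sum>q\<in>UNIV. s q ** x ** r q)"
    using mlin_tensor[OF S] by blast
  define Sl where "Sl f = (\<Sum>q\<in>UNIV. mat_scale (f (s q)) (r q))" for f
  define Sr where "Sr g = (\<Sum>q\<in>UNIV. mat_scale (g (r q)) (s q))" for g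
  \<comment> \<open>A term \<open>l ** x ** m ** y ** n\<close> is sent to its middle factor
    \<open>m\<close> with coefficient \<open>f l * g n\<close>. Terms in which x and y are adjacent
    have 1 in the middle.\<close>
  have "rcontr g (\<lambda>y. lcontr f (\<lambda>x. N x y)) = rcontr g (\<lambda>y. lcontr f (\<lambda>x. S x ** y + x ** S y - S (x ** y)))" for f g
    by (simp only: NS)
  note eq = this[unfolded N_def F_def T_def tensor_op_defect sr]
  show ?thesis
  proof (rule exI[of _ Sl], rule exI[of _ Sr], intro allI impI conjI)
    fix f g :: "complex^'n^'n \<Rightarrow> complex"
    assume f: "clin f" and g: "clin g"
    show "g (Sl f) = f (Sr g)"
      by (simp add: Sl_def Sr_def clin_sum f g clin_scale mult.commute)
    note con = lcontr_mult[OF f] lcontr_mult'[OF f] lcontr_mult2[OF f]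
      rcontr_mult[OF g] rcontr_mult'[OF g] rcontr_mult2[OF g]
      lcontr_lin lcontr_sum rcontr_lin rcontr_sum
    show "(\<Sum>i\<in>?I. \<Sum>j\<in>?I. mat_scale (f (a i) * g (b j)) (b i ** a j))
    - (\<Sum>j\<in>?I. \<Sum>i\<in>?I. mat_scale (f (a j ** a i) * g (b j)) (b i))
    - (\<Sum>j\<in>?I. \<Sum>i\<in>?I. mat_scale (f (a j) * g (b i ** b j)) (a i))
    - (\<Sum>j\<in>?I. mat_scale (f (a j) * g (b j)) c)
    + (\<Sum>i\<in>?I. mat_scale (f (a i) * g (mat 1)) (b i ** c))
    - (\<Sum>i\<in>?I. mat_scale (f (c ** a i) * g (mat 1)) (b i))
    + mat_scale ((\<Sum>j\<in>?I. \<Sum>i\<in>?I. f (a j ** a i) * g (b i ** b j)) + (\<Sum>i\<in>?I. f (c ** a i) * g (b i))) (mat 1)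
    = mat_scale (g (mat 1)) (Sl f) + mat_scale (f (mat 1)) (Sr g) - mat_scale (f (Sr g)) (mat 1)"
      using eq[of g f]
      by (simp add: matmul_sum_left matmul_sum_right matmul_assoc con Sl_def Sr_def clin_sum[OF f] clin_scale[OF f]
          mat.scale_sum_right mat.scale_sum_left mat.scale_left_distrib mult.commute add.assoc[symmetric])
  qed
qed

lemma sum_single:
  assumes "finite I" "l \<in> I" "\<And>j. j \<in> I \<Longrightarrow> j \<noteq> l \<Longrightarrow> H j = 0"
  shows "sum H I = H l"
proof -
  have "sum H I = sum H {l}"
    using assms by (intro sum.mono_neutral_right) auto
  then show ?thesis by simp
qed

lemma dual_expansion:
  assumes z: "z \<in> mat.span (a ` {0..p::nat})" and f: "\<And>k. clin (f k)"
    and dual: "\<And>k i. i \<in> {0..p} \<Longrightarrow> f k (a i) = (if k = i then 1 else 0)"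
  shows "z = (\<Sum>k=0..p. mat_scale (f k z) (a k))"
proof -
  obtain u where u: "z = (\<Sum>i=0..p. mat_scale (u i) (a i))"
    using z by (auto simp: span_family[OF mat.vector_space_axioms])
  have "f k z = u k" if "k \<in> {0..p}" for k
  proof -
    have "f k z = (\<Sum>i=0..p. u i * f k (a i))"
      by (simp add: u clin_sum[OF f] clin_scale[OF f])
    also have "\<dots> = (\<Sum>i=0..p. if k = i then u k else 0)"
      by (intro sum.cong) (auto simp: dual)
    also have "\<dots> = u k" using that by simp
    finally show ?thesis .
  qed
  then show ?thesis by (subst u) simp
qed

text \<open>The three-slot identity is tested with dual functionals. With \<open>g = be l\<close>
  and f free (\<open>conb\<close>), or \<open>f = al l\<close> and g free (\<open>cona\<close>), one
  outer slot loses its unit terms and the sums collapse to one index. Functionals that kill a family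
  show that its span is closed under products; dual ones then give \<open>b i ** a j\<close>; with
  these products known, the free functional gives the products with \<open>c\<close>.\<close>

lemma relations_if_associative:
  fixes a b :: "nat \<Rightarrow> complex^'n^'n"
  assumes assoc: "\<And>x y z. M_product p a b c (M_product p a b c x y) z = M_product p a b c x (M_product p a b c y z)"
    and a0: "a 0 = mat 1" and b0: "b 0 = mat 1"
    and inda: "lin_indep_family mat_scale {0..p} a" and indb: "lin_indep_family mat_scale {0..p} b"
  shows "\<exists>\<phi> \<psi> t. matrix_relations p a b c \<phi> \<psi> t"
proof -
  let ?I = "{1..p}"
  obtain al where al: "\<And>k. clin (al k)" and ala: "\<And>k i. i \<in> {0..p} \<Longrightarrow> al k (a i) = (if k = i then 1 else 0)"
    using dual_functionals[OF inda] by blast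
  obtain be where be: "\<And>k. clin (be k)" and beb: "\<And>k i. i \<in> {0..p} \<Longrightarrow> be k (b i) = (if k = i then 1 else 0)"
    using dual_functionals[OF indb] by blast
  have al1: "al k (mat 1) = (if k = 0 then 1 else 0)" and be1: "be k (mat 1) = (if k = 0 then 1 else 0)" for k
    using ala[of 0 k] beb[of 0 k] by (auto simp: a0 b0)
  obtain Sl Sr where con: "\<And>f g. clin f \<Longrightarrow> clin g \<Longrightarrow>
    (\<Sum>i\<in>?I. \<Sum>j\<in>?I. mat_scale (f (a i) * g (b j)) (b i ** a j))
    - (\<Sum>j\<in>?I. \<Sum>i\<in>?I. mat_scale (f (a j ** a i) * g (b j)) (b i))
    - (\<Sum>j\<in>?I. \<Sum>i\<in>?I. mat_scale (f (a j) * g (b i ** b j)) (a i))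
    - (\<Sum>j\<in>?I. mat_scale (f (a j) * g (b j)) c)
    + (\<Sum>i\<in>?I. mat_scale (f (a i) * g (mat 1)) (b i ** c))
    - (\<Sum>i\<in>?I. mat_scale (f (c ** a i) * g (mat 1)) (b i))
    + mat_scale ((\<Sum>j\<in>?I. \<Sum>i\<in>?I. f (a j ** a i) * g (b i ** b j)) + (\<Sum>i\<in>?I. f (c ** a i) * g (b i))) (mat 1)
    = mat_scale (g (mat 1)) (Sl f) + mat_scale (f (mat 1)) (Sr g) - mat_scale (f (Sr g)) (mat 1)"
    and SlSr: "\<And>f g. clin f \<Longrightarrow> clin g \<Longrightarrow> g (Sl f) = f (Sr g)"
    using contracted_associativity[OF assoc] by blast
  have ala': "al l (a j) = (if l = j then 1 else 0)" and beb': "be l (b j) = (if l = j then 1 else 0)"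
    if "j \<in> ?I" for l j
    using that by (simp_all add: ala beb)
  have conb: "(\<Sum>i\<in>?I. mat_scale (f (a i)) (b i ** a l)) - (\<Sum>i\<in>?I. mat_scale (f (a l ** a i)) (b i))
    - (\<Sum>j\<in>?I. \<Sum>i\<in>?I. mat_scale (f (a j) * be l (b i ** b j)) (a i)) - mat_scale (f (a l)) c
    + mat_scale ((\<Sum>j\<in>?I. \<Sum>i\<in>?I. f (a j ** a i) * be l (b i ** b j)) + f (c ** a l)) (mat 1)
    = mat_scale (f (mat 1)) (Sr (be l)) - mat_scale (f (Sr (be l))) (mat 1)" if l: "l \<in> ?I" and f: "clin f" for l f
  proof -
    have 0: "be l (mat 1) = 0" using l be1 by auto
    have 1: "(\<Sum>i\<in>?I. \<Sum>j\<in>?I. mat_scale (f (a i) * be l (b j)) (b i ** a j)) = (\<Sum>i\<in>?I. mat_scale (f (a i)) (b i ** a l))"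
      by (intro sum.cong refl trans[OF sum_single[OF _ l]]) (use l in \<open>auto simp: beb'\<close>)
    have 2: "(\<Sum>j\<in>?I. \<Sum>i\<in>?I. mat_scale (f (a j ** a i) * be l (b j)) (b i)) = (\<Sum>i\<in>?I. mat_scale (f (a l ** a i)) (b i))"
      by (rule trans[OF sum_single[OF _ l]]) (use l in \<open>auto simp: beb'\<close>)
    have 3: "(\<Sum>j\<in>?I. mat_scale (f (a j) * be l (b j)) c) = mat_scale (f (a l)) c"
      by (rule trans[OF sum_single[OF _ l]]) (use l in \<open>auto simp: beb'\<close>)
    have 4: "(\<Sum>i\<in>?I. f (c ** a i) * be l (b i)) = f (c ** a l)"
      by (rule trans[OF sum_single[OF _ l]]) (use l in \<open>auto simp: beb'\<close>)
    show ?thesis using con[OF f be[of l]] unfolding 0 1 2 3 4 by simp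
  qed
  have cona: "(\<Sum>j\<in>?I. mat_scale (g (b j)) (b l ** a j)) - (\<Sum>j\<in>?I. \<Sum>i\<in>?I. mat_scale (al l (a j ** a i) * g (b j)) (b i))
    - (\<Sum>i\<in>?I. mat_scale (g (b i ** b l)) (a i)) - mat_scale (g (b l)) c
    + mat_scale (g (mat 1)) (b l ** c) - (\<Sum>i\<in>?I. mat_scale (al l (c ** a i) * g (mat 1)) (b i))
    + mat_scale ((\<Sum>j\<in>?I. \<Sum>i\<in>?I. al l (a j ** a i) * g (b i ** b j)) + (\<Sum>i\<in>?I. al l (c ** a i) * g (b i))) (mat 1)
    = mat_scale (g (mat 1)) (Sl (al l)) - mat_scale (g (Sl (al l))) (mat 1)" if l: "l \<in> ?I" and g: "clin g" for l g
  proof -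
    have 0: "al l (mat 1) = 0" using l al1 by auto
    have 1: "(\<Sum>i\<in>?I. \<Sum>j\<in>?I. mat_scale (al l (a i) * g (b j)) (b i ** a j)) = (\<Sum>j\<in>?I. mat_scale (g (b j)) (b l ** a j))"
      by (rule trans[OF sum_single[OF _ l]]) (use l in \<open>auto simp: ala'\<close>)
    have 2: "(\<Sum>j\<in>?I. \<Sum>i\<in>?I. mat_scale (al l (a j) * g (b i ** b j)) (a i)) = (\<Sum>i\<in>?I. mat_scale (g (b i ** b l)) (a i))"
      by (rule trans[OF sum_single[OF _ l]]) (use l in \<open>auto simp: ala'\<close>)
    have 3: "(\<Sum>j\<in>?I. mat_scale (al l (a j) * g (b j)) c) = mat_scale (g (b l)) c"
      by (rule trans[OF sum_single[OF _ l]]) (use l in \<open>auto simp: ala'\<close>)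
    have 4: "(\<Sum>i\<in>?I. mat_scale (al l (a i) * g (mat 1)) (b i ** c)) = mat_scale (g (mat 1)) (b l ** c)"
      by (rule trans[OF sum_single[OF _ l]]) (use l in \<open>auto simp: ala'\<close>)
    show ?thesis using con[OF al[of l] g] unfolding 0 1 2 3 4 SlSr[OF al g] by simp
  qed
  have coeff_a: "al i (\<Sum>j\<in>?I. mat_scale (u j) (a j)) = u i" and coeff_b: "be i (\<Sum>j\<in>?I. mat_scale (u j) (b j)) = u i"
    if i: "i \<in> ?I" for i u
    unfolding clin_sum[OF al] clin_sum[OF be] clin_scale[OF al] clin_scale[OF be]
    by (rule trans[OF sum_single[OF _ i]]; use i in \<open>auto simp: ala' beb'\<close>)+
  have aspan: "a l ** a i \<in> mat.span (a ` {0..p})" if l: "l \<in> ?I" and i: "i \<in> ?I" for l i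
  proof (rule in_span_if_functionals)
    fix f :: "complex^'n^'n \<Rightarrow> complex"
    assume f: "clin f" and fa: "\<And>s. s \<in> a ` {0..p} \<Longrightarrow> f s = 0"
    have "f (a i) = 0" if "i \<in> {0..p}" for i using fa that by blast
    then have fa': "\<And>i. i \<in> ?I \<Longrightarrow> f (a i) = 0" and f1: "f (mat 1) = 0" by (auto simp: a0[symmetric])
    \<comment> \<open>As f kills all \<open>a i\<close>, the identity says that a combination of the
      \<open>b i\<close> is a multiple of 1. Reading its coefficient with \<open>be i\<close> gives
      \<open>f (a l ** a i) = 0\<close>.\<close>
    have "- (\<Sum>i\<in>?I. mat_scale (f (a l ** a i)) (b i))
      + mat_scale ((\<Sum>j\<in>?I. \<Sum>i\<in>?I. f (a j ** a i) * be l (b i ** b j)) + f (c ** a l)) (mat 1)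
      = - mat_scale (f (Sr (be l))) (mat 1)" (is "?x = ?y")
      using conb[OF l f] l by (simp add: fa' f1)
    then have "be i ?x = be i ?y" by simp
    then show "f (a l ** a i) = 0"
      using i be1[of i] by (simp only: clin_add[OF be] clin_uminus[OF be] coeff_b clin_scale[OF be]) simp
  qed
  have bspan: "b i ** b l \<in> mat.span (b ` {0..p})" if l: "l \<in> ?I" and i: "i \<in> ?I" for l i
  proof (rule in_span_if_functionals)
    fix g :: "complex^'n^'n \<Rightarrow> complex"
    assume g: "clin g" and gb: "\<And>s. s \<in> b ` {0..p} \<Longrightarrow> g s = 0"
    have "g (b i) = 0" if "i \<in> {0..p}" for i using gb that by blast
    then have gb': "\<And>i. i \<in> ?I \<Longrightarrow> g (b i) = 0" and g1: "g (mat 1) = 0" by (auto simp: b0[symmetric])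
    have "- (\<Sum>i\<in>?I. mat_scale (g (b i ** b l)) (a i))
      + mat_scale ((\<Sum>j\<in>?I. \<Sum>i\<in>?I. al l (a j ** a i) * g (b i ** b j)) + (\<Sum>i\<in>?I. al l (c ** a i) * g (b i))) (mat 1)
      = - mat_scale (g (Sl (al l))) (mat 1)" (is "?x = ?y")
      using cona[OF l g] l by (simp add: gb' g1)
    then have "al i ?x = al i ?y" by simp
    then show "g (b i ** b l) = 0"
      using i al1[of i] by (simp only: clin_add[OF al] clin_uminus[OF al] coeff_a clin_scale[OF al]) simp
  qed
  define \<phi> where "\<phi> i j k = al k (a i ** a j)" for i j k
  define \<psi> where "\<psi> i j k = be k (b i ** b j)" for i j k
  have aa: "a i ** a j = (\<Sum>k=0..p. mat_scale (\<phi> i j k) (a k))" if "i \<in> ?I" "j \<in> ?I" for i j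
    unfolding \<phi>_def by (rule dual_expansion[OF aspan[OF that] al ala])
  have bb: "b i ** b j = (\<Sum>k=0..p. mat_scale (\<psi> i j k) (b k))" if "i \<in> ?I" "j \<in> ?I" for i j
    unfolding \<psi>_def by (rule dual_expansion[OF bspan[OF that(2,1)] be beb])
  \<comment> \<open>Here \<open>f = al i\<close> kills the unit, so the unknown right-hand side is a
    multiple of 1 and only the coefficient of 1 stays undetermined.\<close>
  have "\<exists>\<tau>. b i ** a j = (\<Sum>k\<in>?I. mat_scale (\<psi> k i j) (a k)) + (\<Sum>k\<in>?I. mat_scale (\<phi> j k i) (b k))
      + mat_scale \<tau> (mat 1) + (if i = j then c else 0)" if i: "i \<in> ?I" and j: "j \<in> ?I" for i j
  proof -
    have 0: "al i (mat 1) = 0" using i al1 by auto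
    have 1: "(\<Sum>k\<in>?I. mat_scale (al i (a k)) (b k ** a j)) = b i ** a j"
      by (rule trans[OF sum_single[OF _ i]]) (use i in \<open>auto simp: ala'\<close>)
    have 2: "(\<Sum>k\<in>?I. \<Sum>l\<in>?I. mat_scale (al i (a k) * be j (b l ** b k)) (a l)) = (\<Sum>l\<in>?I. mat_scale (\<psi> l i j) (a l))"
      by (rule trans[OF sum_single[OF _ i]]) (use i in \<open>auto simp: ala' \<psi>_def\<close>)
    define d where "d = (if i = j then c else 0)"
    have 3: "mat_scale (al i (a j)) c = d"
      using j by (simp add: ala' d_def)
    show ?thesis
      using conb[OF j al[of i]]
      unfolding d_def[symmetric] 0 1 2 3 \<phi>_def[symmetric]
      by (intro exI[of _ "- ((\<Sum>k\<in>?I. \<Sum>l\<in>?I. \<phi> k l i * be j (b l ** b k)) + al i (c ** a j)) - al i (Sr (be j))"])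
        (simp add: mat.scale_left_diff_distrib mat.scale_left_distrib, simp add: algebra_simps)
  qed
  note ex_t = this
  define t where "t i j = (SOME \<tau>. b i ** a j = (\<Sum>k\<in>?I. mat_scale (\<psi> k i j) (a k)) + (\<Sum>k\<in>?I. mat_scale (\<phi> j k i) (b k))
      + mat_scale \<tau> (mat 1) + (if i = j then c else 0))" for i j
  have ba: "b i ** a j = (\<Sum>k\<in>?I. mat_scale (\<psi> k i j) (a k)) + (\<Sum>k\<in>?I. mat_scale (\<phi> j k i) (b k))
      + mat_scale (t i j) (mat 1) + (if i = j then c else 0)" if "i \<in> ?I" "j \<in> ?I" for i j
    unfolding t_def by (rule someI_ex[OF ex_t[OF that]])
  let ?w = "contraction p \<phi> \<psi> t"
  have ca: "c ** a j = (\<Sum>k\<in>?I. mat_scale (\<phi> j k 0) (b k)) - (\<Sum>k=0..p. mat_scale (?w k j) (a k))" if j: "j \<in> ?I" for j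
  proof -
    define M where "M = (\<Sum>k\<in>?I. mat_scale (\<phi> j k 0) (b k))"
    have main: "mat_scale ((\<Sum>k=0..p. ?w k j * f (a k)) + f (c ** a j)) (mat 1) - mat_scale (f (mat 1)) M
        = mat_scale (f (mat 1)) (Sr (be j)) - mat_scale (f (Sr (be j))) (mat 1)" if f: "clin f" for f
    proof -
      have 1: "(\<Sum>i\<in>?I. mat_scale (f (a i)) (b i ** a j))
          = (\<Sum>i\<in>?I. \<Sum>k\<in>?I. mat_scale (f (a i) * \<psi> k i j) (a k)) + (\<Sum>i\<in>?I. \<Sum>k\<in>?I. mat_scale (f (a i) * \<phi> j k i) (b k))
            + mat_scale (\<Sum>i\<in>?I. t i j * f (a i)) (mat 1) + mat_scale (f (a j)) c"
      proof -
        have "(\<Sum>i\<in>?I. mat_scale (f (a i)) (if i = j then c else 0)) = mat_scale (f (a j)) c"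
          by (rule trans[OF sum_single[OF _ j]]) (use j in auto)
        then show ?thesis
          using j by (simp add: ba mat_scale_expand sum.distrib mat.scale_sum_left mult.commute)
      qed
      have 2: "(\<Sum>i\<in>?I. mat_scale (f (a j ** a i)) (b i))
          = mat_scale (f (mat 1)) M + (\<Sum>k\<in>?I. \<Sum>i\<in>?I. mat_scale (f (a k) * \<phi> j i k) (b i))"
      proof -
        have "(\<Sum>i\<in>?I. mat_scale (f (a j ** a i)) (b i))
            = mat_scale (f (mat 1)) M + (\<Sum>i\<in>?I. \<Sum>k\<in>?I. mat_scale (f (a k) * \<phi> j i k) (b i))"
          using j by (simp add: aa clin_add[OF f] clin_sum[OF f] clin_scale[OF f] sum_atLeast0_atMost a0 M_def
             mat.scale_left_distrib sum.distrib mat.scale_sum_right mat.scale_sum_left mult.commute)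
        also have "(\<Sum>i\<in>?I. \<Sum>k\<in>?I. mat_scale (f (a k) * \<phi> j i k) (b i)) = (\<Sum>k\<in>?I. \<Sum>i\<in>?I. mat_scale (f (a k) * \<phi> j i k) (b i))"
          by (rule sum.swap)
        finally show ?thesis .
      qed
      have 4: "(\<Sum>l\<in>?I. \<Sum>i\<in>?I. f (a l ** a i) * \<psi> i l j) = (\<Sum>k=0..p. (\<Sum>l\<in>?I. \<Sum>i\<in>?I. \<phi> l i k * \<psi> i l j) * f (a k))"
      proof -
        have "(\<Sum>l\<in>?I. \<Sum>i\<in>?I. f (a l ** a i) * \<psi> i l j) = (\<Sum>l\<in>?I. \<Sum>i\<in>?I. \<Sum>k=0..p. \<phi> l i k * \<psi> i l j * f (a k))"
          by (intro sum.cong refl) (simp add: aa clin_sum[OF f] clin_scale[OF f] sum_distrib_left sum_distrib_right mult_ac)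
        also have "\<dots> = (\<Sum>k=0..p. \<Sum>l\<in>?I. \<Sum>i\<in>?I. \<phi> l i k * \<psi> i l j * f (a k))"
          by (rule sum_rotate3[symmetric])
        finally show ?thesis by (simp add: sum_distrib_right)
      qed
      have 5: "(\<Sum>k=0..p. ?w k j * f (a k)) = (\<Sum>i\<in>?I. t i j * f (a i)) + (\<Sum>l\<in>?I. \<Sum>i\<in>?I. f (a l ** a i) * \<psi> i l j)"
      proof -
        have "(\<Sum>k=0..p. (if k = 0 \<or> j = 0 then 0 else t k j) * f (a k)) = (\<Sum>i\<in>?I. t i j * f (a i))"
          unfolding sum_atLeast0_atMost using j by simp
        then show ?thesis
          unfolding 4 contraction_def by (simp only: distrib_right sum.distrib)
      qed
      show ?thesis
        using conb[OF j f] unfolding 1 2 5 \<psi>_def[symmetric]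
        by (simp add: mat.scale_left_distrib algebra_simps)
    qed
    \<comment> \<open>Since \<open>al 0\<close> is 1 at the unit, testing with it determines
      \<open>Sr (be j)\<close> up to a multiple of 1; put back into \<open>main\<close>, this
      multiple cancels for every f.\<close>
    obtain \<sigma> where Sr: "Sr (be j) = - M + mat_scale \<sigma> (mat 1)"
    proof
      have "al 0 (mat 1) = 1" using al1 by simp
      then show "Sr (be j) = - M + mat_scale ((\<Sum>k=0..p. ?w k j * al 0 (a k)) + al 0 (c ** a j) + al 0 (Sr (be j))) (mat 1)"
        using main[OF al[of 0]] by (simp add: mat.scale_left_distrib algebra_simps)
    qed
    have "f (c ** a j - (M - (\<Sum>k=0..p. mat_scale (?w k j) (a k)))) = 0" if f: "clin f" for f
    proof -
      have "mat_scale ((\<Sum>k=0..p. ?w k j * f (a k)) + f (c ** a j)) (mat 1) = mat_scale (f M) (mat 1 :: complex^'n^'n)"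
        using main[OF f] unfolding Sr
        by (simp add: clin_simps[OF f] mat_scale_expand mat.scale_left_diff_distrib mat.scale_left_distrib mult.commute)
      then have "(\<Sum>k=0..p. ?w k j * f (a k)) + f (c ** a j) = f M" by simp
      then show ?thesis by (simp add: clin_simps[OF f] eq_diff_eq add.commute)
    qed
    then have "c ** a j - (M - (\<Sum>k=0..p. mat_scale (?w k j) (a k))) = 0"
      by (rule eq_zero_if_functionals)
    then show ?thesis by (simp add: M_def)
  qed
  have bc: "b i ** c = (\<Sum>k\<in>?I. mat_scale (\<psi> k i 0) (a k)) - (\<Sum>j=0..p. mat_scale (?w i j) (b j))" if i: "i \<in> ?I" for i
  proof -
    define M where "M = (\<Sum>k\<in>?I. mat_scale (\<psi> k i 0) (a k))"
    \<comment> \<open>Unlike in the previous case the sought product occurs with the factor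
      \<open>g (mat 1)\<close>. It is kept in Y together with the coefficients
      \<open>al i (c ** a k)\<close>, which cancel at the end.\<close>
    define Y where "Y = b i ** c - (\<Sum>k\<in>?I. mat_scale (al i (c ** a k)) (b k)) - M"
    have main: "mat_scale ((\<Sum>k=0..p. ?w i k * g (b k)) + (\<Sum>k\<in>?I. al i (c ** a k) * g (b k))) (mat 1) + mat_scale (g (mat 1)) Y
        = mat_scale (g (mat 1)) (Sl (al i)) - mat_scale (g (Sl (al i))) (mat 1)" if g: "clin g" for g
    proof -
      have 1: "(\<Sum>j\<in>?I. mat_scale (g (b j)) (b i ** a j))
          = (\<Sum>k\<in>?I. \<Sum>j\<in>?I. mat_scale (g (b j) * \<psi> k i j) (a k)) + (\<Sum>j\<in>?I. \<Sum>k\<in>?I. mat_scale (\<phi> j k i * g (b j)) (b k))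
            + mat_scale (\<Sum>j\<in>?I. t i j * g (b j)) (mat 1) + mat_scale (g (b i)) c"
      proof -
        have "(\<Sum>j\<in>?I. mat_scale (g (b j)) (if i = j then c else 0)) = mat_scale (g (b i)) c"
          by (rule trans[OF sum_single[OF _ i]]) (use i in auto)
        moreover have "(\<Sum>j\<in>?I. \<Sum>k\<in>?I. mat_scale (g (b j) * \<psi> k i j) (a k)) = (\<Sum>k\<in>?I. \<Sum>j\<in>?I. mat_scale (g (b j) * \<psi> k i j) (a k))"
          by (rule sum.swap)
        ultimately show ?thesis
          using i by (simp add: ba mat_scale_expand sum.distrib mat.scale_sum_left mult.commute)
      qed
      have 3: "(\<Sum>k\<in>?I. mat_scale (g (b k ** b i)) (a k))
          = mat_scale (g (mat 1)) M + (\<Sum>k\<in>?I. \<Sum>j\<in>?I. mat_scale (g (b j) * \<psi> k i j) (a k))"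
        using i by (simp add: bb clin_add[OF g] clin_sum[OF g] clin_scale[OF g] sum_atLeast0_atMost b0 M_def
           mat.scale_left_distrib sum.distrib mat.scale_sum_right mat.scale_sum_left mult.commute)
      have 4: "(\<Sum>l\<in>?I. \<Sum>m\<in>?I. \<phi> l m i * g (b m ** b l)) = (\<Sum>k=0..p. (\<Sum>l\<in>?I. \<Sum>m\<in>?I. \<phi> l m i * \<psi> m l k) * g (b k))"
      proof -
        have "(\<Sum>l\<in>?I. \<Sum>m\<in>?I. \<phi> l m i * g (b m ** b l)) = (\<Sum>l\<in>?I. \<Sum>m\<in>?I. \<Sum>k=0..p. \<phi> l m i * \<psi> m l k * g (b k))"
          by (intro sum.cong refl) (simp add: bb clin_sum[OF g] clin_scale[OF g] sum_distrib_left sum_distrib_right mult_ac)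
        also have "\<dots> = (\<Sum>k=0..p. \<Sum>l\<in>?I. \<Sum>m\<in>?I. \<phi> l m i * \<psi> m l k * g (b k))"
          by (rule sum_rotate3[symmetric])
        finally show ?thesis by (simp add: sum_distrib_right)
      qed
      have 5: "(\<Sum>k=0..p. ?w i k * g (b k)) = (\<Sum>j\<in>?I. t i j * g (b j)) + (\<Sum>l\<in>?I. \<Sum>m\<in>?I. \<phi> l m i * g (b m ** b l))"
      proof -
        have "(\<Sum>k=0..p. (if i = 0 \<or> k = 0 then 0 else t i k) * g (b k)) = (\<Sum>j\<in>?I. t i j * g (b j))"
          unfolding sum_atLeast0_atMost using i by simp
        then show ?thesis
          unfolding 4 contraction_def by (simp only: distrib_right sum.distrib)
      qed
      show ?thesis
        using cona[OF i g] unfolding 1 3 5 \<phi>_def[symmetric] Y_def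
        by (simp add: mat_scale_expand mat.scale_left_distrib mult.commute algebra_simps)
    qed
    obtain \<sigma> where Sl: "Sl (al i) = Y + mat_scale \<sigma> (mat 1)"
    proof
      have "be 0 (mat 1) = 1" using be1 by simp
      then show "Sl (al i) = Y + mat_scale ((\<Sum>k=0..p. ?w i k * be 0 (b k)) + (\<Sum>k\<in>?I. al i (c ** a k) * be 0 (b k)) + be 0 (Sl (al i))) (mat 1)"
        using main[OF be[of 0]] by (simp add: mat.scale_left_distrib algebra_simps)
    qed
    have "g (b i ** c - (M - (\<Sum>k=0..p. mat_scale (?w i k) (b k)))) = 0" if g: "clin g" for g
    proof -
      have "mat_scale ((\<Sum>k=0..p. ?w i k * g (b k)) + (\<Sum>k\<in>?I. al i (c ** a k) * g (b k))) (mat 1) = mat_scale (- g Y) (mat 1 :: complex^'n^'n)"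
        using main[OF g] unfolding Sl
        by (simp add: clin_add[OF g] clin_scale[OF g] mat_scale_expand mat.scale_left_diff_distrib mat.scale_left_distrib mult.commute)
      then have "(\<Sum>k=0..p. ?w i k * g (b k)) + (\<Sum>k\<in>?I. al i (c ** a k) * g (b k)) = - g Y"
        by (simp only: mat.scale_cancel_right mat_one_neq_zero) simp
      then show ?thesis by (simp add: clin_simps[OF g] Y_def algebra_simps)
    qed
    then have "b i ** c - (M - (\<Sum>k=0..p. mat_scale (?w i k) (b k))) = 0"
      by (rule eq_zero_if_functionals)
    then show ?thesis by (simp add: M_def)
  qed
  have "matrix_relations p a b c \<phi> \<psi> t"
    by unfold_locales (fact a0 b0 aa bb ba bc ca)+
  then show ?thesis by blast
qed

section \<open>Uniqueness of the presentation\<close>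

declare One_nat_def [simp del]

text \<open>Both functionals kill the unit, so every term with 1 in an outer slot dies; only
  \<open>a i ** x ** y ** b i\<close> survives, with 1 in the middle. Hence the tensor formed by the
  \<open>a i\<close> and \<open>b i\<close>, modulo the unit in both factors, is an invariant of the
  product.\<close>

lemma M_product_contract:
  fixes a b :: "nat \<Rightarrow> complex^'n^'n"
  assumes f: "clin f" and g: "clin g" and "f (mat 1) = 0" "g (mat 1) = 0"
  shows "rcontr g (\<lambda>y. lcontr f (\<lambda>x. M_product p a b c x y)) = - mat_scale (\<Sum>i=1..p. f (a i) * g (b i)) (mat 1)"
proof -
  note con = lcontr_mult[OF f] lcontr_mult'[OF f] lcontr_mult2[OF f]
    rcontr_mult[OF g] rcontr_mult'[OF g] rcontr_mult2[OF g]
    lcontr_lin lcontr_sum rcontr_lin rcontr_sum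
  show ?thesis
    unfolding M_product_def by (simp add: matmul_assoc con assms(3,4) mat.scale_sum_left sum_negf)
qed

text \<open>The condition on g and h keeps the tensor of the two families unchanged; the shifts
  contribute only terms with 1 in an outer slot, which \<open>c\<close> compensates. The sign of
  \<open>u i * v i\<close> is due to writing the correction in the new \<open>a'\<close>,
  \<open>b'\<close>, each of which contains its shift already.\<close>

lemma M_product_change_basis:
  fixes a b :: "nat \<Rightarrow> complex^'n^'n"
  assumes a': "\<And>i. i \<in> {1..p'} \<Longrightarrow> a' i = (\<Sum>k=1..p. mat_scale (g i k) (a k)) + mat_scale (u i) (mat 1)"
    and b': "\<And>i. i \<in> {1..p'} \<Longrightarrow> b' i = (\<Sum>k=1..p. mat_scale (h i k) (b k)) + mat_scale (v i) (mat 1)"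
    and gh: "\<And>k l. k \<in> {1..p} \<Longrightarrow> l \<in> {1..p} \<Longrightarrow> (\<Sum>i=1..p'. g i k * h i l) = (if k = l then 1 else 0)"
  shows "M_product p' a' b' (c - (\<Sum>i=1..p'. mat_scale (u i) (b' i)) - (\<Sum>i=1..p'. mat_scale (v i) (a' i))
           + mat_scale (\<Sum>i=1..p'. u i * v i) (mat 1)) = M_product p a b c"
proof (intro ext)
  fix x y
  let ?D = "\<lambda>i. mat_scale (u i) (b' i) + mat_scale (v i) (a' i) - mat_scale (u i * v i) (mat 1)"
  have *: "left_right_term (a' i) (b' i) x y
      = (\<Sum>k=1..p. \<Sum>l=1..p. mat_scale (g i k * h i l) (left_right_term (a k) (b l) x y)) + x ** ?D i ** y"
    if "i \<in> {1..p'}" for i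
  proof -
    define \<alpha> where "\<alpha> = (\<Sum>k=1..p. mat_scale (g i k) (a k))"
    define \<beta> where "\<beta> = (\<Sum>k=1..p. mat_scale (h i k) (b k))"
    have "left_right_term \<alpha> \<beta> x y = (\<Sum>k=1..p. \<Sum>l=1..p. mat_scale (g i k * h i l) (left_right_term (a k) (b l) x y))"
      unfolding \<alpha>_def left_right_term_sum(1)
      by (simp add: \<beta>_def left_right_term_sum left_right_term_lin mat_scale_expand mult.commute)
    moreover have "left_right_term (a' i) (b' i) x y = left_right_term \<alpha> \<beta> x y + x ** ?D i ** y"
      unfolding a'[OF that] b'[OF that] \<alpha>_def[symmetric] \<beta>_def[symmetric]
      by (simp add: left_right_term_lin matmul_expand mat_scale_expand mult.commute)
    ultimately show ?thesis by simp
  qed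
  have "(\<Sum>i=1..p'. left_right_term (a' i) (b' i) x y)
      = (\<Sum>i=1..p'. \<Sum>k=1..p. \<Sum>l=1..p. mat_scale (g i k * h i l) (left_right_term (a k) (b l) x y))
        + (\<Sum>i=1..p'. x ** ?D i ** y)"
    by (simp add: * sum.distrib)
  also have "(\<Sum>i=1..p'. \<Sum>k=1..p. \<Sum>l=1..p. mat_scale (g i k * h i l) (left_right_term (a k) (b l) x y))
      = (\<Sum>k=1..p. \<Sum>l=1..p. mat_scale (\<Sum>i=1..p'. g i k * h i l) (left_right_term (a k) (b l) x y))"
    unfolding mat.scale_sum_left by (rule sum_rotate3)
  also have "\<dots> = (\<Sum>k=1..p. \<Sum>l=1..p. mat_scale (if k = l then 1 else 0) (left_right_term (a k) (b l) x y))"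
    by (intro sum.cong refl) (simp add: gh)
  also have "\<dots> = (\<Sum>k=1..p. left_right_term (a k) (b k) x y)"
  proof (intro sum.cong refl)
    fix k assume k: "k \<in> {1..p}"
    show "(\<Sum>l=1..p. mat_scale (if k = l then 1 else 0) (left_right_term (a k) (b l) x y)) = left_right_term (a k) (b k) x y"
      by (rule trans[OF sum_single[OF _ k]]) auto
  qed
  finally show "M_product p' a' b' (c - (\<Sum>i=1..p'. mat_scale (u i) (b' i)) - (\<Sum>i=1..p'. mat_scale (v i) (a' i))
           + mat_scale (\<Sum>i=1..p'. u i * v i) (mat 1)) x y = M_product p a b c x y"
    by (simp add: M_product_eq_sum matmul_expand mat.scale_sum_left sum.distrib sum_subtractf)
qed

text \<open>Two presentations of one product define the same tensor modulo units. Dual functionals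
  express each family by the other, the coefficient matrices are inverse to each other up to
  transposition, and the scalar parts which such functionals do not see are the shifts u and
  v.\<close>

lemma M_product_unique:
  fixes a b a' b' :: "nat \<Rightarrow> complex^'n^'n"
  assumes eq: "M_product p a b c = M_product p' a' b' c'"
    and unit: "a 0 = mat 1" "b 0 = mat 1" "a' 0 = mat 1" "b' 0 = mat 1"
    and ind: "lin_indep_family mat_scale {0..p} a" "lin_indep_family mat_scale {0..p} b"
      "lin_indep_family mat_scale {0..p'} a'" "lin_indep_family mat_scale {0..p'} b'"
  shows "p' = p \<and> (\<exists>g h u v.
    (\<forall>i\<in>{1..p}. a' i = (\<Sum>k=1..p. mat_scale (g i k) (a k)) + mat_scale (u i) (mat 1)) \<and>
    (\<forall>i\<in>{1..p}. b' i = (\<Sum>k=1..p. mat_scale (h i k) (b k)) + mat_scale (v i) (mat 1)) \<and>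
    (\<forall>k\<in>{1..p}. \<forall>l\<in>{1..p}. (\<Sum>i=1..p. g i k * h i l) = (if k = l then 1 else 0)) \<and>
    (\<forall>i\<in>{1..p}. \<forall>j\<in>{1..p}. (\<Sum>k=1..p. g i k * h j k) = (if i = j then 1 else 0)) \<and>
    c' = c - (\<Sum>i=1..p. mat_scale (u i) (b' i)) - (\<Sum>i=1..p. mat_scale (v i) (a' i))
           + mat_scale (\<Sum>i=1..p. u i * v i) (mat 1))"
proof -
  have con: "(\<Sum>i=1..p. f (a i) * g (b i)) = (\<Sum>i=1..p'. f (a' i) * g (b' i))"
    if "clin f" "clin g" "f (mat 1) = 0" "g (mat 1) = 0" for f g
    using M_product_contract[OF that, of p a b c] M_product_contract[OF that, of p' a' b' c'] by (simp add: eq)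
  obtain al where al: "\<And>k. clin (al k)" and ala: "\<And>k i. i \<in> {0..p} \<Longrightarrow> al k (a i) = (if k = i then 1 else 0)"
    using dual_functionals[OF ind(1)] by blast
  obtain be where be: "\<And>k. clin (be k)" and beb: "\<And>k i. i \<in> {0..p} \<Longrightarrow> be k (b i) = (if k = i then 1 else 0)"
    using dual_functionals[OF ind(2)] by blast
  obtain al' where al': "\<And>k. clin (al' k)" and ala': "\<And>k i. i \<in> {0..p'} \<Longrightarrow> al' k (a' i) = (if k = i then 1 else 0)"
    using dual_functionals[OF ind(3)] by blast
  obtain be' where be': "\<And>k. clin (be' k)" and beb': "\<And>k i. i \<in> {0..p'} \<Longrightarrow> be' k (b' i) = (if k = i then 1 else 0)"
    using dual_functionals[OF ind(4)] by blast
  have one: "k \<noteq> 0 \<Longrightarrow> al k (mat 1) = 0" "k \<noteq> 0 \<Longrightarrow> be k (mat 1) = 0"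
      "k \<noteq> 0 \<Longrightarrow> al' k (mat 1) = 0" "k \<noteq> 0 \<Longrightarrow> be' k (mat 1) = 0" for k
    using ala[of 0 k] beb[of 0 k] ala'[of 0 k] beb'[of 0 k] by (auto simp: unit)
  have pick: "(\<Sum>i=1..q. (if k = i then 1 else 0) * H i) = H k" "(\<Sum>i=1..q. H i * (if k = i then 1 else 0)) = H k"
    if k: "k \<in> {1..q}" for q k and H :: "nat \<Rightarrow> complex"
    by (rule trans[OF sum_single[OF _ k]]; use k in auto)+
  have L: "f (a i) = (\<Sum>k=1..p'. f (a' k) * be i (b' k))" if "clin f" "f (mat 1) = 0" "i \<in> {1..p}" for f i
    using con[OF that(1) be[of i] that(2)] that(3) by (simp add: one beb pick)
  have L': "f (a' i) = (\<Sum>k=1..p. f (a k) * be' i (b k))" if "clin f" "f (mat 1) = 0" "i \<in> {1..p'}" for f i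
    using con[OF that(1) be'[of i] that(2)] that(3) by (simp add: one beb' pick)
  have R': "f (b' i) = (\<Sum>k=1..p. al' i (a k) * f (b k))" if "clin f" "f (mat 1) = 0" "i \<in> {1..p'}" for f i
    using con[OF al'[of i] that(1) _ that(2)] that(3) by (simp add: one ala' pick)
  define g where "g i k = be' i (b k)" for i k
  define h where "h i k = al' i (a k)" for i k
  \<comment> \<open>Functionals that kill 1 determine a matrix up to a multiple of 1.\<close>
  have exp: "\<exists>u. z = w + mat_scale u (mat 1)" if "\<And>f. clin f \<Longrightarrow> f (mat 1) = 0 \<Longrightarrow> f z = f w" for z w :: "complex^'n^'n"
  proof -
    have "z - w \<in> mat.span {mat 1}"
      by (rule in_span_if_functionals) (use that in \<open>auto simp: clin_diff\<close>)
    then obtain u where "z - w = mat_scale u (mat 1)" by (auto simp: mat.span_singleton)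
    then show ?thesis by (intro exI[of _ u]) (simp add: algebra_simps)
  qed
  have "\<exists>u. a' i = (\<Sum>k=1..p. mat_scale (g i k) (a k)) + mat_scale u (mat 1)" if "i \<in> {1..p'}" for i
  proof (rule exp)
    fix f :: "complex^'n^'n \<Rightarrow> complex"
    assume f: "clin f" "f (mat 1) = 0"
    show "f (a' i) = f (\<Sum>k=1..p. mat_scale (g i k) (a k))"
      using L'[OF f that] by (simp add: clin_sum[OF f(1)] clin_scale[OF f(1)] g_def mult.commute)
  qed
  then have "\<forall>i. \<exists>u. i \<in> {1..p'} \<longrightarrow> a' i = (\<Sum>k=1..p. mat_scale (g i k) (a k)) + mat_scale u (mat 1)" by blast
  from choice[OF this] obtain u where a'u: "\<And>i. i \<in> {1..p'} \<Longrightarrow> a' i = (\<Sum>k=1..p. mat_scale (g i k) (a k)) + mat_scale (u i) (mat 1)" by blast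
  have "\<exists>v. b' i = (\<Sum>k=1..p. mat_scale (h i k) (b k)) + mat_scale v (mat 1)" if "i \<in> {1..p'}" for i
  proof (rule exp)
    fix f :: "complex^'n^'n \<Rightarrow> complex"
    assume f: "clin f" "f (mat 1) = 0"
    show "f (b' i) = f (\<Sum>k=1..p. mat_scale (h i k) (b k))"
      using R'[OF f that] by (simp add: clin_sum[OF f(1)] clin_scale[OF f(1)] h_def mult.commute)
  qed
  then have "\<forall>i. \<exists>v. i \<in> {1..p'} \<longrightarrow> b' i = (\<Sum>k=1..p. mat_scale (h i k) (b k)) + mat_scale v (mat 1)" by blast
  from choice[OF this] obtain v where b'v: "\<And>i. i \<in> {1..p'} \<Longrightarrow> b' i = (\<Sum>k=1..p. mat_scale (h i k) (b k)) + mat_scale (v i) (mat 1)" by blast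
  have *: "(\<Sum>k=1..p. g i k * h j k) = (if i = j then 1 else 0)" if "i \<in> {1..p'}" "j \<in> {1..p'}" for i j
    using con[OF al'[of j] be'[of i]] that by (simp add: one ala' beb' pick g_def h_def mult.commute)
  have coeff: "al k (a' i) = g i k" "be k (b' i) = h i k" if "i \<in> {1..p'}" "k \<in> {1..p}" for i k
    using L'[OF al[of k] _ that(1)] R'[OF be[of k] _ that(1)] that by (simp_all add: one ala beb pick g_def h_def)
  have **: "(\<Sum>i=1..p'. g i k * h i l) = (if k = l then 1 else 0)" if "k \<in> {1..p}" "l \<in> {1..p}" for k l
    using con[OF al[of k] be[of l]] that by (cases "k = l") (auto simp: one ala beb pick coeff)
  \<comment> \<open>Completed by the unit, both families are bases of the same space.\<close>
  have "p' = p"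
  proof -
    have "a' i \<in> mat.span (a ` {0..p})" if "i \<in> {0..p'}" for i
    proof (cases "i = 0")
      case True
      then show ?thesis by (metis unit(1,3) atLeastAtMost_iff image_eqI le0 mat.span_base)
    next
      case False
      then have "i \<in> {1..p'}" using that by auto
      moreover have "mat 1 \<in> mat.span (a ` {0..p})" by (metis unit(1) atLeastAtMost_iff image_eqI le0 mat.span_base)
      ultimately show ?thesis unfolding a'u[OF \<open>i \<in> {1..p'}\<close>]
        by (intro mat.span_add mat.span_sum mat.span_scale) (auto intro: mat.span_base)
    qed
    then have s1: "a' ` {0..p'} \<subseteq> mat.span (a ` {0..p})" by auto
    have "a i \<in> mat.span (a' ` {0..p'})" if "i \<in> {0..p}" for i
    proof (cases "i = 0")
      case True
      then show ?thesis by (metis unit(1,3) atLeastAtMost_iff image_eqI le0 mat.span_base)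
    next
      case False
      then have i: "i \<in> {1..p}" using that by auto
      have "\<exists>w. a i = (\<Sum>k=1..p'. mat_scale (be i (b' k)) (a' k)) + mat_scale w (mat 1)"
      proof (rule exp)
        fix f :: "complex^'n^'n \<Rightarrow> complex"
        assume f: "clin f" "f (mat 1) = 0"
        show "f (a i) = f (\<Sum>k=1..p'. mat_scale (be i (b' k)) (a' k))"
          using L[OF f i] by (simp add: clin_sum[OF f(1)] clin_scale[OF f(1)] mult.commute)
      qed
      then obtain w where "a i = (\<Sum>k=1..p'. mat_scale (be i (b' k)) (a' k)) + mat_scale w (mat 1)" by blast
      moreover have "mat 1 \<in> mat.span (a' ` {0..p'})" by (metis unit(3) atLeastAtMost_iff image_eqI le0 mat.span_base)
      ultimately show ?thesis
        by (simp only:) (intro mat.span_add mat.span_sum mat.span_scale, auto intro: mat.span_base)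
    qed
    then have s2: "a ` {0..p} \<subseteq> mat.span (a' ` {0..p'})" by auto
    have "card (a ` {0..p}) \<le> card (a' ` {0..p'})"
      using mat.independent_span_bound[of "a' ` {0..p'}" "a ` {0..p}"] ind s2 by (simp add: lin_indep_family_def)
    moreover have "card (a' ` {0..p'}) \<le> card (a ` {0..p})"
      using mat.independent_span_bound[of "a ` {0..p}" "a' ` {0..p'}"] ind s1 by (simp add: lin_indep_family_def)
    ultimately show ?thesis using ind(1,3) by (simp add: lin_indep_family_def card_image)
  qed
  \<comment> \<open>The value prescribed by the change of basis. At x = y = 1 the products with
    \<open>c0\<close> and \<open>c'\<close> can differ only in this term, so equality of the
    products gives \<open>c0 = c'\<close>.\<close>
  define c0 where "c0 = c - (\<Sum>i=1..p'. mat_scale (u i) (b' i)) - (\<Sum>i=1..p'. mat_scale (v i) (a' i)) + mat_scale (\<Sum>i=1..p'. u i * v i) (mat 1)"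
  have "M_product p' a' b' c0 = M_product p' a' b' c'"
    unfolding c0_def eq[symmetric] by (rule M_product_change_basis[OF a'u b'v **])
  then have "M_product p' a' b' c0 (mat 1) (mat 1) = M_product p' a' b' c' (mat 1) (mat 1)" by simp
  then have "c0 = c'" by (simp add: M_product_eq_sum)
  then show ?thesis
    using a'u b'v * ** unfolding c0_def \<open>p' = p\<close> by blast
qed

section \<open>Adapted bases\<close>

context weak_M_structure
begin

lemma form_add_left: "\<lbrakk>v \<in> Lsp L; v' \<in> Lsp L; w \<in> Lsp L\<rbrakk> \<Longrightarrow> form L (v + v') w = form L v w + form L v' w"
  and form_add_right: "\<lbrakk>v \<in> Lsp L; w \<in> Lsp L; w' \<in> Lsp L\<rbrakk> \<Longrightarrow> form L v (w + w') = form L v w + form L v w'"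
  and form_scale_left: "\<lbrakk>v \<in> Lsp L; w \<in> Lsp L\<rbrakk> \<Longrightarrow> form L (sc c v) w = c * form L v w"
  and form_scale_right: "\<lbrakk>v \<in> Lsp L; w \<in> Lsp L\<rbrakk> \<Longrightarrow> form L v (sc c w) = c * form L v w"
  using form_bilinear by (auto simp: bilinear_on_def)

lemma L_closed: "0 \<in> Lsp L" "\<lbrakk>v \<in> Lsp L; w \<in> Lsp L\<rbrakk> \<Longrightarrow> v + w \<in> Lsp L"
    "\<lbrakk>v \<in> Lsp L; w \<in> Lsp L\<rbrakk> \<Longrightarrow> v - w \<in> Lsp L" "v \<in> Lsp L \<Longrightarrow> sc c v \<in> Lsp L"
    "v \<in> Lsp L \<Longrightarrow> - v \<in> Lsp L"
    "(\<And>i. i \<in> I \<Longrightarrow> f i \<in> Lsp L) \<Longrightarrow> sum f I \<in> Lsp L"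
  using subspace_L by (auto intro: subspace_0 subspace_add subspace_diff subspace_scale subspace_neg subspace_sum)

lemma form_zero: "w \<in> Lsp L \<Longrightarrow> form L 0 w = 0" "w \<in> Lsp L \<Longrightarrow> form L w 0 = 0"
  using form_scale_left[of 0 w 0] form_scale_right[of w 0 0] L_closed by auto

lemma form_sum_left: "\<lbrakk>\<And>i. i \<in> I \<Longrightarrow> f i \<in> Lsp L; w \<in> Lsp L\<rbrakk> \<Longrightarrow> form L (sum f I) w = (\<Sum>i\<in>I. form L (f i) w)"
  by (induction I rule: infinite_finite_induct) (auto simp: form_zero form_add_left L_closed)

lemma form_sum_right: "\<lbrakk>\<And>i. i \<in> I \<Longrightarrow> f i \<in> Lsp L; w \<in> Lsp L\<rbrakk> \<Longrightarrow> form L w (sum f I) = (\<Sum>i\<in>I. form L w (f i))"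
  by (induction I rule: infinite_finite_induct) (auto simp: form_zero form_add_right L_closed)

lemma form_diff_left: "\<lbrakk>v \<in> Lsp L; v' \<in> Lsp L; w \<in> Lsp L\<rbrakk> \<Longrightarrow> form L (v - v') w = form L v w - form L v' w"
  using form_add_left[of "v - v'" v' w] L_closed by simp

lemma form_diff_right: "\<lbrakk>v \<in> Lsp L; w \<in> Lsp L; w' \<in> Lsp L\<rbrakk> \<Longrightarrow> form L v (w - w') = form L v w - form L v w'"
  using form_add_right[of v "w - w'" w'] L_closed by simp

lemmas form_simps = form_add_left form_add_right form_diff_left form_diff_right
  form_scale_left form_scale_right form_sum_left form_sum_right form_zero

lemma A_in_L: "a \<in> Asp L \<Longrightarrow> a \<in> Lsp L" and B_in_L: "b \<in> Bsp L \<Longrightarrow> b \<in> Lsp L"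
  using subspace_A(2) subspace_B(2) by auto

lemma unit_in: "unit L \<in> Asp L" "unit L \<in> Bsp L" "unit L \<in> Lsp L"
  using unit_mem A_in_L by auto

lemma orthogonal_subspace: "w \<in> Lsp L \<Longrightarrow> subspace {x \<in> Lsp L. form L w x = 0}"
  by (rule subspaceI) (auto simp: form_simps L_closed)

text \<open>By isotropy the unit is orthogonal to A and to B, hence to their sum S, so C lies
  outside S. As S has codimension one, a vector outside the span of S and C would give too many
  independent vectors.\<close>

lemma span_codim:
  assumes C: "C \<in> Lsp L" "form L (unit L) C \<noteq> 0" and v: "v \<in> Lsp L"
  shows "\<exists>a\<in>Asp L. \<exists>b\<in>Bsp L. \<exists>k. v = a + b + sc k C"
proof -
  define S where "S = {a + b |a b. a \<in> Asp L \<and> b \<in> Bsp L}"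
  have S: "subspace S" unfolding S_def by (rule subspace_sums[OF subspace_A(1) subspace_B(1)])
  have SL: "S \<subseteq> Lsp L" by (auto simp: S_def A_in_L B_in_L L_closed)
  have "form L (unit L) s = 0" if "s \<in> S" for s
    using that by (auto simp: S_def form_simps unit_in A_in_L B_in_L form_AA form_BB)
  then have CS: "C \<notin> S" using C by auto
  obtain Y where Y: "Y \<subseteq> Lsp L" "independent Y" "Lsp L \<subseteq> span Y" "card Y = dim (Lsp L)"
    using basis_exists by blast
  obtain F where F: "finite F" "span F = Lsp L" using finite_dim by blast
  have finY: "finite Y" using independent_span_bound[OF F(1) Y(2)] Y(1) F(2) by auto
  obtain X where X: "X \<subseteq> S" "independent X" "S \<subseteq> span X" "card X = dim S"
    using basis_exists by blast
  have finX: "finite X" using independent_span_bound[OF F(1) X(2)] X(1) SL F(2) by auto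
  have spX: "span X = S" using X S by (simp add: span_subspace)
  have C1: "independent (insert C X)" using CS X(2) by (simp add: independent_insertI spX)
  have CX: "C \<notin> X" using CS X(1) by auto
  have "v \<in> span (insert C X)"
  proof (rule ccontr)
    assume nv: "v \<notin> span (insert C X)"
    then have "independent (insert v (insert C X))" by (simp add: independent_insertI C1)
    moreover have "insert v (insert C X) \<subseteq> span Y" using v C(1) X(1) SL Y(3) by auto
    ultimately have "card (insert v (insert C X)) \<le> card Y"
      using independent_span_bound[OF finY] by blast
    moreover have "v \<notin> insert C X" using nv span_base by blast
    ultimately show False
      using finX CX by (simp add: X(4) Y(4) codim_AB S_def[symmetric])
  qed
  then obtain k where "v - sc k C \<in> S" by (auto simp: span_breakdown_eq spX)
  then obtain a b where "a \<in> Asp L" "b \<in> Bsp L" "v - sc k C = a + b" by (auto simp: S_def)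
  then have "v = a + b + sc k C" by (simp add: eq_diff_eq[symmetric] diff_eq_eq)
  with \<open>a \<in> Asp L\<close> \<open>b \<in> Bsp L\<close> show ?thesis by blast
qed

text \<open>Both sides are the product of b, 1 and a: commuting actions give
  \<open>(b 1) a = b (1 a)\<close>. This makes the product of b and a accessible to the invariance
  of the form from either side.\<close>

lemma lact_A: "\<lbrakk>b \<in> Bsp L; a \<in> Asp L\<rbrakk> \<Longrightarrow> lact L b a = ract L b a"
proof -
  assume ba: "b \<in> Bsp L" "a \<in> Asp L"
  have "ract L (lact L b (unit L)) a = lact L b (ract L (unit L) a)"
    using ba unit_in by (intro actions_commute)
  then show ?thesis using ba unit_in by (simp add: lact_B ract_A mulB_unit mulA_unit)
qed

lemma form_lact_B: "\<lbrakk>b \<in> Bsp L; v \<in> Lsp L; b' \<in> Bsp L\<rbrakk> \<Longrightarrow> form L (lact L b v) b' = form L (mulB L b' b) v"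
  using form_lact[of b' b v] by (simp add: form_sym[of "lact L b v" b'] B_in_L lact_closed)

lemma form_ract_A: "\<lbrakk>a \<in> Asp L; v \<in> Lsp L; a' \<in> Asp L\<rbrakk> \<Longrightarrow> form L (ract L v a) a' = form L (mulA L a a') v"
  using form_ract[of v a a'] by (simp add: form_sym[of v] A_in_L mulA_closed)

lemma form_lact_unit: "\<lbrakk>b \<in> Bsp L; v \<in> Lsp L\<rbrakk> \<Longrightarrow> form L (lact L b v) (unit L) = form L b v"
  by (simp add: form_lact_B unit_in mulB_unit)

lemma form_ract_unit: "\<lbrakk>a \<in> Asp L; v \<in> Lsp L\<rbrakk> \<Longrightarrow> form L (ract L v a) (unit L) = form L a v"
  by (simp add: form_ract_A unit_in mulA_unit)

end

locale adapted_M_structure = weak_M_structure sc L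
  for sc :: "complex \<Rightarrow> 'v::ab_group_add \<Rightarrow> 'v" and L :: "'v M_data" +
  fixes p :: nat and A B :: "nat \<Rightarrow> 'v" and C :: 'v
  assumes adapted: "adapted_basis sc L p A B C"
begin

text \<open>C is the vector dual to the unit, so pairing with \<open>dualA k\<close> reads the
  coefficient at \<open>B k\<close> for all k, including the coefficient of 1 at k = 0. For elements
  of the subspace A, \<open>dualB\<close> does the same with respect to the
  \<open>A k\<close>.\<close>

definition dualA :: "nat \<Rightarrow> 'v" where "dualA k = (if k = 0 then C else A k)"
definition dualB :: "nat \<Rightarrow> 'v" where "dualB k = (if k = 0 then C else B k)"

lemma A0: "A 0 = unit L" and B0: "B 0 = unit L"
  and span_A: "span (A ` {0..p}) = Asp L" and span_B: "span (B ` {0..p}) = Bsp L"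
  and indep_A: "lin_indep_family sc {0..p} A" and indep_B: "lin_indep_family sc {0..p} B"
  and C_in: "C \<in> Lsp L"
  using adapted by (auto simp: adapted_basis_def)

lemma A_in: "i \<in> {0..p} \<Longrightarrow> A i \<in> Asp L" and B_in: "i \<in> {0..p} \<Longrightarrow> B i \<in> Bsp L"
  using span_A span_B span_base by blast+

lemma A_in': "i \<in> {1..p} \<Longrightarrow> A i \<in> Asp L" and B_in': "i \<in> {1..p} \<Longrightarrow> B i \<in> Bsp L"
  using A_in B_in by auto

lemma A_inL: "i \<in> {0..p} \<Longrightarrow> A i \<in> Lsp L" and B_inL: "i \<in> {0..p} \<Longrightarrow> B i \<in> Lsp L"
  using A_in B_in A_in_L B_in_L by auto

lemma form_A_A: "\<lbrakk>i \<in> {0..p}; j \<in> {0..p}\<rbrakk> \<Longrightarrow> form L (A i) (A j) = 0"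
  and form_B_B: "\<lbrakk>i \<in> {0..p}; j \<in> {0..p}\<rbrakk> \<Longrightarrow> form L (B i) (B j) = 0"
  by (simp_all add: form_AA form_BB A_in B_in)

lemma form_A_B: "\<lbrakk>i \<in> {0..p}; j \<in> {0..p}\<rbrakk> \<Longrightarrow> form L (A i) (B j) = (if i = j \<and> i \<noteq> 0 then 1 else 0)"
proof -
  assume ij: "i \<in> {0..p}" "j \<in> {0..p}"
  have "form L (A i) (B j) = 0" if "i = 0 \<or> j = 0"
    using that ij form_AA[of "A i" "unit L"] form_BB[of "unit L" "B j"]
    by (auto simp: A0 B0 unit_in A_in B_in)
  moreover have "form L (A i) (B j) = (if i = j then 1 else 0)" if "i \<noteq> 0" "j \<noteq> 0"
    using that ij adapted by (auto simp: adapted_basis_def)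
  ultimately show ?thesis by (cases "i = 0 \<or> j = 0") auto
qed

lemma form_B_A: "\<lbrakk>i \<in> {0..p}; j \<in> {0..p}\<rbrakk> \<Longrightarrow> form L (B i) (A j) = (if i = j \<and> i \<noteq> 0 then 1 else 0)"
  using form_A_B[of j i] form_sym[of "A j" "B i"] by (auto simp: A_inL B_inL)

lemma form_C: "form L C C = 0" "i \<in> {0..p} \<Longrightarrow> form L C (A i) = (if i = 0 then 1 else 0)"
    "i \<in> {0..p} \<Longrightarrow> form L C (B i) = (if i = 0 then 1 else 0)"
    "i \<in> {0..p} \<Longrightarrow> form L (A i) C = (if i = 0 then 1 else 0)"
    "i \<in> {0..p} \<Longrightarrow> form L (B i) C = (if i = 0 then 1 else 0)"
proof -
  show "form L C C = 0" using adapted by (auto simp: adapted_basis_def)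
  have u: "form L C (unit L) = 1"
    using adapted form_sym[of C "unit L"] unit_in by (auto simp: adapted_basis_def)
  show a: "form L C (A i) = (if i = 0 then 1 else 0)" "form L C (B i) = (if i = 0 then 1 else 0)" if "i \<in> {0..p}" for i
    using adapted u that by (auto simp: adapted_basis_def)
  show "form L (A i) C = (if i = 0 then 1 else 0)" "form L (B i) C = (if i = 0 then 1 else 0)" if "i \<in> {0..p}"
    using a[OF that] form_sym[of C] that by (auto simp: A_inL B_inL C_in)
qed

lemma orthogonal_zero:
  assumes w: "w \<in> Lsp L" and "\<And>i. i \<in> {0..p} \<Longrightarrow> form L w (A i) = 0"
    and "\<And>i. i \<in> {0..p} \<Longrightarrow> form L w (B i) = 0" and C: "form L w C = 0"
  shows "w = 0"
proof (rule form_nondeg[OF w])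
  fix x assume x: "x \<in> Lsp L"
  let ?O = "{x \<in> Lsp L. form L w x = 0}"
  have O: "subspace ?O" by (rule orthogonal_subspace[OF w])
  have "A ` {0..p} \<subseteq> ?O" "B ` {0..p} \<subseteq> ?O" using assms A_inL B_inL by auto
  then have AO: "Asp L \<subseteq> ?O" and BO: "Bsp L \<subseteq> ?O"
    unfolding span_A[symmetric] span_B[symmetric] using span_minimal[OF _ O] by auto
  have "form L (unit L) C = 1" using form_C(4)[of 0] by (simp add: A0)
  then obtain a b k where "a \<in> Asp L" "b \<in> Bsp L" "x = a + b + sc k C"
    using span_codim[OF C_in _ x] by auto
  moreover from this have "form L w a = 0" "form L w b = 0" using AO BO by auto
  ultimately show "form L w x = 0"
    using C w C_in by (simp add: form_add_right form_scale_right L_closed A_in_L B_in_L)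
qed

text \<open>The difference of both sides is orthogonal to all \<open>A i\<close>, all
  \<open>B i\<close> and C, hence zero by non-degeneracy. One sum starts at 1 and the other at 0 so
  that the unit is counted once.\<close>

lemma expansion:
  assumes v: "v \<in> Lsp L"
  shows "v = (\<Sum>k=1..p. sc (form L v (B k)) (A k)) + (\<Sum>k=0..p. sc (form L v (dualA k)) (B k)) + sc (form L v (unit L)) C"
    (is "v = ?e")
proof -
  define X where "X = (\<Sum>k=1..p. sc (form L v (B k)) (A k))"
  define Y where "Y = (\<Sum>k=1..p. sc (form L v (A k)) (B k))"
  have e: "?e = X + (sc (form L v C) (unit L) + Y) + sc (form L v (unit L)) C"
    by (simp add: X_def Y_def sum_atLeast0_atMost dualA_def B0)
  have XL: "X \<in> Lsp L" and YL: "Y \<in> Lsp L"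
    unfolding X_def Y_def by (intro L_closed; simp add: A_inL B_inL)+
  have X: "form L X w = (\<Sum>k=1..p. form L v (B k) * form L (A k) w)"
    and Y: "form L Y w = (\<Sum>k=1..p. form L v (A k) * form L (B k) w)" if "w \<in> Lsp L" for w
    unfolding X_def Y_def using that by (subst form_sum_left; auto simp: form_scale_left A_inL B_inL L_closed)+
  have XA: "form L X (A i) = 0" and YB: "form L Y (B i) = 0" if "i \<in> {0..p}" for i
    using that by (simp_all add: X Y A_inL B_inL form_A_A form_B_B)
  have XB: "form L X (B i) = (if i = 0 then 0 else form L v (B i))"
    and YA: "form L Y (A i) = (if i = 0 then 0 else form L v (A i))" if i: "i \<in> {0..p}" for i
  proof -
    have "(\<Sum>k=1..p. form L v (B k) * form L (A k) (B i)) = (if i = 0 then 0 else form L v (B i))"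
    proof (cases "i = 0")
      case True
      then show ?thesis by (simp add: form_A_B)
    next
      case False
      then have i': "i \<in> {1..p}" using i by auto
      show ?thesis by (rule trans[OF sum_single[OF _ i']]) (use i' in \<open>auto simp: form_A_B\<close>)
    qed
    moreover have "(\<Sum>k=1..p. form L v (A k) * form L (B k) (A i)) = (if i = 0 then 0 else form L v (A i))"
    proof (cases "i = 0")
      case True
      then show ?thesis by (simp add: form_B_A)
    next
      case False
      then have i': "i \<in> {1..p}" using i by auto
      show ?thesis by (rule trans[OF sum_single[OF _ i']]) (use i' in \<open>auto simp: form_B_A\<close>)
    qed
    ultimately show "form L X (B i) = (if i = 0 then 0 else form L v (B i))"
      "form L Y (A i) = (if i = 0 then 0 else form L v (A i))"
      using i by (simp_all add: X Y A_inL B_inL)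
  qed
  have XC: "form L X C = 0" and YC: "form L Y C = 0"
    by (simp_all add: X Y C_in form_C)
  have u: "form L (unit L) (A i) = 0" "form L (unit L) (B i) = 0" if "i \<in> {0..p}" for i
    using that form_A_A[of 0 i] form_B_B[of 0 i] by (auto simp: A0 B0)
  have uC: "form L (unit L) C = 1" using form_C(4)[of 0] by (simp add: A0)
  note in_L = XL YL A_inL B_inL C_in L_closed unit_in v
  have "v - (X + (sc (form L v C) (unit L) + Y) + sc (form L v (unit L)) C) = 0"
  proof (rule orthogonal_zero)
    show "v - (X + (sc (form L v C) (unit L) + Y) + sc (form L v (unit L)) C) \<in> Lsp L"
      by (simp add: in_L)
  next
    fix i assume i: "i \<in> {0..p}"
    show "form L (v - (X + (sc (form L v C) (unit L) + Y) + sc (form L v (unit L)) C)) (A i) = 0"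
      using i by (simp add: form_diff_left form_add_left form_scale_left in_L XA YA u form_C A0)
    show "form L (v - (X + (sc (form L v C) (unit L) + Y) + sc (form L v (unit L)) C)) (B i) = 0"
      using i by (simp add: form_diff_left form_add_left form_scale_left in_L XB YB u form_C B0)
  next
    show "form L (v - (X + (sc (form L v C) (unit L) + Y) + sc (form L v (unit L)) C)) C = 0"
      by (simp add: form_diff_left form_add_left form_scale_left in_L XC YC uC form_C)
  qed
  then show ?thesis unfolding e by simp
qed

definition \<phi> :: "nat \<Rightarrow> nat \<Rightarrow> nat \<Rightarrow> complex" where
  "\<phi> i j k = form L (mulA L (A i) (A j)) (dualB k)"

definition \<psi> :: "nat \<Rightarrow> nat \<Rightarrow> nat \<Rightarrow> complex" where
  "\<psi> i j k = form L (mulB L (B i) (B j)) (dualA k)"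

definition t :: "nat \<Rightarrow> nat \<Rightarrow> complex" where
  "t i j = form L (lact L (B i) (A j)) C"

lemma A_expansion:
  assumes a: "a \<in> Asp L" shows "a = (\<Sum>k=0..p. sc (form L a (dualB k)) (A k))"
proof -
  have "a = (\<Sum>k=1..p. sc (form L a (B k)) (A k)) + (\<Sum>k=0..p. sc (form L a (dualA k)) (B k)) + sc (form L a (unit L)) C"
    by (rule expansion[OF A_in_L[OF a]])
  moreover have "form L a (A k) = 0" if "k \<in> {1..p}" for k
    using that a by (simp add: form_AA A_in)
  moreover have "form L a (unit L) = 0" using a by (simp add: form_AA unit_in)
  ultimately show ?thesis
    by (simp add: sum_atLeast0_atMost dualA_def dualB_def A0 B0 add.commute)
qed

lemma B_expansion:
  assumes b: "b \<in> Bsp L" shows "b = (\<Sum>k=0..p. sc (form L b (dualA k)) (B k))"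
proof -
  have "b = (\<Sum>k=1..p. sc (form L b (B k)) (A k)) + (\<Sum>k=0..p. sc (form L b (dualA k)) (B k)) + sc (form L b (unit L)) C"
    by (rule expansion[OF B_in_L[OF b]])
  moreover have "form L b (B k) = 0" if "k \<in> {1..p}" for k
    using that b by (simp add: form_BB B_in)
  moreover have "form L b (unit L) = 0" using b by (simp add: form_BB unit_in)
  ultimately show ?thesis by simp
qed

lemma mulA_expansion: "\<lbrakk>i \<in> {1..p}; j \<in> {1..p}\<rbrakk> \<Longrightarrow> mulA L (A i) (A j) = (\<Sum>k=0..p. sc (\<phi> i j k) (A k))"
  unfolding \<phi>_def by (rule A_expansion) (simp add: mulA_closed A_in)

lemma mulB_expansion: "\<lbrakk>i \<in> {1..p}; j \<in> {1..p}\<rbrakk> \<Longrightarrow> mulB L (B i) (B j) = (\<Sum>k=0..p. sc (\<psi> i j k) (B k))"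
  unfolding \<psi>_def by (rule B_expansion) (simp add: mulB_closed B_in)

text \<open>Invariance of the form evaluates the coefficients:
  \<open>(B_i A_j, B_k) = (B_k B_i, A_j)\<close> gives \<psi>,
  \<open>(B_i A_j, A_k) = (A_j A_k, B_i)\<close> gives \<phi>, and
  \<open>(B_i A_j, 1) = (B_i, A_j)\<close> is the coefficient of C. Only the coefficient of the unit
  is new.\<close>

lemma lact_BA_expansion:
  assumes i: "i \<in> {1..p}" and j: "j \<in> {1..p}"
  shows "lact L (B i) (A j) = (\<Sum>k=1..p. sc (\<psi> k i j) (A k)) + (\<Sum>k=1..p. sc (\<phi> j k i) (B k))
    + sc (t i j) (unit L) + (if i = j then C else 0)"
proof -
  let ?v = "lact L (B i) (A j)"
  have v: "?v \<in> Lsp L" using i j by (simp add: lact_closed B_in A_inL)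
  have B: "form L ?v (B k) = \<psi> k i j" if "k \<in> {1..p}" for k
    using that i j by (simp add: form_lact_B \<psi>_def B_in A_inL dualA_def)
  have A: "form L ?v (A k) = \<phi> j k i" if "k \<in> {1..p}" for k
    using that i j by (simp add: lact_A form_ract_A \<phi>_def B_in A_in B_inL dualB_def)
  have u: "form L ?v (unit L) = (if i = j then 1 else 0)"
    using i j by (simp add: form_lact_unit B_in A_inL form_B_A)
  have "?v = (\<Sum>k=1..p. sc (form L ?v (B k)) (A k)) + (\<Sum>k=0..p. sc (form L ?v (dualA k)) (B k)) + sc (form L ?v (unit L)) C"
    by (rule expansion[OF v])
  moreover have "sc (form L ?v (unit L)) C = (if i = j then C else 0)" by (simp add: u)
  ultimately show ?thesis
    by (simp add: B A sum_atLeast0_atMost dualA_def t_def B0 add_ac)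
qed

text \<open>Here \<open>(B_i C, 1) = (B_i, C) = 0\<close> excludes C and invariance gives the
  coefficients along the \<open>A k\<close>. Those along the \<open>B k\<close> remain free in a
  weak M-structure; centrality of K will fix them.\<close>

lemma lact_BC_expansion:
  assumes i: "i \<in> {1..p}"
  shows "lact L (B i) C = (\<Sum>k=1..p. sc (\<psi> k i 0) (A k)) + (\<Sum>k=0..p. sc (form L (lact L (B i) C) (dualA k)) (B k))"
proof -
  let ?v = "lact L (B i) C"
  have v: "?v \<in> Lsp L" using i by (simp add: lact_closed B_in C_in)
  have B: "form L ?v (B k) = \<psi> k i 0" if "k \<in> {1..p}" for k
    using that i by (simp add: form_lact_B \<psi>_def B_in C_in dualA_def)
  have u: "form L ?v (unit L) = 0"
    using i by (simp add: form_lact_unit B_in C_in form_C)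
  have "?v = (\<Sum>k=1..p. sc (form L ?v (B k)) (A k)) + (\<Sum>k=0..p. sc (form L ?v (dualA k)) (B k)) + sc (form L ?v (unit L)) C"
    by (rule expansion[OF v])
  then show ?thesis by (simp add: B u)
qed

lemma ract_CA_expansion:
  assumes j: "j \<in> {1..p}"
  shows "ract L C (A j) = (\<Sum>k=1..p. sc (\<phi> j k 0) (B k)) + (\<Sum>k=0..p. sc (form L (ract L C (A j)) (dualB k)) (A k))"
proof -
  let ?v = "ract L C (A j)"
  have v: "?v \<in> Lsp L" using j by (simp add: ract_closed A_in C_in)
  have A: "form L ?v (A k) = \<phi> j k 0" if "k \<in> {1..p}" for k
    using that j by (simp add: form_ract_A \<phi>_def A_in C_in dualB_def)
  have u: "form L ?v (unit L) = 0"
    using j by (simp add: form_ract_unit A_in C_in form_C)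
  have "?v = (\<Sum>k=1..p. sc (form L ?v (B k)) (A k)) + (\<Sum>k=0..p. sc (form L ?v (dualA k)) (B k)) + sc (form L ?v (unit L)) C"
    by (rule expansion[OF v])
  then show ?thesis by (simp add: A u sum_atLeast0_atMost dualA_def dualB_def A0 B0 add_ac)
qed

end

section \<open>The weak M-algebra and its representations\<close>

lemma free_alg_simps [simp]:
  "mult (free_alg L) = (*)" "one (free_alg L) = 1" "zero (free_alg L) = 0" "add (free_alg L) = (+)"
  by (simp_all add: free_alg_def)

lemma free_alg_closed:
  "f \<in> carrier (free_alg L) \<Longrightarrow> g \<in> carrier (free_alg L) \<Longrightarrow> f + g \<in> carrier (free_alg L)"
  "f \<in> carrier (free_alg L) \<Longrightarrow> g \<in> carrier (free_alg L) \<Longrightarrow> f * g \<in> carrier (free_alg L)"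
  "0 \<in> carrier (free_alg L)" "1 \<in> carrier (free_alg L)" "scalar c \<in> carrier (free_alg L)"
  "v \<in> Lsp L \<Longrightarrow> gen v \<in> carrier (free_alg L)"
proof -
  assume fg: "f \<in> carrier (free_alg L)" "g \<in> carrier (free_alg L)"
  show "f + g \<in> carrier (free_alg L)"
    using fg keys_add[of f g] by (auto simp: free_alg_def)
  show "f * g \<in> carrier (free_alg L)"
    using fg keys_mult[of f g] by (fastforce simp: free_alg_def plus_list_def)
qed (auto simp: free_alg_def scalar_def gen_def zero_list_def)

lemma free_alg_uminus_closed: "f \<in> carrier (free_alg L) \<Longrightarrow> - f \<in> carrier (free_alg L)"
  by (auto simp: free_alg_def in_keys_iff)

lemma free_alg_diff_closed:
  "f \<in> carrier (free_alg L) \<Longrightarrow> g \<in> carrier (free_alg L) \<Longrightarrow> f - g \<in> carrier (free_alg L)"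
  using free_alg_closed(1)[of f L "- g"] free_alg_uminus_closed[of g L] by simp

lemma free_alg_sum_closed: "(\<And>i. i \<in> I \<Longrightarrow> f i \<in> carrier (free_alg L)) \<Longrightarrow> sum f I \<in> carrier (free_alg L)"
  by (induction I rule: infinite_finite_induct) (auto intro: free_alg_closed)

lemmas free_alg_closeds = free_alg_closed free_alg_uminus_closed free_alg_diff_closed free_alg_sum_closed

lemma ring_free_alg: "ring (free_alg L)"
proof (rule ringI)
  show "abelian_group (free_alg L)"
  proof (rule abelian_groupI)
    fix f assume "f \<in> carrier (free_alg L)"
    then show "\<exists>g\<in>carrier (free_alg L). g \<oplus>\<^bsub>free_alg L\<^esub> f = \<zero>\<^bsub>free_alg L\<^esub>"
      by (intro bexI[of _ "- f"]) (auto intro: free_alg_uminus_closed)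
  qed (auto intro: free_alg_closed simp: algebra_simps)
  show "Group.monoid (free_alg L)"
    by (rule monoidI) (auto intro: free_alg_closed simp: algebra_simps)
qed (auto simp: algebra_simps)

lemma scalar_add: "scalar (c + d) = scalar c + scalar d"
  and scalar_mult: "scalar (c * d) = scalar c * scalar d"
  and scalar_one: "scalar 1 = 1" and scalar_zero: "scalar 0 = 0"
  by (simp_all add: scalar_def single_add mult_single plus_list_def zero_list_def flip: single_one)

lemma scalar_sum: "scalar (sum f I) = (\<Sum>i\<in>I. scalar (f i))"
  by (induction I rule: infinite_finite_induct) (auto simp: scalar_add scalar_zero)

lemma scalar_uminus: "scalar (- c) = - scalar c"
  using scalar_add[of c "- c"] by (simp add: scalar_zero eq_neg_iff_add_eq_0 add.commute)

lemma scalar_commute: "scalar c * f = f * scalar c"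
proof -
  have *: "scalar c * Poly_Mapping.single w d = Poly_Mapping.single w d * scalar c" for w d
    by (simp add: scalar_def mult_single plus_list_def mult.commute)
  have "f = (\<Sum>w\<in>Poly_Mapping.keys f. Poly_Mapping.single w (Poly_Mapping.lookup f w))"
    by (rule poly_mapping_eqI) (simp add: lookup_sum lookup_single when_def in_keys_iff)
  then show ?thesis
    using * by (metis (no_types, lifting) sum.cong sum_distrib_left sum_distrib_right)
qed

lemma scalar_left_commute: "f * (scalar c * g) = scalar c * (f * g)"
  by (metis mult.assoc scalar_commute)

lemma poly_mapping_sum_single: "f = (\<Sum>w\<in>Poly_Mapping.keys f. Poly_Mapping.single w (Poly_Mapping.lookup f w))"
  by (rule poly_mapping_eqI) (simp add: lookup_sum lookup_single when_def in_keys_iff)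

text \<open>Words are products of letters, and every element is a combination of words. This reduces
  centrality of K to commutation with the elements of L.\<close>

lemma free_alg_generated:
  assumes f: "f \<in> carrier (free_alg L)"
    and scal: "\<And>c. P (scalar c)" and gens: "\<And>v. v \<in> Lsp L \<Longrightarrow> P (gen v)"
    and add: "\<And>g h. P g \<Longrightarrow> P h \<Longrightarrow> P (g + h)" and mul: "\<And>g h. P g \<Longrightarrow> P h \<Longrightarrow> P (g * h)"
  shows "P f"
proof -
  have word: "P (Poly_Mapping.single w 1)" if "set w \<subseteq> Lsp L" for w
    using that
  proof (induction w)
    case Nil
    then show ?case using scal[of 1] by (simp add: scalar_def)
  next
    case (Cons v w)
    have "Poly_Mapping.single (v # w) 1 = gen v * Poly_Mapping.single w 1"
      by (simp add: gen_def mult_single plus_list_def)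
    then show ?case using Cons by (auto intro: mul gens)
  qed
  have single: "P (Poly_Mapping.single w c)" if "set w \<subseteq> Lsp L" for w c
  proof -
    have "Poly_Mapping.single w c = scalar c * Poly_Mapping.single w 1"
      by (simp add: scalar_def mult_single plus_list_def)
    then show ?thesis using that by (auto intro: mul scal word)
  qed
  have "P (\<Sum>w\<in>S. Poly_Mapping.single w (Poly_Mapping.lookup f w))" if "finite S" "S \<subseteq> Poly_Mapping.keys f" for S
    using that
  proof (induction S rule: finite_induct)
    case empty
    then show ?case using scal[of 0] by (simp add: scalar_zero)
  next
    case (insert w S)
    then show ?case using f by (auto intro!: add single simp: free_alg_def)
  qed
  from this[of "Poly_Mapping.keys f"] show ?thesis by (simp flip: poly_mapping_sum_single)
qed

section \<open>Evaluation of the free algebra in matrices\<close>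

definition word_eval :: "('v \<Rightarrow> complex^'n^'n) \<Rightarrow> 'v list \<Rightarrow> complex^'n^'n" where
  "word_eval r w = foldr (\<lambda>v X. r v ** X) w (mat 1)"

text \<open>The unital homomorphism that extends \<open>r\<close> from letters to the free algebra.
  It exists for every map \<open>r\<close>; conditions on \<open>r\<close> enter only when passing
  to the quotient.\<close>

definition eval_free :: "('v \<Rightarrow> complex^'n^'n) \<Rightarrow> ('v list \<Rightarrow>\<^sub>0 complex) \<Rightarrow> complex^'n^'n" where
  "eval_free r f = (\<Sum>w\<in>Poly_Mapping.keys f. mat_scale (Poly_Mapping.lookup f w) (word_eval r w))"

lemma word_eval_append: "word_eval r (u @ w) = word_eval r u ** word_eval r w"
  by (induction u) (simp_all add: word_eval_def matmul_assoc)

lemma eval_free_superset: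
  "finite S \<Longrightarrow> Poly_Mapping.keys f \<subseteq> S \<Longrightarrow> eval_free r f = (\<Sum>w\<in>S. mat_scale (Poly_Mapping.lookup f w) (word_eval r w))"
  unfolding eval_free_def by (rule sum.mono_neutral_left) (auto simp: in_keys_iff)

lemma eval_free_add: "eval_free r (f + g) = eval_free r f + eval_free r g"
proof -
  have "eval_free r h = (\<Sum>w\<in>Poly_Mapping.keys f \<union> Poly_Mapping.keys g. mat_scale (Poly_Mapping.lookup h w) (word_eval r w))"
    if "Poly_Mapping.keys h \<subseteq> Poly_Mapping.keys f \<union> Poly_Mapping.keys g" for h
    using that by (intro eval_free_superset) auto
  from this[of f] this[of g] this[of "f + g"] show ?thesis
    using keys_add[of f g] by (simp add: lookup_add mat.scale_left_distrib sum.distrib)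
qed

lemma eval_free_zero: "eval_free r 0 = 0"
  by (simp add: eval_free_def)

lemma eval_free_sum: "eval_free r (sum f I) = (\<Sum>i\<in>I. eval_free r (f i))"
  by (induction I rule: infinite_finite_induct) (auto simp: eval_free_add eval_free_zero)

lemma eval_free_uminus: "eval_free r (- f) = - eval_free r f"
  using eval_free_add[of r f "- f"] by (simp add: eval_free_zero eq_neg_iff_add_eq_0 add.commute)

lemma eval_free_diff: "eval_free r (f - g) = eval_free r f - eval_free r g"
  using eval_free_add[of r f "- g"] by (simp add: eval_free_uminus)

lemma eval_free_single: "eval_free r (Poly_Mapping.single w c) = mat_scale c (word_eval r w)"
  by (simp add: eval_free_def)

lemma eval_free_mult: "eval_free r (f * g) = eval_free r f ** eval_free r g"
proof -
  have "f * g = (\<Sum>u\<in>Poly_Mapping.keys f. \<Sum>w\<in>Poly_Mapping.keys g. Poly_Mapping.single (u @ w) (Poly_Mapping.lookup f u * Poly_Mapping.lookup g w))"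
  proof -
    have "f * g = (\<Sum>u\<in>Poly_Mapping.keys f. Poly_Mapping.single u (Poly_Mapping.lookup f u)) * (\<Sum>w\<in>Poly_Mapping.keys g. Poly_Mapping.single w (Poly_Mapping.lookup g w))"
      using poly_mapping_sum_single[of f] poly_mapping_sum_single[of g] by argo
    then show ?thesis by (simp add: sum_product mult_single plus_list_def)
  qed
  then have "eval_free r (f * g) = (\<Sum>u\<in>Poly_Mapping.keys f. \<Sum>w\<in>Poly_Mapping.keys g. mat_scale (Poly_Mapping.lookup f u * Poly_Mapping.lookup g w) (word_eval r u ** word_eval r w))"
    by (simp add: eval_free_sum eval_free_single word_eval_append)
  also have "\<dots> = eval_free r f ** eval_free r g"
    unfolding eval_free_def by (simp add: matmul_sum_left) (simp add: matmul_sum_right matmul_scale_left matmul_scale_right mat_scale_expand mult.commute)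
  finally show ?thesis .
qed

lemma eval_free_gen: "eval_free r (gen v) = r v"
  by (simp add: gen_def eval_free_single word_eval_def)

lemma eval_free_scalar: "eval_free r (scalar c) = mat_scale c (mat 1)"
  by (simp add: scalar_def eval_free_single word_eval_def)

lemma eval_free_one: "eval_free r 1 = mat 1"
  using eval_free_scalar[of r 1] by (simp add: scalar_one)

lemma mat_ring_simps [simp]:
  "carrier (mat_ring :: (complex^'n^'n) ring) = UNIV" "mult mat_ring = (\<lambda>X Y. X ** (Y::complex^'n^'n))"
  "one mat_ring = (mat 1 :: complex^'n^'n)" "zero mat_ring = (0 :: complex^'n^'n)"
  "add mat_ring = (\<lambda>X Y. X + (Y::complex^'n^'n))"
  by (simp_all add: mat_ring_def)

lemma ring_mat_ring: "ring (mat_ring :: (complex^'n^'n) ring)"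
proof (rule ringI)
  show "abelian_group (mat_ring :: (complex^'n^'n) ring)"
    by (rule abelian_groupI) (auto simp: algebra_simps intro: exI[of _ "- _"])
  show "Group.monoid (mat_ring :: (complex^'n^'n) ring)"
    by (rule monoidI) (auto simp: matmul_assoc)
qed (auto simp: matmul_expand)

lemma eval_free_hom: "eval_free r \<in> ring_hom (free_alg L) (mat_ring :: (complex^'n^'n) ring)"
  by (rule ring_hom_memI) (auto simp: eval_free_add eval_free_mult eval_free_one)

section \<open>Calculation modulo the defining ideal\<close>

context weak_M_structure
begin

abbreviation "I \<equiv> U_ideal sc L"
abbreviation "F \<equiv> carrier (free_alg L)"

lemma U_rels_carrier: "U_rels sc L \<subseteq> F"
  unfolding U_rels_def
  by (auto simp: free_alg_closeds L_closed unit_in lact_closed ract_closed A_in_L B_in_L)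

lemma ideal_I: "ideal I (free_alg L)"
  unfolding U_ideal_def by (rule ring.genideal_ideal[OF ring_free_alg U_rels_carrier])

lemma U_rels_I: "x \<in> U_rels sc L \<Longrightarrow> x \<in> I"
  using ring.genideal_self[OF ring_free_alg U_rels_carrier] by (auto simp: U_ideal_def)

lemma I_add: "x \<in> I \<Longrightarrow> y \<in> I \<Longrightarrow> x + y \<in> I"
  using additive_subgroup.a_closed[OF ideal.axioms(1)[OF ideal_I]] by simp

lemma I_zero: "0 \<in> I"
  using additive_subgroup.zero_closed[OF ideal.axioms(1)[OF ideal_I]] by simp

lemma I_mult: "x \<in> I \<Longrightarrow> f \<in> F \<Longrightarrow> f * x \<in> I" "x \<in> I \<Longrightarrow> f \<in> F \<Longrightarrow> x * f \<in> I"
  using ideal.I_l_closed[OF ideal_I] ideal.I_r_closed[OF ideal_I] by auto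

lemma I_uminus: "x \<in> I \<Longrightarrow> - x \<in> I"
  using I_mult(1)[of x "scalar (- 1)", OF _ free_alg_closed(5)] by (simp add: scalar_uminus scalar_one)

lemma I_diff: "x \<in> I \<Longrightarrow> y \<in> I \<Longrightarrow> x - y \<in> I"
  using I_add[of x "- y"] I_uminus[of y] by simp

lemma I_sum: "(\<And>i. i \<in> J \<Longrightarrow> f i \<in> I) \<Longrightarrow> sum f J \<in> I"
  by (induction J rule: infinite_finite_induct) (auto intro: I_add I_zero)

lemma U_proj_iff: "f \<in> F \<Longrightarrow> g \<in> F \<Longrightarrow> U_proj sc L f = U_proj sc L g \<longleftrightarrow> f - g \<in> I"
proof
  have U: "U_proj sc L f = {h + f |h. h \<in> I}" for f
    by (auto simp: U_proj_def a_r_coset_def')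
  assume "f \<in> F" "g \<in> F"
  show "f - g \<in> I" if "U_proj sc L f = U_proj sc L g"
  proof -
    have "0 + f \<in> U_proj sc L f" unfolding U using I_zero by blast
    then have "f \<in> U_proj sc L g" using that by simp
    then obtain h where "h \<in> I" "f = h + g" unfolding U by blast
    then show ?thesis by simp
  qed
  show "U_proj sc L f = U_proj sc L g" if "f - g \<in> I"
  proof -
    have "h + f = (h + (f - g)) + g" "h + g = (h - (f - g)) + f" for h by simp_all
    then have "{h + f |h. h \<in> I} \<subseteq> {h + g |h. h \<in> I}" "{h + g |h. h \<in> I} \<subseteq> {h + f |h. h \<in> I}"
      using I_add[OF _ that] I_diff[OF _ that] by blast+
    then show ?thesis unfolding U by (rule subset_antisym)
  qed
qed

lemma U_alg_carrier: "carrier (U_alg sc L) = U_proj sc L ` F"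
  by (auto simp: U_alg_def FactRing_def U_proj_def A_RCOSETS_def')

lemma U_proj_mult: "f \<in> F \<Longrightarrow> g \<in> F \<Longrightarrow> U_proj sc L f \<otimes>\<^bsub>U_alg sc L\<^esub> U_proj sc L g = U_proj sc L (f * g)"
  using ideal.rcoset_mult_add[OF ideal_I] by (simp add: U_alg_def FactRing_def U_proj_def)

lemma U_proj_add: "f \<in> F \<Longrightarrow> g \<in> F \<Longrightarrow> U_proj sc L f \<oplus>\<^bsub>U_alg sc L\<^esub> U_proj sc L g = U_proj sc L (f + g)"
  using abelian_subgroup.a_rcos_sum[OF abelian_subgroupI3[OF ideal.axioms(1)[OF ideal_I] ring.is_abelian_group[OF ring_free_alg]]]
  by (simp add: U_alg_def FactRing_def U_proj_def)

lemma U_proj_one: "\<one>\<^bsub>U_alg sc L\<^esub> = U_proj sc L 1"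
  by (simp add: U_alg_def FactRing_def U_proj_def)

lemma U_central_iff:
  assumes k: "k \<in> F"
  shows "U_central sc L (U_proj sc L k) \<longleftrightarrow> (\<forall>f\<in>F. k * f - f * k \<in> I)"
  using k by (auto simp: U_central_def U_alg_carrier U_proj_mult U_proj_iff free_alg_closeds)

lemma gen_add: "v \<in> Lsp L \<Longrightarrow> w \<in> Lsp L \<Longrightarrow> gen (v + w) - (gen v + gen w) \<in> I"
  and gen_scale: "v \<in> Lsp L \<Longrightarrow> gen (sc c v) - scalar c * gen v \<in> I"
  and gen_unit: "gen (unit L) - 1 \<in> I"
  and gen_lact: "b \<in> Bsp L \<Longrightarrow> v \<in> Lsp L \<Longrightarrow> gen b * gen v - gen (lact L b v) \<in> I"
  and gen_ract: "v \<in> Lsp L \<Longrightarrow> a \<in> Asp L \<Longrightarrow> gen v * gen a - gen (ract L v a) \<in> I"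
  by (rule U_rels_I; unfold U_rels_def; blast)+

end

text \<open>A representation of U(L) as seen on L alone. By the universal property the two notions
  are interchangeable, and this one involves no cosets.\<close>

definition linear_rep :: "(complex \<Rightarrow> 'v::ab_group_add \<Rightarrow> 'v) \<Rightarrow> 'v M_data \<Rightarrow> ('v \<Rightarrow> complex^'n^'n) \<Rightarrow> bool" where
  "linear_rep sc L r \<longleftrightarrow>
     (\<forall>v\<in>Lsp L. \<forall>w\<in>Lsp L. r (v + w) = r v + r w) \<and> (\<forall>c. \<forall>v\<in>Lsp L. r (sc c v) = mat_scale c (r v)) \<and>
     r (unit L) = mat 1 \<and> (\<forall>b\<in>Bsp L. \<forall>v\<in>Lsp L. r (lact L b v) = r b ** r v) \<and>
     (\<forall>v\<in>Lsp L. \<forall>a\<in>Asp L. r (ract L v a) = r v ** r a)"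

context weak_M_structure
begin

lemma U_incl_cong: "\<lbrakk>v \<in> Lsp L; f \<in> F; gen v - f \<in> I\<rbrakk> \<Longrightarrow> U_incl sc L v = U_proj sc L f"
  unfolding U_incl_def by (simp add: U_proj_iff free_alg_closed)

lemma linear_rep_of_representation:
  assumes \<rho>: "Defs.representation sc L \<rho>"
  shows "linear_rep sc L (\<lambda>v. \<rho> (U_incl sc L v))"
proof -
  have hom: "\<rho> \<in> ring_hom (U_alg sc L) mat_ring"
    and scale: "\<And>c u. u \<in> carrier (U_alg sc L) \<Longrightarrow> \<rho> (U_scale sc L c u) = mat_scale c (\<rho> u)"
    using \<rho> by (auto simp: Defs.representation_def)
  have carr: "U_proj sc L f \<in> carrier (U_alg sc L)" if "f \<in> F" for f using that by (simp add: U_alg_carrier)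
  have add: "\<rho> (U_proj sc L (f + g)) = \<rho> (U_proj sc L f) + \<rho> (U_proj sc L g)" if "f \<in> F" "g \<in> F" for f g
    using ring_hom_add[OF hom carr[OF that(1)] carr[OF that(2)]] that by (simp add: U_proj_add)
  have mult: "\<rho> (U_proj sc L (f * g)) = \<rho> (U_proj sc L f) ** \<rho> (U_proj sc L g)" if "f \<in> F" "g \<in> F" for f g
    using ring_hom_mult[OF hom carr[OF that(1)] carr[OF that(2)]] that by (simp add: U_proj_mult)
  have one: "\<rho> (U_proj sc L 1) = mat 1"
    using ring_hom_one[OF hom] by (simp add: U_proj_one)
  have scal: "\<rho> (U_proj sc L (scalar c * f)) = mat_scale c (\<rho> (U_proj sc L f))" if "f \<in> F" for c f
    using scale[OF carr[OF that], of c] that by (simp add: U_scale_def U_proj_mult free_alg_closed)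
  have "\<rho> (U_incl sc L (v + w)) = \<rho> (U_incl sc L v) + \<rho> (U_incl sc L w)" if "v \<in> Lsp L" "w \<in> Lsp L" for v w
    using that U_incl_cong[OF _ _ gen_add[OF that]] by (simp add: L_closed free_alg_closed add U_incl_def)
  moreover have "\<rho> (U_incl sc L (sc c v)) = mat_scale c (\<rho> (U_incl sc L v))" if "v \<in> Lsp L" for c v
    using that U_incl_cong[OF _ _ gen_scale[OF that]] by (simp add: L_closed free_alg_closed scal U_incl_def)
  moreover have "\<rho> (U_incl sc L (unit L)) = mat 1"
    using U_incl_cong[OF _ _ gen_unit] by (simp add: unit_in free_alg_closed one)
  moreover have "\<rho> (U_incl sc L (lact L b v)) = \<rho> (U_incl sc L b) ** \<rho> (U_incl sc L v)" if "b \<in> Bsp L" "v \<in> Lsp L" for b v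
  proof -
    have "gen (lact L b v) - gen b * gen v \<in> I" using I_uminus[OF gen_lact[OF that]] by simp
    from U_incl_cong[OF _ _ this] show ?thesis
      using that by (simp add: lact_closed free_alg_closed B_in_L mult U_incl_def)
  qed
  moreover have "\<rho> (U_incl sc L (ract L v a)) = \<rho> (U_incl sc L v) ** \<rho> (U_incl sc L a)" if "v \<in> Lsp L" "a \<in> Asp L" for v a
  proof -
    have "gen (ract L v a) - gen v * gen a \<in> I" using I_uminus[OF gen_ract[OF that]] by simp
    from U_incl_cong[OF _ _ this] show ?thesis
      using that by (simp add: ract_closed free_alg_closed A_in_L mult U_incl_def)
  qed
  ultimately show ?thesis unfolding linear_rep_def by blast
qed

text \<open>The kernel of the evaluation is an ideal, and the conditions on \<open>r\<close> say
  that it contains the defining relations, hence the ideal generated by them.\<close>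

lemma eval_free_ideal:
  fixes r :: "'v \<Rightarrow> complex^'n^'n"
  assumes r: "linear_rep sc L r" and x: "x \<in> I"
  shows "eval_free r x = 0"
proof -
  have "ring_hom_ring (free_alg L) (mat_ring :: (complex^'n^'n) ring) (eval_free r)"
    by (rule ring_hom_ringI2[OF ring_free_alg ring_mat_ring eval_free_hom])
  then have ker: "ideal (a_kernel (free_alg L) mat_ring (eval_free r)) (free_alg L)"
    by (rule ring_hom_ring.kernel_is_ideal)
  have "eval_free r x = 0" if "x \<in> U_rels sc L" for x
    using that r unfolding U_rels_def linear_rep_def
    by (auto simp: eval_free_add eval_free_diff eval_free_mult eval_free_gen eval_free_scalar eval_free_one
        matmul_scale_left)
  then have "U_rels sc L \<subseteq> a_kernel (free_alg L) mat_ring (eval_free r)"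
    using U_rels_carrier by (auto simp: a_kernel_def')
  then have "I \<subseteq> a_kernel (free_alg L) mat_ring (eval_free r)"
    unfolding U_ideal_def by (rule ring.genideal_minimal[OF ring_free_alg ker])
  then show ?thesis using x by (auto simp: a_kernel_def')
qed

lemma representation_of_linear_rep:
  fixes r :: "'v \<Rightarrow> complex^'n^'n"
  assumes r: "linear_rep sc L r"
  shows "\<exists>\<rho>. Defs.representation sc L \<rho> \<and> (\<forall>v. v \<in> Lsp L \<longrightarrow> \<rho> (U_incl sc L v) = r v)"
proof -
  note I0 = eval_free_ideal[OF r]
  \<comment> \<open>Any representative of the coset will do, since the evaluation vanishes on the
    ideal.\<close>
  define \<rho> where "\<rho> u = eval_free r (SOME f. f \<in> F \<and> U_proj sc L f = u)" for u
  have \<rho>: "\<rho> (U_proj sc L f) = eval_free r f" if f: "f \<in> F" for f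
  proof -
    have "(SOME g. g \<in> F \<and> U_proj sc L g = U_proj sc L f) \<in> F
        \<and> U_proj sc L (SOME g. g \<in> F \<and> U_proj sc L g = U_proj sc L f) = U_proj sc L f"
      by (rule someI[of "\<lambda>g. g \<in> F \<and> U_proj sc L g = U_proj sc L f" f]) (simp add: f)
    then have "(SOME g. g \<in> F \<and> U_proj sc L g = U_proj sc L f) - f \<in> I"
      using U_proj_iff f by blast
    from I0[OF this] show ?thesis by (simp add: \<rho>_def eval_free_diff)
  qed
  have "\<rho> \<in> ring_hom (U_alg sc L) mat_ring"
    by (rule ring_hom_memI)
      (auto simp: U_alg_carrier U_proj_mult U_proj_add U_proj_one \<rho> free_alg_closed eval_free_add eval_free_mult eval_free_one)
  moreover have "\<rho> (U_scale sc L c u) = mat_scale c (\<rho> u)" if "u \<in> carrier (U_alg sc L)" for c u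
    using that by (auto simp: U_alg_carrier U_scale_def U_proj_mult \<rho> free_alg_closed eval_free_mult eval_free_scalar
      matmul_scale_left)
  moreover have "\<rho> (U_incl sc L v) = r v" if "v \<in> Lsp L" for v
    using that by (simp add: U_incl_def \<rho> free_alg_closed eval_free_gen)
  ultimately show ?thesis unfolding Defs.representation_def by blast
qed

lemma gen_cong_trans: "x - y \<in> I \<Longrightarrow> y - z \<in> I \<Longrightarrow> x - z \<in> I"
  using I_add[of "x - y" "y - z"] by simp

lemma gen_zero: "gen 0 \<in> I"
  using gen_scale[of 0 0] L_closed by (simp add: scalar_zero)

lemma gen_lincomb:
  "(\<And>i. i \<in> J \<Longrightarrow> f i \<in> Lsp L) \<Longrightarrow> gen (\<Sum>i\<in>J. sc (c i) (f i)) - (\<Sum>i\<in>J. scalar (c i) * gen (f i)) \<in> I"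
proof (induction J rule: infinite_finite_induct)
  case (insert i J)
  let ?s = "\<Sum>i\<in>J. sc (c i) (f i)" and ?g = "\<Sum>i\<in>J. scalar (c i) * gen (f i)"
  have "gen (sc (c i) (f i) + ?s) - (gen (sc (c i) (f i)) + gen ?s) \<in> I"
    using insert by (intro gen_add L_closed) auto
  moreover have "gen (sc (c i) (f i)) - scalar (c i) * gen (f i) \<in> I"
    using insert by (intro gen_scale) auto
  moreover have "gen ?s - ?g \<in> I" using insert by auto
  ultimately have "gen (sc (c i) (f i) + ?s) - (gen (sc (c i) (f i)) + gen ?s)
      + ((gen (sc (c i) (f i)) - scalar (c i) * gen (f i)) + (gen ?s - ?g)) \<in> I"
    by (intro I_add)
  then show ?case using insert by (simp add: algebra_simps)
qed (use gen_zero in auto)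

lemma gen_diff:
  assumes "v \<in> Lsp L" "w \<in> Lsp L" shows "gen (v - w) - (gen v - gen w) \<in> I"
  using I_uminus[OF gen_add[of "v - w" w]] assms L_closed by (simp add: algebra_simps)

end

section \<open>Products of generators and commutators with K\<close>

context adapted_M_structure
begin

definition K_free :: "'v list \<Rightarrow>\<^sub>0 complex" where
  "K_free = (\<Sum>i=1..p. gen (A i) * gen (B i)) + gen C"

lemma K_free_in: "K_free \<in> F"
  unfolding K_free_def by (intro free_alg_closeds) (auto simp: A_inL B_inL C_in)

lemma K_elem_eq: "K_elem sc L p A B C = U_proj sc L K_free"
  by (simp add: K_elem_def K_free_def)

text \<open>The expansion of the product contains the letter \<open>gen (unit L)\<close>, which
  differs from 1 in the free algebra; the multiple of \<open>gen (unit L) - 1\<close> added at the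
  end replaces it by a scalar.\<close>

lemma gen_AA:
  assumes i: "i \<in> {1..p}" and j: "j \<in> {1..p}"
  shows "gen (A i) * gen (A j) - (scalar (\<phi> i j 0) + (\<Sum>k=1..p. scalar (\<phi> i j k) * gen (A k))) \<in> I"
proof -
  have 1: "gen (A i) * gen (A j) - gen (\<Sum>k=0..p. sc (\<phi> i j k) (A k)) \<in> I"
    using gen_ract[of "A i" "A j"] i j by (simp add: A_in A_inL ract_A mulA_expansion)
  have 2: "gen (\<Sum>k=0..p. sc (\<phi> i j k) (A k)) - (\<Sum>k=0..p. scalar (\<phi> i j k) * gen (A k)) \<in> I"
    by (rule gen_lincomb) (simp add: A_inL)
  have 3: "scalar (\<phi> i j 0) * (gen (unit L) - 1) \<in> I"
    by (rule I_mult(1)[OF gen_unit]) (rule free_alg_closed)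
  show ?thesis
    using I_add[OF gen_cong_trans[OF 1 2] 3] by (simp add: sum_atLeast0_atMost A0 algebra_simps)
qed

lemma gen_BB:
  assumes i: "i \<in> {1..p}" and j: "j \<in> {1..p}"
  shows "gen (B i) * gen (B j) - (scalar (\<psi> i j 0) + (\<Sum>k=1..p. scalar (\<psi> i j k) * gen (B k))) \<in> I"
proof -
  have 1: "gen (B i) * gen (B j) - gen (\<Sum>k=0..p. sc (\<psi> i j k) (B k)) \<in> I"
    using gen_lact[of "B i" "B j"] i j by (simp add: B_in B_inL lact_B mulB_expansion)
  have 2: "gen (\<Sum>k=0..p. sc (\<psi> i j k) (B k)) - (\<Sum>k=0..p. scalar (\<psi> i j k) * gen (B k)) \<in> I"
    by (rule gen_lincomb) (simp add: B_inL)
  have 3: "scalar (\<psi> i j 0) * (gen (unit L) - 1) \<in> I"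
    by (rule I_mult(1)[OF gen_unit]) (rule free_alg_closed)
  show ?thesis
    using I_add[OF gen_cong_trans[OF 1 2] 3] by (simp add: sum_atLeast0_atMost B0 algebra_simps)
qed

lemma gen_BA:
  assumes i: "i \<in> {1..p}" and j: "j \<in> {1..p}"
  shows "gen (B i) * gen (A j) - ((\<Sum>k=1..p. scalar (\<psi> k i j) * gen (A k)) + (\<Sum>k=1..p. scalar (\<phi> j k i) * gen (B k))
    + scalar (t i j) + (if i = j then gen C else 0)) \<in> I"
proof -
  define X where "X = (\<Sum>k=1..p. sc (\<psi> k i j) (A k))"
  define Y where "Y = (\<Sum>k=1..p. sc (\<phi> j k i) (B k))"
  define Z where "Z = (if i = j then C else 0)"
  have XL: "X \<in> Lsp L" and YL: "Y \<in> Lsp L" unfolding X_def Y_def by (intro L_closed; simp add: A_inL B_inL)+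
  have ZL: "Z \<in> Lsp L" by (simp add: Z_def C_in L_closed)
  have "gen (B i) * gen (A j) - gen (X + Y + sc (t i j) (unit L) + Z) \<in> I"
    using gen_lact[of "B i" "A j"] i j by (simp add: B_in A_inL lact_BA_expansion X_def Y_def Z_def)
  moreover have "gen (X + Y + sc (t i j) (unit L) + Z) - (gen (X + Y + sc (t i j) (unit L)) + gen Z) \<in> I"
    by (rule gen_add) (simp_all add: L_closed XL YL ZL unit_in)
  moreover have "gen (X + Y + sc (t i j) (unit L)) - (gen (X + Y) + gen (sc (t i j) (unit L))) \<in> I"
    by (rule gen_add) (simp_all add: L_closed XL YL unit_in)
  moreover have "gen (X + Y) - (gen X + gen Y) \<in> I"
    by (rule gen_add) (simp_all add: XL YL)
  moreover have "gen X - (\<Sum>k=1..p. scalar (\<psi> k i j) * gen (A k)) \<in> I"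
    unfolding X_def by (rule gen_lincomb) (simp add: A_inL)
  moreover have "gen Y - (\<Sum>k=1..p. scalar (\<phi> j k i) * gen (B k)) \<in> I"
    unfolding Y_def by (rule gen_lincomb) (simp add: B_inL)
  moreover have "gen (sc (t i j) (unit L)) - scalar (t i j) * gen (unit L) \<in> I"
    by (rule gen_scale) (simp add: unit_in)
  moreover have "scalar (t i j) * (gen (unit L) - 1) \<in> I"
    by (rule I_mult(1)[OF gen_unit]) (rule free_alg_closed)
  moreover have "gen Z - (if i = j then gen C else 0) \<in> I"
    using gen_zero I_zero by (auto simp: Z_def)
  \<comment> \<open>The congruences collected above telescope.\<close>
  ultimately have "(gen (B i) * gen (A j) - gen (X + Y + sc (t i j) (unit L) + Z))
    + ((gen (X + Y + sc (t i j) (unit L) + Z) - (gen (X + Y + sc (t i j) (unit L)) + gen Z))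
    + ((gen (X + Y + sc (t i j) (unit L)) - (gen (X + Y) + gen (sc (t i j) (unit L))))
    + ((gen (X + Y) - (gen X + gen Y)) + ((gen X - (\<Sum>k=1..p. scalar (\<psi> k i j) * gen (A k)))
    + ((gen Y - (\<Sum>k=1..p. scalar (\<phi> j k i) * gen (B k))) + ((gen (sc (t i j) (unit L)) - scalar (t i j) * gen (unit L))
    + (scalar (t i j) * (gen (unit L) - 1) + (gen Z - (if i = j then gen C else 0))))))))) \<in> I" (is "?x \<in> I")
    by (intro I_add)
  moreover have "?x = gen (B i) * gen (A j) - ((\<Sum>k=1..p. scalar (\<psi> k i j) * gen (A k)) + (\<Sum>k=1..p. scalar (\<phi> j k i) * gen (B k))
    + scalar (t i j) + (if i = j then gen C else 0))"
    by (simp only: right_diff_distrib mult_1_right) (simp only: algebra_simps)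
  ultimately show ?thesis by (rule back_subst[of "\<lambda>x. x \<in> I"])
qed

text \<open>In \<open>K A_j\<close>, rewriting each \<open>B^i A_j\<close> produces words
  \<open>A_i A_k\<close>, words \<open>A_i B^k\<close> and the word \<open>A_j C\<close>. The last
  two kinds cancel against \<open>A_j K\<close>, up to the terms with \<phi> at index 0, and
  rewriting the first kind produces the contraction. So modulo the ideal the commutator is
  \<open>C A_j\<close> minus the value that the relation for \<open>c ** a j\<close>
  demands.\<close>

lemma K_free_commutator_A:
  assumes j: "j \<in> {1..p}"
  shows "K_free * gen (A j) - gen (A j) * K_free - (gen C * gen (A j) - ((\<Sum>k=1..p. scalar (\<phi> j k 0) * gen (B k))
    - scalar (contraction p \<phi> \<psi> t 0 j) - (\<Sum>k=1..p. scalar (contraction p \<phi> \<psi> t k j) * gen (A k)))) \<in> I"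
proof -
  let ?I = "{1..p}"
  \<comment> \<open>\<open>e\<close>, \<open>h\<close> and \<open>m\<close> are the elements of the
    ideal that express the three rewritings.\<close>
  define e where "e i = gen (B i) * gen (A j) - ((\<Sum>k\<in>?I. scalar (\<psi> k i j) * gen (A k)) + (\<Sum>k\<in>?I. scalar (\<phi> j k i) * gen (B k))
    + scalar (t i j) + (if i = j then gen C else 0))" for i
  define h where "h i = gen (A j) * gen (A i) - (scalar (\<phi> j i 0) + (\<Sum>k\<in>?I. scalar (\<phi> j i k) * gen (A k)))" for i
  define m where "m i k = gen (A i) * gen (A k) - (scalar (\<phi> i k 0) + (\<Sum>l\<in>?I. scalar (\<phi> i k l) * gen (A l)))" for i k
  have "(\<Sum>i\<in>?I. gen (A i) * e i) - (\<Sum>i\<in>?I. h i * gen (B i)) + (\<Sum>i\<in>?I. \<Sum>k\<in>?I. scalar (\<psi> k i j) * m i k) \<in> I"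
    (is "?x \<in> I")
    unfolding e_def h_def m_def
    by (intro I_add I_diff I_sum I_mult gen_BA gen_AA j free_alg_closed A_inL B_inL) auto
  moreover have "?x = K_free * gen (A j) - gen (A j) * K_free - (gen C * gen (A j) - ((\<Sum>k\<in>?I. scalar (\<phi> j k 0) * gen (B k))
    - scalar (contraction p \<phi> \<psi> t 0 j) - (\<Sum>k\<in>?I. scalar (contraction p \<phi> \<psi> t k j) * gen (A k))))"
  proof -
    define U1 where "U1 = (\<Sum>i\<in>?I. \<Sum>k\<in>?I. scalar (\<psi> k i j) * (gen (A i) * gen (A k)))"
    define U2 where "U2 = (\<Sum>i\<in>?I. \<Sum>k\<in>?I. scalar (\<phi> j k i) * (gen (A i) * gen (B k)))"
    have 1: "(\<Sum>i\<in>?I. gen (A i) * e i) = (\<Sum>i\<in>?I. gen (A i) * (gen (B i) * gen (A j)))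
        - (U1 + U2 + (\<Sum>i\<in>?I. scalar (t i j) * gen (A i)) + gen (A j) * gen C)"
    proof -
      have "(\<Sum>i\<in>?I. gen (A i) * (if i = j then gen C else 0)) = gen (A j) * gen C"
        by (rule trans[OF sum_single[OF _ j]]) auto
      then show ?thesis
        by (simp add: e_def right_diff_distrib distrib_left sum_distrib_left sum_subtractf sum.distrib
            scalar_left_commute U1_def U2_def scalar_commute[of _ "gen _", symmetric])
    qed
    have 2: "(\<Sum>i\<in>?I. h i * gen (B i)) = (\<Sum>i\<in>?I. gen (A j) * (gen (A i) * gen (B i)))
        - ((\<Sum>i\<in>?I. scalar (\<phi> j i 0) * gen (B i)) + U2)"
    proof -
      have "(\<Sum>i\<in>?I. \<Sum>k\<in>?I. scalar (\<phi> j i k) * (gen (A k) * gen (B i))) = U2"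
        unfolding U2_def by (rule sum.swap)
      then show ?thesis
        by (simp add: h_def left_diff_distrib distrib_right sum_distrib_right sum_subtractf sum.distrib mult.assoc)
    qed
    have 3: "(\<Sum>i\<in>?I. \<Sum>k\<in>?I. scalar (\<psi> k i j) * m i k) = U1 - (scalar (\<Sum>i\<in>?I. \<Sum>k\<in>?I. \<phi> i k 0 * \<psi> k i j)
        + (\<Sum>l\<in>?I. scalar (\<Sum>i\<in>?I. \<Sum>k\<in>?I. \<phi> i k l * \<psi> k i j) * gen (A l)))"
    proof -
      have "(\<Sum>i\<in>?I. \<Sum>k\<in>?I. scalar (\<psi> k i j) * m i k) = U1 - ((\<Sum>i\<in>?I. \<Sum>k\<in>?I. scalar (\<phi> i k 0 * \<psi> k i j))
        + (\<Sum>i\<in>?I. \<Sum>k\<in>?I. \<Sum>l\<in>?I. scalar (\<phi> i k l * \<psi> k i j) * gen (A l)))"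
        by (simp add: m_def U1_def right_diff_distrib distrib_left sum_distrib_left sum_subtractf sum.distrib
            mult.assoc[symmetric] mult.commute[of "\<phi> _ _ _"] flip: scalar_mult)
      also have "(\<Sum>i\<in>?I. \<Sum>k\<in>?I. \<Sum>l\<in>?I. scalar (\<phi> i k l * \<psi> k i j) * gen (A l))
          = (\<Sum>l\<in>?I. \<Sum>i\<in>?I. \<Sum>k\<in>?I. scalar (\<phi> i k l * \<psi> k i j) * gen (A l))"
        by (rule sum_rotate3[symmetric])
      finally show ?thesis by (simp add: scalar_sum sum_distrib_right)
    qed
    have 4: "(\<Sum>k\<in>?I. scalar (contraction p \<phi> \<psi> t k j) * gen (A k)) = (\<Sum>i\<in>?I. scalar (t i j) * gen (A i))
        + (\<Sum>l\<in>?I. scalar (\<Sum>i\<in>?I. \<Sum>k\<in>?I. \<phi> i k l * \<psi> k i j) * gen (A l))"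
      unfolding sum.distrib[symmetric] distrib_right[symmetric] scalar_add[symmetric]
      using j by (intro sum.cong refl arg_cong2[of _ _ _ _ "(*)"] arg_cong[of _ _ scalar]) (auto simp: contraction_def)
    have 5: "contraction p \<phi> \<psi> t 0 j = (\<Sum>i\<in>?I. \<Sum>k\<in>?I. \<phi> i k 0 * \<psi> k i j)"
      by (simp add: contraction_def)
    have 6: "K_free * gen (A j) = (\<Sum>i\<in>?I. gen (A i) * (gen (B i) * gen (A j))) + gen C * gen (A j)"
      by (simp add: K_free_def distrib_right sum_distrib_right mult.assoc)
    have 7: "gen (A j) * K_free = (\<Sum>i\<in>?I. gen (A j) * (gen (A i) * gen (B i))) + gen (A j) * gen C"
      by (simp add: K_free_def distrib_left sum_distrib_left)
    show ?thesis unfolding 1 2 3 4 5 6 7 by simp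
  qed
  ultimately show ?thesis by (rule back_subst[of "\<lambda>x. x \<in> I"])
qed

text \<open>The mirror image of the computation for A. The commutator is taken in the order
  \<open>B K - K B\<close>, so that \<open>B C\<close> occurs with coefficient 1.\<close>

lemma K_free_commutator_B:
  assumes j: "j \<in> {1..p}"
  shows "gen (B j) * K_free - K_free * gen (B j) - (gen (B j) * gen C - ((\<Sum>k=1..p. scalar (\<psi> k j 0) * gen (A k))
    - scalar (contraction p \<phi> \<psi> t j 0) - (\<Sum>k=1..p. scalar (contraction p \<phi> \<psi> t j k) * gen (B k)))) \<in> I"
proof -
  let ?I = "{1..p}"
  define e where "e i = gen (B j) * gen (A i) - ((\<Sum>k\<in>?I. scalar (\<psi> k j i) * gen (A k)) + (\<Sum>k\<in>?I. scalar (\<phi> i k j) * gen (B k))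
    + scalar (t j i) + (if j = i then gen C else 0))" for i
  define h where "h i = gen (B i) * gen (B j) - (scalar (\<psi> i j 0) + (\<Sum>k\<in>?I. scalar (\<psi> i j k) * gen (B k)))" for i
  define m where "m i k = gen (B k) * gen (B i) - (scalar (\<psi> k i 0) + (\<Sum>l\<in>?I. scalar (\<psi> k i l) * gen (B l)))" for i k
  have "(\<Sum>i\<in>?I. e i * gen (B i)) - (\<Sum>i\<in>?I. gen (A i) * h i) + (\<Sum>i\<in>?I. \<Sum>k\<in>?I. scalar (\<phi> i k j) * m i k) \<in> I"
    (is "?x \<in> I")
    unfolding e_def h_def m_def
    by (intro I_add I_diff I_sum I_mult gen_BA gen_BB j free_alg_closed A_inL B_inL) auto
  moreover have "?x = gen (B j) * K_free - K_free * gen (B j) - (gen (B j) * gen C - ((\<Sum>k\<in>?I. scalar (\<psi> k j 0) * gen (A k))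
    - scalar (contraction p \<phi> \<psi> t j 0) - (\<Sum>k\<in>?I. scalar (contraction p \<phi> \<psi> t j k) * gen (B k))))"
  proof -
    define U1 where "U1 = (\<Sum>i\<in>?I. \<Sum>k\<in>?I. scalar (\<phi> i k j) * (gen (B k) * gen (B i)))"
    define U2 where "U2 = (\<Sum>i\<in>?I. \<Sum>k\<in>?I. scalar (\<psi> i j k) * (gen (A i) * gen (B k)))"
    have 1: "(\<Sum>i\<in>?I. e i * gen (B i)) = (\<Sum>i\<in>?I. gen (B j) * (gen (A i) * gen (B i)))
        - (U1 + U2 + (\<Sum>i\<in>?I. scalar (t j i) * gen (B i)) + gen C * gen (B j))"
    proof -
      have "(\<Sum>i\<in>?I. (if j = i then gen C else 0) * gen (B i)) = gen C * gen (B j)"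
        by (rule trans[OF sum_single[OF _ j]]) auto
      moreover have "(\<Sum>i\<in>?I. \<Sum>k\<in>?I. scalar (\<psi> k j i) * (gen (A k) * gen (B i))) = U2"
        unfolding U2_def by (rule sum.swap)
      ultimately show ?thesis
        by (simp add: e_def left_diff_distrib distrib_right sum_distrib_right sum_subtractf sum.distrib
            mult.assoc U1_def)
    qed
    have 2: "(\<Sum>i\<in>?I. gen (A i) * h i) = (\<Sum>i\<in>?I. gen (A i) * (gen (B i) * gen (B j)))
        - ((\<Sum>i\<in>?I. scalar (\<psi> i j 0) * gen (A i)) + U2)"
      by (simp add: h_def right_diff_distrib distrib_left sum_distrib_left sum_subtractf sum.distrib
          scalar_left_commute U2_def scalar_commute[of _ "gen _", symmetric])
    have 3: "(\<Sum>i\<in>?I. \<Sum>k\<in>?I. scalar (\<phi> i k j) * m i k) = U1 - (scalar (\<Sum>i\<in>?I. \<Sum>k\<in>?I. \<phi> i k j * \<psi> k i 0)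
        + (\<Sum>l\<in>?I. scalar (\<Sum>i\<in>?I. \<Sum>k\<in>?I. \<phi> i k j * \<psi> k i l) * gen (B l)))"
    proof -
      have "(\<Sum>i\<in>?I. \<Sum>k\<in>?I. scalar (\<phi> i k j) * m i k) = U1 - ((\<Sum>i\<in>?I. \<Sum>k\<in>?I. scalar (\<phi> i k j * \<psi> k i 0))
        + (\<Sum>i\<in>?I. \<Sum>k\<in>?I. \<Sum>l\<in>?I. scalar (\<phi> i k j * \<psi> k i l) * gen (B l)))"
        by (simp add: m_def U1_def right_diff_distrib distrib_left sum_distrib_left sum_subtractf sum.distrib
            mult.assoc[symmetric] flip: scalar_mult)
      also have "(\<Sum>i\<in>?I. \<Sum>k\<in>?I. \<Sum>l\<in>?I. scalar (\<phi> i k j * \<psi> k i l) * gen (B l))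
          = (\<Sum>l\<in>?I. \<Sum>i\<in>?I. \<Sum>k\<in>?I. scalar (\<phi> i k j * \<psi> k i l) * gen (B l))"
        by (rule sum_rotate3[symmetric])
      finally show ?thesis by (simp add: scalar_sum sum_distrib_right)
    qed
    have 4: "(\<Sum>k\<in>?I. scalar (contraction p \<phi> \<psi> t j k) * gen (B k)) = (\<Sum>i\<in>?I. scalar (t j i) * gen (B i))
        + (\<Sum>l\<in>?I. scalar (\<Sum>i\<in>?I. \<Sum>k\<in>?I. \<phi> i k j * \<psi> k i l) * gen (B l))"
      unfolding sum.distrib[symmetric] distrib_right[symmetric] scalar_add[symmetric]
      using j by (intro sum.cong refl arg_cong2[of _ _ _ _ "(*)"] arg_cong[of _ _ scalar]) (auto simp: contraction_def)
    have 5: "contraction p \<phi> \<psi> t j 0 = (\<Sum>i\<in>?I. \<Sum>k\<in>?I. \<phi> i k j * \<psi> k i 0)"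
      by (simp add: contraction_def)
    have 6: "gen (B j) * K_free = (\<Sum>i\<in>?I. gen (B j) * (gen (A i) * gen (B i))) + gen (B j) * gen C"
      by (simp add: K_free_def distrib_left sum_distrib_left)
    have 7: "K_free * gen (B j) = (\<Sum>i\<in>?I. gen (A i) * (gen (B i) * gen (B j))) + gen C * gen (B j)"
      by (simp add: K_free_def distrib_right sum_distrib_right mult.assoc)
    show ?thesis unfolding 1 2 3 4 5 6 7 by simp
  qed
  ultimately show ?thesis by (rule back_subst[of "\<lambda>x. x \<in> I"])
qed

end

context weak_M_structure
begin

lemma linear_rep_simps:
  assumes "linear_rep sc L r"
  shows "v \<in> Lsp L \<Longrightarrow> w \<in> Lsp L \<Longrightarrow> r (v + w) = r v + r w" "v \<in> Lsp L \<Longrightarrow> r (sc c v) = mat_scale c (r v)"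
    "r (unit L) = mat 1" "b \<in> Bsp L \<Longrightarrow> v \<in> Lsp L \<Longrightarrow> r (lact L b v) = r b ** r v"
    "v \<in> Lsp L \<Longrightarrow> a \<in> Asp L \<Longrightarrow> r (ract L v a) = r v ** r a"
    "r 0 = 0" "v \<in> Lsp L \<Longrightarrow> w \<in> Lsp L \<Longrightarrow> r (v - w) = r v - r w"
    "(\<And>i. i \<in> J \<Longrightarrow> f i \<in> Lsp L) \<Longrightarrow> r (\<Sum>i\<in>J. sc (x i) (f i)) = (\<Sum>i\<in>J. mat_scale (x i) (r (f i)))"
proof -
  note R = assms[unfolded linear_rep_def]
  show add: "v \<in> Lsp L \<Longrightarrow> w \<in> Lsp L \<Longrightarrow> r (v + w) = r v + r w" for v w using R by blast
  show scale: "v \<in> Lsp L \<Longrightarrow> r (sc c v) = mat_scale c (r v)" for v c using R by blast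
  show "r (unit L) = mat 1" using R by blast
  show "b \<in> Bsp L \<Longrightarrow> v \<in> Lsp L \<Longrightarrow> r (lact L b v) = r b ** r v" using R by blast
  show "v \<in> Lsp L \<Longrightarrow> a \<in> Asp L \<Longrightarrow> r (ract L v a) = r v ** r a" using R by blast
  show zero: "r 0 = 0" using scale[of 0 0] L_closed by simp
  show "v \<in> Lsp L \<Longrightarrow> w \<in> Lsp L \<Longrightarrow> r (v - w) = r v - r w" using add[of "v - w" w] L_closed by simp
  show "(\<And>i. i \<in> J \<Longrightarrow> f i \<in> Lsp L) \<Longrightarrow> r (\<Sum>i\<in>J. sc (x i) (f i)) = (\<Sum>i\<in>J. mat_scale (x i) (r (f i)))"
    by (induction J rule: infinite_finite_induct) (simp_all add: zero add scale L_closed)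
qed

end

context adapted_M_structure
begin

lemma lincomb_in_L:
  "(\<Sum>k=0..p. sc (x k) (A k)) \<in> Lsp L" "(\<Sum>k=1..p. sc (x k) (A k)) \<in> Lsp L"
  "(\<Sum>k=0..p. sc (x k) (B k)) \<in> Lsp L" "(\<Sum>k=1..p. sc (x k) (B k)) \<in> Lsp L"
  by (intro L_closed; simp add: A_inL B_inL)+

lemma linear_rep_lincomb:
  assumes r: "linear_rep sc L r"
  shows "r (\<Sum>k=0..p. sc (x k) (A k)) = (\<Sum>k=0..p. mat_scale (x k) (r (A k)))"
    "r (\<Sum>k=1..p. sc (x k) (A k)) = (\<Sum>k=1..p. mat_scale (x k) (r (A k)))"
    "r (\<Sum>k=0..p. sc (x k) (B k)) = (\<Sum>k=0..p. mat_scale (x k) (r (B k)))"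
    "r (\<Sum>k=1..p. sc (x k) (B k)) = (\<Sum>k=1..p. mat_scale (x k) (r (B k)))"
  by (rule linear_rep_simps(8)[OF r]; simp add: A_inL B_inL)+

text \<open>These relations hold for every weak M-structure. What separates the last two from
  \<open>matrix_relations\<close> is that the coefficients of \<open>r (B i) ** r C\<close> along
  the \<open>r (B k)\<close>, and of \<open>r C ** r (A j)\<close> along the \<open>r (A k)\<close>,
  are not yet identified.\<close>

lemma linear_rep_AB:
  assumes r: "linear_rep sc L r"
  shows "r (A 0) = mat 1" "r (B 0) = mat 1"
    and "\<lbrakk>i \<in> {1..p}; j \<in> {1..p}\<rbrakk> \<Longrightarrow> r (A i) ** r (A j) = (\<Sum>k=0..p. mat_scale (\<phi> i j k) (r (A k)))"
    and "\<lbrakk>i \<in> {1..p}; j \<in> {1..p}\<rbrakk> \<Longrightarrow> r (B i) ** r (B j) = (\<Sum>k=0..p. mat_scale (\<psi> i j k) (r (B k)))"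
    and "\<lbrakk>i \<in> {1..p}; j \<in> {1..p}\<rbrakk> \<Longrightarrow> r (B i) ** r (A j) = (\<Sum>k=1..p. mat_scale (\<psi> k i j) (r (A k)))
        + (\<Sum>k=1..p. mat_scale (\<phi> j k i) (r (B k))) + mat_scale (t i j) (mat 1) + (if i = j then r C else 0)"
    and "i \<in> {1..p} \<Longrightarrow> r (B i) ** r C = (\<Sum>k=1..p. mat_scale (\<psi> k i 0) (r (A k)))
        + (\<Sum>k=0..p. mat_scale (form L (lact L (B i) C) (dualA k)) (r (B k)))"
    and "j \<in> {1..p} \<Longrightarrow> r C ** r (A j) = (\<Sum>k=1..p. mat_scale (\<phi> j k 0) (r (B k)))
        + (\<Sum>k=0..p. mat_scale (form L (ract L C (A j)) (dualB k)) (r (A k)))"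
proof -
  note R = linear_rep_simps(1-7)[OF r] and RS = linear_rep_lincomb[OF r] and SL = lincomb_in_L
  show "r (A 0) = mat 1" "r (B 0) = mat 1" by (simp_all add: A0 B0 R)
  show "r (A i) ** r (A j) = (\<Sum>k=0..p. mat_scale (\<phi> i j k) (r (A k)))" if "i \<in> {1..p}" "j \<in> {1..p}" for i j
    using R(5)[of "A i" "A j"] that by (simp add: A_inL A_in ract_A mulA_expansion RS)
  show "r (B i) ** r (B j) = (\<Sum>k=0..p. mat_scale (\<psi> i j k) (r (B k)))" if "i \<in> {1..p}" "j \<in> {1..p}" for i j
    using R(4)[of "B i" "B j"] that by (simp add: B_inL B_in lact_B mulB_expansion RS)
  show "r (B i) ** r (A j) = (\<Sum>k=1..p. mat_scale (\<psi> k i j) (r (A k)))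
        + (\<Sum>k=1..p. mat_scale (\<phi> j k i) (r (B k))) + mat_scale (t i j) (mat 1) + (if i = j then r C else 0)"
    if "i \<in> {1..p}" "j \<in> {1..p}" for i j
    using R(4)[of "B i" "A j"] that
    by (cases "i = j") (simp_all add: B_in A_inL lact_BA_expansion R(1,2,3,6) RS SL C_in L_closed unit_in)
  show "r (B i) ** r C = (\<Sum>k=1..p. mat_scale (\<psi> k i 0) (r (A k)))
        + (\<Sum>k=0..p. mat_scale (form L (lact L (B i) C) (dualA k)) (r (B k)))" if "i \<in> {1..p}" for i
  proof -
    have "r (B i) ** r C = r (lact L (B i) C)" using R(4)[of "B i" C] that by (simp add: B_in C_in)
    also have "\<dots> = r ((\<Sum>k=1..p. sc (\<psi> k i 0) (A k)) + (\<Sum>k=0..p. sc (form L (lact L (B i) C) (dualA k)) (B k)))"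
      using lact_BC_expansion[OF that] by simp
    finally show ?thesis by (simp add: R(1) RS SL)
  qed
  show "r C ** r (A j) = (\<Sum>k=1..p. mat_scale (\<phi> j k 0) (r (B k)))
        + (\<Sum>k=0..p. mat_scale (form L (ract L C (A j)) (dualB k)) (r (A k)))" if "j \<in> {1..p}" for j
  proof -
    have "r C ** r (A j) = r (ract L C (A j))" using R(5)[of C "A j"] that by (simp add: A_in C_in)
    also have "\<dots> = r ((\<Sum>k=1..p. sc (\<phi> j k 0) (B k)) + (\<Sum>k=0..p. sc (form L (ract L C (A j)) (dualB k)) (A k)))"
      using ract_CA_expansion[OF that] by simp
    finally show ?thesis by (simp add: R(1) RS SL)
  qed
qed

text \<open>Centrality puts the commutators of K into the ideal, and they are congruent to the
  difference of the two sides of the missing relations; evaluating in matrices makes this difference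
  zero.\<close>

lemma central_imp_matrix_relations:
  assumes r: "linear_rep sc L r" and K: "U_central sc L (K_elem sc L p A B C)"
  shows "matrix_relations p (\<lambda>i. r (A i)) (\<lambda>i. r (B i)) (r C) \<phi> \<psi> t"
proof
  note R = linear_rep_AB[OF r]
  note ev = eval_free_add eval_free_diff eval_free_mult eval_free_gen eval_free_scalar eval_free_sum
  have comm: "K_free * f - f * K_free \<in> I" if "f \<in> F" for f
    using K that by (simp add: K_elem_eq U_central_iff K_free_in)
  fix j assume j: "j \<in> {1..p}"
  have "gen (A j) \<in> F" "gen (B j) \<in> F" using j by (simp_all add: free_alg_closed A_inL B_inL)
  note comm = comm[OF this(1)] I_uminus[OF comm[OF this(2)]]
  show "r C ** r (A j) = (\<Sum>k=1..p. mat_scale (\<phi> j k 0) (r (B k)))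
        - (\<Sum>k=0..p. mat_scale (contraction p \<phi> \<psi> t k j) (r (A k)))"
    using eval_free_ideal[OF r I_diff[OF comm(1) K_free_commutator_A[OF j]]]
    by (simp add: ev sum_atLeast0_atMost R(1) matmul_scale_left algebra_simps)
  show "r (B j) ** r C = (\<Sum>k=1..p. mat_scale (\<psi> k j 0) (r (A k)))
        - (\<Sum>k=0..p. mat_scale (contraction p \<phi> \<psi> t j k) (r (B k)))"
    using eval_free_ideal[OF r I_diff[OF comm(2) K_free_commutator_B[OF j]]]
    by (simp add: ev sum_atLeast0_atMost R(2) matmul_scale_left algebra_simps)
qed (use linear_rep_AB[OF r] in auto)

text \<open>The difference of E and C is orthogonal to the unit and to all \<open>A i\<close>,
  \<open>B i\<close>, hence equals a multiple d of the unit. Then \<open>(E, E) = 2 d\<close>, so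
  isotropy of E forces d = 0.\<close>

lemma C_unique:
  assumes E: "E \<in> Lsp L" "form L (unit L) E = 1" "form L E E = 0"
    and AB: "\<And>i. i \<in> {1..p} \<Longrightarrow> form L E (A i) = 0" "\<And>i. i \<in> {1..p} \<Longrightarrow> form L E (B i) = 0"
  shows "E = C"
proof -
  define D where "D = E - C"
  have DL: "D \<in> Lsp L" using E C_in by (simp add: D_def L_closed)
  have uE: "form L E (unit L) = 1" using E form_sym[of E "unit L"] unit_in by simp
  have Cu: "form L C (unit L) = 1" using form_C(2)[of 0] by (simp add: A0)
  have "form L D (A i) = 0" "form L D (B i) = 0" if "i \<in> {1..p}" for i
    using that AB E C_in by (simp_all add: D_def form_diff_left A_inL B_inL form_C)
  moreover have "form L D (unit L) = 0" using E C_in by (simp add: D_def form_diff_left unit_in uE Cu)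
  ultimately have "D = sc (form L D C) (unit L)"
    using expansion[OF DL] by (simp add: sum_atLeast0_atMost dualA_def B0)
  then obtain d where "D = sc d (unit L)" by blast
  then have Ed: "E = C + sc d (unit L)" by (simp add: D_def algebra_simps)
  have uu: "form L (unit L) (unit L) = 0" by (simp add: form_AA unit_in)
  have uC: "form L (unit L) C = 1" using form_C(4)[of 0] by (simp add: A0)
  have "form L E E = 2 * d"
    unfolding Ed by (simp add: form_add_left form_add_right form_scale_left form_scale_right C_in unit_in L_closed form_C uu uC Cu)
  then show ?thesis using E(3) Ed by simp
qed

text \<open>The element C of the adapted basis with the given \<open>A'\<close> and
  \<open>B'\<close>. The two sums restore orthogonality to \<open>A'\<close> and \<open>B'\<close>;
  the multiple of the unit restores isotropy. The scalar products with C are the constants u and v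
  of the equivalence transformation.\<close>

definition shifted_C :: "nat \<Rightarrow> (nat \<Rightarrow> 'v) \<Rightarrow> (nat \<Rightarrow> 'v) \<Rightarrow> 'v" where
  "shifted_C q A' B' = C - (\<Sum>i=1..q. sc (form L (A' i) C) (B' i)) - (\<Sum>i=1..q. sc (form L (B' i) C) (A' i))
     + sc (\<Sum>i=1..q. form L (A' i) C * form L (B' i) C) (unit L)"

lemma shifted_C:
  assumes A': "\<And>i. i \<in> {1..q} \<Longrightarrow> A' i \<in> Asp L" and B': "\<And>i. i \<in> {1..q} \<Longrightarrow> B' i \<in> Bsp L"
    and dual: "\<And>i j. i \<in> {1..q} \<Longrightarrow> j \<in> {1..q} \<Longrightarrow> form L (A' i) (B' j) = (if i = j then 1 else 0)"
  shows "shifted_C q A' B' \<in> Lsp L" "form L (unit L) (shifted_C q A' B') = 1"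
    "form L (shifted_C q A' B') (shifted_C q A' B') = 0"
    "i \<in> {1..q} \<Longrightarrow> form L (shifted_C q A' B') (A' i) = 0" "i \<in> {1..q} \<Longrightarrow> form L (shifted_C q A' B') (B' i) = 0"
proof -
  let ?E = "shifted_C q A' B'"
  define X where "X = (\<Sum>i=1..q. sc (form L (A' i) C) (B' i))"
  define Y where "Y = (\<Sum>i=1..q. sc (form L (B' i) C) (A' i))"
  define s where "s = (\<Sum>i=1..q. form L (A' i) C * form L (B' i) C)"
  have E: "?E = C - X - Y + sc s (unit L)" by (simp add: shifted_C_def X_def Y_def s_def)
  note AL = A_in_L[OF A'] and BL = B_in_L[OF B']
  have XB: "X \<in> Bsp L" unfolding X_def using subspace_B(1) B' by (intro subspace_sum subspace_scale) auto
  have YA: "Y \<in> Asp L" unfolding Y_def using subspace_A(1) A' by (intro subspace_sum subspace_scale) auto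
  have XL: "X \<in> Lsp L" and YL: "Y \<in> Lsp L" using XB YA by (simp_all add: A_in_L B_in_L)
  have uX: "form L (unit L) X = 0" and uY: "form L (unit L) Y = 0" and uu: "form L (unit L) (unit L) = 0"
    using XB YA by (simp_all add: form_AA form_BB unit_in)
  have uC: "form L (unit L) C = 1" using form_C(4)[of 0] by (simp add: A0)
  have Cu: "form L C (unit L) = 1" using form_C(2)[of 0] by (simp add: A0)
  have dual': "form L (B' j) (A' i) = (if i = j then 1 else 0)" if "i \<in> {1..q}" "j \<in> {1..q}" for i j
    using dual[OF that] form_sym[OF AL[OF that(1)] BL[OF that(2)]] by simp
  have XA: "form L X (A' i) = form L (A' i) C" if i: "i \<in> {1..q}" for i
  proof -
    have "form L X (A' i) = (\<Sum>j=1..q. form L (A' j) C * form L (B' j) (A' i))"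
      unfolding X_def using AL[OF i] by (subst form_sum_left) (auto simp: form_scale_left BL L_closed)
    also have "\<dots> = form L (A' i) C"
      by (rule trans[OF sum_single[OF _ i]]) (use i in \<open>auto simp: dual'\<close>)
    finally show ?thesis .
  qed
  have YB: "form L Y (B' i) = form L (B' i) C" if i: "i \<in> {1..q}" for i
  proof -
    have "form L Y (B' i) = (\<Sum>j=1..q. form L (B' j) C * form L (A' j) (B' i))"
      unfolding Y_def using BL[OF i] by (subst form_sum_left) (auto simp: form_scale_left AL L_closed)
    also have "\<dots> = form L (B' i) C"
      by (rule trans[OF sum_single[OF _ i]]) (use i in \<open>auto simp: dual\<close>)
    finally show ?thesis .
  qed
  have CA: "form L C (A' i) = form L (A' i) C" and CB: "form L C (B' i) = form L (B' i) C" if "i \<in> {1..q}" for i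
    using that form_sym[OF C_in] AL BL by auto
  have XC: "form L X C = s"
  proof -
    have "form L X C = (\<Sum>j=1..q. form L (A' j) C * form L (B' j) C)"
      unfolding X_def using C_in by (subst form_sum_left) (auto simp: form_scale_left BL L_closed)
    then show ?thesis by (simp add: s_def)
  qed
  have YC: "form L Y C = s"
  proof -
    have "form L Y C = (\<Sum>j=1..q. form L (B' j) C * form L (A' j) C)"
      unfolding Y_def using C_in by (subst form_sum_left) (auto simp: form_scale_left AL L_closed)
    then show ?thesis by (simp add: s_def mult.commute)
  qed
  have XY: "form L X Y = s"
  proof -
    have "form L X Y = (\<Sum>j=1..q. form L (B' j) C * form L X (A' j))"
      unfolding Y_def using XL by (subst form_sum_right) (auto simp: form_scale_right AL L_closed)
    then show ?thesis by (simp add: s_def XA mult.commute)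
  qed
  have XX: "form L X X = 0" and YY: "form L Y Y = 0" using XB YA by (simp_all add: form_AA form_BB)
  have sym: "form L C X = s" "form L C Y = s" "form L Y X = s" "form L X (unit L) = 0" "form L Y (unit L) = 0"
    using XC YC XY uX uY form_sym XL YL C_in unit_in by metis+
  note all = form_add_left form_add_right form_diff_left form_diff_right form_scale_left form_scale_right
    C_in XL YL unit_in L_closed
  show "?E \<in> Lsp L" by (simp add: E all)
  show "form L (unit L) ?E = 1" by (simp add: E all uX uY uu uC)
  show "form L ?E ?E = 0" by (simp add: E all uX uY uu uC Cu XX YY XY XC YC sym form_C)
  show "form L ?E (A' i) = 0" if i: "i \<in> {1..q}"
    using i YA A'[OF i] by (simp add: E all AL XA CA form_AA unit_in)
  show "form L ?E (B' i) = 0" if i: "i \<in> {1..q}"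
    using i XB B'[OF i] by (simp add: E all BL YB CB form_BB unit_in)
qed

lemma linear_rep_shifted_C:
  assumes r: "linear_rep sc L r" and A': "\<And>i. i \<in> {1..q} \<Longrightarrow> A' i \<in> Asp L" and B': "\<And>i. i \<in> {1..q} \<Longrightarrow> B' i \<in> Bsp L"
  shows "r (shifted_C q A' B') = r C - (\<Sum>i=1..q. mat_scale (form L (A' i) C) (r (B' i)))
    - (\<Sum>i=1..q. mat_scale (form L (B' i) C) (r (A' i))) + mat_scale (\<Sum>i=1..q. form L (A' i) C * form L (B' i) C) (mat 1)"
proof -
  note AL = A_in_L[OF A'] and BL = B_in_L[OF B']
  have S: "(\<Sum>i=1..q. sc (form L (A' i) C) (B' i)) \<in> Lsp L" "(\<Sum>i=1..q. sc (form L (B' i) C) (A' i)) \<in> Lsp L"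
    by (intro L_closed AL BL; assumption)+
  have "r (\<Sum>i=1..q. sc (form L (A' i) C) (B' i)) = (\<Sum>i=1..q. mat_scale (form L (A' i) C) (r (B' i)))"
    "r (\<Sum>i=1..q. sc (form L (B' i) C) (A' i)) = (\<Sum>i=1..q. mat_scale (form L (B' i) C) (r (A' i)))"
    by (rule linear_rep_simps(8)[OF r]; erule AL BL)+
  with S show ?thesis unfolding shifted_C_def
    by (simp add: linear_rep_simps(1-7)[OF r] L_closed C_in unit_in)
qed

text \<open>Scalar products of the new basis with the old one are the data of a change of basis as
  in \<open>M_product_change_basis\<close>: those with \<open>B k\<close> and \<open>A k\<close> are
  the matrices g and h, those with C are the shifts, and C' is the correspondingly shifted
  C.\<close>

lemma M_product_adapted_basis:
  assumes r: "linear_rep sc L r" and adapted': "adapted_basis sc L p' A' B' C'"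
  shows "M_product p' (\<lambda>i. r (A' i)) (\<lambda>i. r (B' i)) (r C') = M_product p (\<lambda>i. r (A i)) (\<lambda>i. r (B i)) (r C)"
proof -
  interpret b: adapted_M_structure sc L p' A' B' C'
    by unfold_locales (rule adapted')
  note R = linear_rep_simps(1-7)[OF r] and RS = linear_rep_lincomb[OF r] and SL = lincomb_in_L
  have C': "C' = shifted_C p' A' B'"
    by (rule b.C_unique[symmetric]; rule shifted_C) (auto simp: b.A_in b.B_in b.form_A_B)
  have A': "r (A' i) = (\<Sum>k=1..p. mat_scale (form L (A' i) (B k)) (r (A k))) + mat_scale (form L (A' i) C) (mat 1)"
    if "i \<in> {1..p'}" for i
  proof -
    have "A' i = (\<Sum>k=1..p. sc (form L (A' i) (B k)) (A k)) + sc (form L (A' i) C) (unit L)"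
      using A_expansion[of "A' i"] that by (simp add: b.A_in sum_atLeast0_atMost dualB_def A0 add.commute)
    then have "r (A' i) = r ((\<Sum>k=1..p. sc (form L (A' i) (B k)) (A k)) + sc (form L (A' i) C) (unit L))" by simp
    then show ?thesis by (simp add: R RS SL L_closed unit_in)
  qed
  have B': "r (B' i) = (\<Sum>k=1..p. mat_scale (form L (B' i) (A k)) (r (B k))) + mat_scale (form L (B' i) C) (mat 1)"
    if "i \<in> {1..p'}" for i
  proof -
    have "B' i = (\<Sum>k=1..p. sc (form L (B' i) (A k)) (B k)) + sc (form L (B' i) C) (unit L)"
      using B_expansion[of "B' i"] that by (simp add: b.B_in sum_atLeast0_atMost dualA_def B0 add.commute)
    then have "r (B' i) = r ((\<Sum>k=1..p. sc (form L (B' i) (A k)) (B k)) + sc (form L (B' i) C) (unit L))" by simp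
    then show ?thesis by (simp add: R RS SL L_closed unit_in)
  qed
  \<comment> \<open>Expand \<open>A l\<close> in the new basis and pair with \<open>B k\<close>; the
    unit component is invisible there, as B is isotropic.\<close>
  have gh: "(\<Sum>i=1..p'. form L (A' i) (B k) * form L (B' i) (A l)) = (if k = l then 1 else 0)"
    if k: "k \<in> {1..p}" and l: "l \<in> {1..p}" for k l
  proof -
    have "A l = (\<Sum>i=1..p'. sc (form L (A l) (B' i)) (A' i)) + sc (form L (A l) C') (unit L)"
      using b.A_expansion[of "A l"] l by (simp add: A_in sum_atLeast0_atMost b.dualB_def b.A0 add.commute)
    then have "form L (A l) (B k) = form L ((\<Sum>i=1..p'. sc (form L (A l) (B' i)) (A' i)) + sc (form L (A l) C') (unit L)) (B k)"
      by simp
    also have "\<dots> = form L (\<Sum>i=1..p'. sc (form L (A l) (B' i)) (A' i)) (B k)"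
      using k by (simp add: form_add_left form_scale_left b.lincomb_in_L L_closed B_inL unit_in form_BB B_in)
    also have "\<dots> = (\<Sum>i=1..p'. form L (A l) (B' i) * form L (A' i) (B k))"
      using k by (subst form_sum_left) (auto simp: form_scale_left L_closed b.A_inL B_inL)
    also have "\<dots> = (\<Sum>i=1..p'. form L (A' i) (B k) * form L (B' i) (A l))"
      using l by (intro sum.cong refl) (simp add: form_sym[of "A l"] A_inL b.B_inL)
    finally show ?thesis using k l by (auto simp: form_A_B)
  qed
  have rC': "r C' = r C - (\<Sum>i=1..p'. mat_scale (form L (A' i) C) (r (B' i)))
    - (\<Sum>i=1..p'. mat_scale (form L (B' i) C) (r (A' i))) + mat_scale (\<Sum>i=1..p'. form L (A' i) C * form L (B' i) C) (mat 1)"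
    unfolding C' by (rule linear_rep_shifted_C[OF r]) (simp_all add: b.A_in b.B_in)
  show ?thesis
    unfolding rC'
    by (rule M_product_change_basis[where g = "\<lambda>i k. form L (A' i) (B k)" and h = "\<lambda>i k. form L (B' i) (A k)"])
      (fact A' B' gh)+
qed

end

section \<open>Pairs with the same product\<close>

lemma indep_family_coefficients:
  assumes "vector_space sc" "lin_indep_family sc I f" "finite I"
    and "(\<Sum>i\<in>I. sc (x i) (f i)) = (\<Sum>i\<in>I. sc (y i) (f i))" and k: "k \<in> I"
  shows "x k = y k"
proof -
  interpret vector_space sc by fact
  have "(\<Sum>i\<in>I. sc (x i - y i) (f i)) = 0"
    using assms(4) by (simp add: scale_left_diff_distrib sum_subtractf)
  then have "x k - y k = 0"
    using assms(2) k by (auto simp: lin_indep_family_iff[OF assms(1,3)])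
  then show ?thesis by simp
qed

context adapted_M_structure
begin

text \<open>Injectivity on the subspace A is non-degeneracy without reference to a basis. It carries
  independence over from the basis in the definition of non-degeneracy to any other adapted
  basis.\<close>

lemma linear_rep_injective_A:
  assumes r: "linear_rep sc L r" and ind: "lin_indep_family mat_scale {0..p} (\<lambda>i. r (A i))"
    and a: "a \<in> Asp L" "r a = 0"
  shows "a = 0"
proof -
  have e: "a = (\<Sum>k=0..p. sc (form L a (dualB k)) (A k))" by (rule A_expansion[OF a(1)])
  have "(\<Sum>k=0..p. mat_scale (form L a (dualB k)) (r (A k))) = 0"
    using a(2) e linear_rep_lincomb(1)[OF r] by metis
  then have "\<forall>k\<in>{0..p}. form L a (dualB k) = 0"
    using spec[OF ind[unfolded lin_indep_family_iff[OF mat.vector_space_axioms finite_atLeastAtMost]],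
      of "\<lambda>k. form L a (dualB k)"] by blast
  then show ?thesis using e by simp
qed

lemma linear_rep_injective_B:
  assumes r: "linear_rep sc L r" and ind: "lin_indep_family mat_scale {0..p} (\<lambda>i. r (B i))"
    and b: "b \<in> Bsp L" "r b = 0"
  shows "b = 0"
proof -
  have e: "b = (\<Sum>k=0..p. sc (form L b (dualA k)) (B k))" by (rule B_expansion[OF b(1)])
  have "(\<Sum>k=0..p. mat_scale (form L b (dualA k)) (r (B k))) = 0"
    using b(2) e linear_rep_lincomb(3)[OF r] by metis
  then have "\<forall>k\<in>{0..p}. form L b (dualA k) = 0"
    using spec[OF ind[unfolded lin_indep_family_iff[OF mat.vector_space_axioms finite_atLeastAtMost]],
      of "\<lambda>k. form L b (dualA k)"] by blast
  then show ?thesis using e by simp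
qed

lemma linear_rep_independent_A:
  assumes r: "linear_rep sc L r" and inj: "\<And>a. a \<in> Asp L \<Longrightarrow> r a = 0 \<Longrightarrow> a = 0"
  shows "lin_indep_family mat_scale {0..p} (\<lambda>i. r (A i))"
  unfolding lin_indep_family_iff[OF mat.vector_space_axioms finite_atLeastAtMost]
proof (intro allI impI)
  fix u assume "(\<Sum>i=0..p. mat_scale (u i) (r (A i))) = 0"
  then have "r (\<Sum>k=0..p. sc (u k) (A k)) = 0" by (simp add: linear_rep_lincomb[OF r])
  moreover have "(\<Sum>k=0..p. sc (u k) (A k)) \<in> Asp L"
    using subspace_A(1) A_in by (intro subspace_sum subspace_scale) auto
  ultimately have "(\<Sum>k=0..p. sc (u k) (A k)) = 0" by (rule inj[rotated])
  then show "\<forall>i\<in>{0..p}. u i = 0"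
    using indep_A by (simp add: lin_indep_family_iff[OF vector_space_axioms])
qed

lemma linear_rep_independent_B:
  assumes r: "linear_rep sc L r" and inj: "\<And>b. b \<in> Bsp L \<Longrightarrow> r b = 0 \<Longrightarrow> b = 0"
  shows "lin_indep_family mat_scale {0..p} (\<lambda>i. r (B i))"
  unfolding lin_indep_family_iff[OF mat.vector_space_axioms finite_atLeastAtMost]
proof (intro allI impI)
  fix u assume "(\<Sum>i=0..p. mat_scale (u i) (r (B i))) = 0"
  then have "r (\<Sum>k=0..p. sc (u k) (B k)) = 0" by (simp add: linear_rep_lincomb[OF r])
  moreover have "(\<Sum>k=0..p. sc (u k) (B k)) \<in> Bsp L"
    using subspace_B(1) B_in by (intro subspace_sum subspace_scale) auto
  ultimately have "(\<Sum>k=0..p. sc (u k) (B k)) = 0" by (rule inj[rotated])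
  then show "\<forall>i\<in>{0..p}. u i = 0"
    using indep_B by (simp add: lin_indep_family_iff[OF vector_space_axioms])
qed

text \<open>A vector outside the smaller span would give p + 2 independent vectors in a space
  spanned by p + 1.\<close>

lemma span_eq_of_independent:
  assumes ind: "lin_indep_family sc {0..p} X" and sub: "\<And>i. i \<in> {0..p} \<Longrightarrow> X i \<in> span (Y ` {0..p})"
  shows "span (X ` {0..p}) = span (Y ` {0..p})"
proof
  show "span (X ` {0..p}) \<subseteq> span (Y ` {0..p})"
    using sub by (intro span_minimal) auto
  have inj: "inj_on X {0..p}" and indX: "independent (X ` {0..p})" using ind by (auto simp: lin_indep_family_def)
  show "span (Y ` {0..p}) \<subseteq> span (X ` {0..p})"
  proof (rule subsetI, rule ccontr)
    fix v assume v: "v \<in> span (Y ` {0..p})" and n: "v \<notin> span (X ` {0..p})"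
    then have "independent (insert v (X ` {0..p}))" using indX by (simp add: independent_insertI)
    moreover have "insert v (X ` {0..p}) \<subseteq> span (Y ` {0..p})" using v sub by auto
    ultimately have "card (insert v (X ` {0..p})) \<le> card (Y ` {0..p})"
      using independent_span_bound[of "Y ` {0..p}"] by simp
    also have "\<dots> \<le> p + 1" using card_image_le[of "{0..p}" Y] by simp
    also have "p + 1 = card (X ` {0..p})" by (simp add: card_image[OF inj])
    finally have "v \<in> X ` {0..p}" by (auto simp: card_insert_if split: if_splits)
    then show False using n span_base by blast
  qed
qed

text \<open>The coefficients that relate the matrices are applied to the basis of L itself.
  Independence of the new vectors is inherited from their matrices, duality is the condition on g
  and h, and the last vector has to be \<open>shifted_C\<close>, whose matrix is the prescribed
  one.\<close>

lemma transformed_adapted_basis: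
  assumes r: "linear_rep sc L r"
    and ind: "lin_indep_family mat_scale {0..p} a'" "lin_indep_family mat_scale {0..p} b'"
    and unit: "a' 0 = mat 1" "b' 0 = mat 1"
    and a': "\<And>i. i \<in> {1..p} \<Longrightarrow> a' i = (\<Sum>k=1..p. mat_scale (g i k) (r (A k))) + mat_scale (u i) (mat 1)"
    and b': "\<And>i. i \<in> {1..p} \<Longrightarrow> b' i = (\<Sum>k=1..p. mat_scale (h i k) (r (B k))) + mat_scale (v i) (mat 1)"
    and gh: "\<And>i j. i \<in> {1..p} \<Longrightarrow> j \<in> {1..p} \<Longrightarrow> (\<Sum>k=1..p. g i k * h j k) = (if i = j then 1 else 0)"
    and c': "c' = r C - (\<Sum>i=1..p. mat_scale (u i) (b' i)) - (\<Sum>i=1..p. mat_scale (v i) (a' i))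
           + mat_scale (\<Sum>i=1..p. u i * v i) (mat 1)"
  shows "\<exists>A' B' C'. adapted_basis sc L p A' B' C' \<and> (\<forall>i\<in>{0..p}. r (A' i) = a' i \<and> r (B' i) = b' i) \<and> r C' = c'"
proof -
  note R = linear_rep_simps(1-7)[OF r] and RS = linear_rep_lincomb[OF r] and SL = lincomb_in_L
  define A' where "A' i = (if i = 0 then unit L else (\<Sum>k=1..p. sc (g i k) (A k)) + sc (u i) (unit L))" for i
  define B' where "B' i = (if i = 0 then unit L else (\<Sum>k=1..p. sc (h i k) (B k)) + sc (v i) (unit L))" for i
  define C' where "C' = shifted_C p A' B'"
  have A'in: "A' i \<in> Asp L" and B'in: "B' i \<in> Bsp L" for i
    using subspace_A(1) subspace_B(1) A_in' B_in' unit_in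
    by (auto simp: A'_def B'_def intro!: subspace_add subspace_sum subspace_scale)
  have rA: "r (A' i) = a' i" and rB: "r (B' i) = b' i" if "i \<in> {0..p}" for i
    using that a'[of i] b'[of i] by (auto simp: A'_def B'_def R RS SL unit L_closed unit_in)
  have AC: "form L (A' i) C = u i" and BC: "form L (B' i) C = v i" if "i \<in> {1..p}" for i
  proof -
    have uC: "form L (unit L) C = 1" using form_C(4)[of 0] by (simp add: A0)
    have "form L (\<Sum>k=1..p. sc (g i k) (A k)) C = 0" "form L (\<Sum>k=1..p. sc (h i k) (B k)) C = 0"
      by (subst form_sum_left; auto simp: form_scale_left L_closed A_inL B_inL C_in form_C)+
    then show "form L (A' i) C = u i" "form L (B' i) C = v i"
      using that by (auto simp: A'_def B'_def form_add_left form_scale_left SL L_closed unit_in C_in uC)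
  qed
  have AB: "form L (A' i) (B' j) = (if i = j then 1 else 0)" if i: "i \<in> {1..p}" and j: "j \<in> {1..p}" for i j
  proof -
    have *: "form L (A k) (\<Sum>l=1..p. sc (h j l) (B l)) = h j k" if k: "k \<in> {1..p}" for k
    proof -
      have "form L (A k) (\<Sum>l=1..p. sc (h j l) (B l)) = (\<Sum>l=1..p. h j l * form L (A k) (B l))"
        using k by (subst form_sum_right) (auto simp: form_scale_right L_closed A_inL B_inL)
      also have "\<dots> = h j k" by (rule trans[OF sum_single[OF _ k]]) (use k in \<open>auto simp: form_A_B\<close>)
      finally show ?thesis .
    qed
    have "form L (\<Sum>k=1..p. sc (g i k) (A k)) (\<Sum>l=1..p. sc (h j l) (B l)) = (\<Sum>k=1..p. g i k * h j k)"
      by (subst form_sum_left) (auto simp: form_scale_left L_closed A_inL SL *)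
    moreover have "(\<Sum>k=1..p. sc (g i k) (A k)) \<in> Asp L" "(\<Sum>l=1..p. sc (h j l) (B l)) \<in> Bsp L"
      using subspace_A(1) subspace_B(1) A_in' B_in' by (auto intro!: subspace_sum subspace_scale)
    ultimately show ?thesis
      using i j gh[OF i j]
      by (simp add: A'_def B'_def form_add_left form_add_right form_scale_left form_scale_right SL L_closed unit_in
          form_AA form_BB)
  qed
  have "lin_indep_family sc {0..p} X" if X: "\<And>i. i \<in> {0..p} \<Longrightarrow> X i \<in> Lsp L"
    and "lin_indep_family mat_scale {0..p} x" "\<And>i. i \<in> {0..p} \<Longrightarrow> r (X i) = x i" for X x
    unfolding lin_indep_family_iff[OF vector_space_axioms finite_atLeastAtMost]
  proof (intro allI impI)
    fix y assume "(\<Sum>i=0..p. sc (y i) (X i)) = 0"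
    then have "r (\<Sum>i=0..p. sc (y i) (X i)) = 0" by (simp add: R)
    moreover have "r (\<Sum>i=0..p. sc (y i) (X i)) = (\<Sum>i=0..p. mat_scale (y i) (r (X i)))"
      by (rule linear_rep_simps(8)[OF r X])
    moreover have "\<dots> = (\<Sum>i=0..p. mat_scale (y i) (x i))" by (intro sum.cong refl) (simp add: that)
    ultimately show "\<forall>i\<in>{0..p}. y i = 0"
      using that(2) by (auto simp: lin_indep_family_iff[OF mat.vector_space_axioms])
  qed
  from this[OF A_in_L[OF A'in] ind(1) rA] this[OF B_in_L[OF B'in] ind(2) rB]
  have indA: "lin_indep_family sc {0..p} A'" and indB: "lin_indep_family sc {0..p} B'" by auto
  have spA: "span (A' ` {0..p}) = Asp L"
    using span_eq_of_independent[OF indA, of A] A'in by (simp add: span_A)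
  have spB: "span (B' ` {0..p}) = Bsp L"
    using span_eq_of_independent[OF indB, of B] B'in by (simp add: span_B)
  note sC = shifted_C[of p A' B', OF A'in B'in AB, folded C'_def]
  have "A' 0 = unit L" "B' 0 = unit L" by (simp_all add: A'_def B'_def)
  then have "adapted_basis sc L p A' B' C'"
    unfolding adapted_basis_def using indA indB spA spB sC AB by simp
  moreover have "r C' = c'"
    unfolding C'_def linear_rep_shifted_C[OF r A'in B'in] c'
    by (simp add: AC BC rA rB)
  ultimately show ?thesis using rA rB by blast
qed

end

lemma same_coordsI:
  assumes "v = (\<Sum>k=1..p. sc (\<alpha> k) (A k)) + (\<Sum>k=0..p. sc (\<beta> k) (B k)) + sc \<gamma> C"
    and "v' = (\<Sum>k=1..p. sc (\<alpha>' k) (A' k)) + (\<Sum>k=0..p. sc (\<beta>' k) (B' k)) + sc \<gamma> C'"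
    and "\<And>k. k \<in> {1..p} \<Longrightarrow> \<alpha>' k = \<alpha> k" and "\<And>k. k \<in> {0..p} \<Longrightarrow> \<beta>' k = \<beta> k"
  shows "same_coords sc p A B C A' B' C' v v'"
proof -
  have "v' = (\<Sum>k=1..p. sc (\<alpha> k) (A' k)) + (\<Sum>k=0..p. sc (\<beta> k) (B' k)) + sc \<gamma> C'"
    unfolding assms(2)
    by (intro arg_cong2[of _ _ _ _ "(+)"] refl sum.cong) (simp_all only: assms(3,4))
  with assms(1) show ?thesis unfolding same_coords_def by blast
qed

text \<open>The constants are recovered from matrices in an order in which each comparison involves
  one independent family: \<phi> from the products of the A's, \<psi> from those of the B's, then
  \<open>t\<close>, where all other terms are known to agree, and finally the free coefficients of
  the products with C.\<close>

lemma same_structure_constants_if_linear_rep: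
  assumes x: "adapted_M_structure sc L p A B C" and y: "adapted_M_structure sc L' p A' B' C'"
    and r: "linear_rep sc L r" and r': "linear_rep sc L' r'"
    and inda: "lin_indep_family mat_scale {0..p} (\<lambda>i. r (A i))" and indb: "lin_indep_family mat_scale {0..p} (\<lambda>i. r (B i))"
    and eqA: "\<And>i. i \<in> {0..p} \<Longrightarrow> r' (A' i) = r (A i)" and eqB: "\<And>i. i \<in> {0..p} \<Longrightarrow> r' (B' i) = r (B i)"
    and eqC: "r' C' = r C"
  shows "same_structure_constants sc p L A B C L' A' B' C'"
proof -
  interpret x: adapted_M_structure sc L p A B C by fact
  interpret y: adapted_M_structure sc L' p A' B' C' by fact
  note X = x.linear_rep_AB[OF r] and Y = y.linear_rep_AB[OF r']
  note ca = indep_family_coefficients[OF mat.vector_space_axioms inda finite_atLeastAtMost]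
  note cb = indep_family_coefficients[OF mat.vector_space_axioms indb finite_atLeastAtMost]
  have A: "(\<Sum>k=0..p. mat_scale (u k) (r' (A' k))) = (\<Sum>k=0..p. mat_scale (u k) (r (A k)))"
    "(\<Sum>k=1..p. mat_scale (u k) (r' (A' k))) = (\<Sum>k=1..p. mat_scale (u k) (r (A k)))"
    and B: "(\<Sum>k=0..p. mat_scale (u k) (r' (B' k))) = (\<Sum>k=0..p. mat_scale (u k) (r (B k)))"
    "(\<Sum>k=1..p. mat_scale (u k) (r' (B' k))) = (\<Sum>k=1..p. mat_scale (u k) (r (B k)))" for u
    by (intro sum.cong refl; simp add: eqA eqB)+
  have \<phi>: "y.\<phi> i j k = x.\<phi> i j k" if "i \<in> {1..p}" "j \<in> {1..p}" "k \<in> {0..p}" for i j k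
    using Y(3)[OF that(1,2)] X(3)[OF that(1,2)] that by (intro ca) (simp_all add: eqA A)
  have \<psi>: "y.\<psi> i j k = x.\<psi> i j k" if "i \<in> {1..p}" "j \<in> {1..p}" "k \<in> {0..p}" for i j k
    using Y(4)[OF that(1,2)] X(4)[OF that(1,2)] that by (intro cb) (simp_all add: eqB B)
  have \<psi>s: "(\<Sum>k=1..p. mat_scale (y.\<psi> k i j) (u k)) = (\<Sum>k=1..p. mat_scale (x.\<psi> k i j) (u k :: complex^'n^'n))"
    if "i \<in> {1..p}" "j \<in> {0..p}" for i j u
    using that by (intro sum.cong refl) (simp add: \<psi>)
  have \<phi>s: "(\<Sum>k=1..p. mat_scale (y.\<phi> j k i) (u k)) = (\<Sum>k=1..p. mat_scale (x.\<phi> j k i) (u k :: complex^'n^'n))"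
    if "j \<in> {1..p}" "i \<in> {0..p}" for i j u
    using that by (intro sum.cong refl) (simp add: \<phi>)
  have t: "y.t i j = x.t i j" if i: "i \<in> {1..p}" and j: "j \<in> {1..p}" for i j
  proof -
    have "mat_scale (y.t i j) (mat 1) = mat_scale (x.t i j) (mat 1 :: complex^'n^'n)"
      using Y(5)[OF i j] X(5)[OF i j] i j by (cases "i = j") (simp_all add: eqA eqB eqC A B \<phi>s \<psi>s)
    then show ?thesis by simp
  qed
  have BC: "form L' (lact L' (B' i) C') (y.dualA k) = form L (lact L (B i) C) (x.dualA k)"
    if i: "i \<in> {1..p}" and k: "k \<in> {0..p}" for i k
    using Y(6)[OF i] X(6)[OF i] i k by (intro cb) (simp_all add: eqA eqB eqC A B \<psi>s)
  have CA: "form L' (ract L' C' (A' i)) (y.dualB k) = form L (ract L C (A i)) (x.dualB k)"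
    if i: "i \<in> {1..p}" and k: "k \<in> {0..p}" for i k
    using Y(7)[OF i] X(7)[OF i] i k by (intro ca) (simp_all add: eqA eqB eqC A B \<phi>s)
  \<comment> \<open>The unit belongs to the B-coordinates, so the constant at index 0 moves from the
    expansion in the \<open>A k\<close> to the coordinate of \<open>B 0\<close>.\<close>
  have s1: "same_coords sc p A B C A' B' C' (mulA L (A i) (A j)) (mulA L' (A' i) (A' j))"
    if ij: "i \<in> {1..p}" "j \<in> {1..p}" for i j
    by (rule same_coordsI[where \<alpha> = "x.\<phi> i j" and \<beta> = "\<lambda>k. if k = 0 then x.\<phi> i j 0 else 0" and \<gamma> = 0 and \<alpha>' = "y.\<phi> i j" and \<beta>' = "\<lambda>k. if k = 0 then y.\<phi> i j 0 else 0"])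
      (use ij in \<open>auto simp: x.mulA_expansion y.mulA_expansion \<phi> sum_atLeast0_atMost x.A0 y.A0 x.B0 y.B0\<close>)
  have s2: "same_coords sc p A B C A' B' C' (mulB L (B i) (B j)) (mulB L' (B' i) (B' j))"
    if ij: "i \<in> {1..p}" "j \<in> {1..p}" for i j
    by (rule same_coordsI[where \<alpha> = "\<lambda>_. 0" and \<beta> = "x.\<psi> i j" and \<gamma> = 0 and \<alpha>' = "\<lambda>_. 0" and \<beta>' = "y.\<psi> i j"])
      (use ij in \<open>auto simp: x.mulB_expansion y.mulB_expansion \<psi>\<close>)
  have s3: "same_coords sc p A B C A' B' C' (lact L (B i) (A j)) (lact L' (B' i) (A' j))"
    if ij: "i \<in> {1..p}" "j \<in> {1..p}" for i j
    by (rule same_coordsI[where \<alpha> = "\<lambda>k. x.\<psi> k i j" and \<beta> = "\<lambda>k. if k = 0 then x.t i j else x.\<phi> j k i" and \<gamma> = "if i = j then 1 else 0" and \<alpha>' = "\<lambda>k. y.\<psi> k i j" and \<beta>' = "\<lambda>k. if k = 0 then y.t i j else y.\<phi> j k i"])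
      (use ij in \<open>auto simp: x.lact_BA_expansion y.lact_BA_expansion \<phi> \<psi> t sum_atLeast0_atMost x.B0 y.B0\<close>)
  have s4: "same_coords sc p A B C A' B' C' (lact L (B i) C) (lact L' (B' i) C')" if i: "i \<in> {1..p}" for i
  proof -
    define x where "x k = form L (lact L (B i) C) (x.dualA k)" for k
    define y where "y k = form L' (lact L' (B' i) C') (y.dualA k)" for k
    have "lact L (B i) C = (\<Sum>k=1..p. sc (x.\<psi> k i 0) (A k)) + (\<Sum>k=0..p. sc (x k) (B k))"
      and "lact L' (B' i) C' = (\<Sum>k=1..p. sc (y.\<psi> k i 0) (A' k)) + (\<Sum>k=0..p. sc (y k) (B' k))"
      and "\<And>k. k \<in> {0..p} \<Longrightarrow> y k = x k"
      unfolding x_def y_def by (rule x.lact_BC_expansion[OF i] y.lact_BC_expansion[OF i] BC[OF i]; assumption?)+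
    then show ?thesis
      by (intro same_coordsI[where \<alpha> = "\<lambda>k. x.\<psi> k i 0" and \<beta> = x and \<gamma> = 0 and \<alpha>' = "\<lambda>k. y.\<psi> k i 0" and \<beta>' = y])
        (use i in \<open>simp_all add: \<psi>\<close>)
  qed
  have s5: "same_coords sc p A B C A' B' C' (ract L C (A i)) (ract L' C' (A' i))" if i: "i \<in> {1..p}" for i
  proof -
    define x where "x k = form L (ract L C (A i)) (x.dualB k)" for k
    define y where "y k = form L' (ract L' C' (A' i)) (y.dualB k)" for k
    have "ract L C (A i) = (\<Sum>k=1..p. sc (x.\<phi> i k 0) (B k)) + (\<Sum>k=0..p. sc (x k) (A k))"
      and "ract L' C' (A' i) = (\<Sum>k=1..p. sc (y.\<phi> i k 0) (B' k)) + (\<Sum>k=0..p. sc (y k) (A' k))"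
      and "\<And>k. k \<in> {0..p} \<Longrightarrow> y k = x k"
      unfolding x_def y_def by (rule x.ract_CA_expansion[OF i] y.ract_CA_expansion[OF i] CA[OF i]; assumption?)+
    then show ?thesis
      by (intro same_coordsI[where \<alpha> = x and \<beta> = "\<lambda>k. if k = 0 then x 0 else x.\<phi> i k 0" and \<gamma> = 0
            and \<alpha>' = y and \<beta>' = "\<lambda>k. if k = 0 then y 0 else y.\<phi> i k 0"])
        (use i in \<open>simp_all add: \<phi> sum_atLeast0_atMost x.A0 y.A0 x.B0 y.B0 add_ac\<close>)
  qed
  show ?thesis
    unfolding same_structure_constants_def using s1 s2 s3 s4 s5 by blast
qed

context adapted_M_structure
begin

text \<open>Independence identifies the given coefficients with the structure constants of L. The
  coefficients of \<open>C A_j\<close> along A and of \<open>B_j C\<close> along B are thus known in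
  L itself and not only in matrices, and the commutator formulas show that K commutes with
  \<open>A_j\<close> and \<open>B_j\<close> in U(L).\<close>

lemma central_if_matrix_relations:
  assumes r: "linear_rep sc L r"
    and inda: "lin_indep_family mat_scale {0..p} (\<lambda>i. r (A i))" and indb: "lin_indep_family mat_scale {0..p} (\<lambda>i. r (B i))"
    and rel: "matrix_relations p (\<lambda>i. r (A i)) (\<lambda>i. r (B i)) (r C) \<phi>' \<psi>' t'"
  shows "U_central sc L (K_elem sc L p A B C)"
proof -
  interpret m: matrix_relations p "\<lambda>i. r (A i)" "\<lambda>i. r (B i)" "r C" \<phi>' \<psi>' t' by fact
  note X = linear_rep_AB[OF r]
  note ca = indep_family_coefficients[OF mat.vector_space_axioms inda finite_atLeastAtMost]
  note cb = indep_family_coefficients[OF mat.vector_space_axioms indb finite_atLeastAtMost]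
  have \<phi>: "\<phi>' i j k = \<phi> i j k" if "i \<in> {1..p}" "j \<in> {1..p}" "k \<in> {0..p}" for i j k
    using X(3)[OF that(1,2)] m.aa[OF that(1,2)] that by (intro ca) simp_all
  have \<psi>: "\<psi>' i j k = \<psi> i j k" if "i \<in> {1..p}" "j \<in> {1..p}" "k \<in> {0..p}" for i j k
    using X(4)[OF that(1,2)] m.bb[OF that(1,2)] that by (intro cb) simp_all
  have \<psi>s: "(\<Sum>k=1..p. mat_scale (\<psi>' k i j) (u k)) = (\<Sum>k=1..p. mat_scale (\<psi> k i j) (u k :: complex^'b^'b))"
    if "i \<in> {1..p}" "j \<in> {0..p}" for i j u
    using that by (intro sum.cong refl) (simp add: \<psi>)
  have \<phi>s: "(\<Sum>k=1..p. mat_scale (\<phi>' j k i) (u k)) = (\<Sum>k=1..p. mat_scale (\<phi> j k i) (u k :: complex^'b^'b))"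
    if "j \<in> {1..p}" "i \<in> {0..p}" for i j u
    using that by (intro sum.cong refl) (simp add: \<phi>)
  have t: "t' i j = t i j" if i: "i \<in> {1..p}" and j: "j \<in> {1..p}" for i j
  proof -
    have "mat_scale (t' i j) (mat 1) = mat_scale (t i j) (mat 1 :: complex^'b^'b)"
      using X(5)[OF i j] m.ba[OF i j] i j by (simp add: \<phi>s \<psi>s)
    then show ?thesis by simp
  qed
  have w: "contraction p \<phi>' \<psi>' t' i j = contraction p \<phi> \<psi> t i j" if "i \<in> {0..p}" "j \<in> {0..p}" for i j
    using that by (auto simp: contraction_def t \<phi> \<psi> intro!: sum.cong)
  have CA: "form L (ract L C (A j)) (dualB k) = - contraction p \<phi> \<psi> t k j" if j: "j \<in> {1..p}" and k: "k \<in> {0..p}" for j k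
  proof -
    have "(\<Sum>k=0..p. mat_scale (form L (ract L C (A j)) (dualB k)) (r (A k)))
        = (\<Sum>k=0..p. mat_scale (- contraction p \<phi>' \<psi>' t' k j) (r (A k)))"
      using X(7)[OF j] m.ca[OF j] j by (simp add: \<phi>s sum_negf)
    from ca[OF this k] show ?thesis using j k by (simp add: w)
  qed
  have BC: "form L (lact L (B j) C) (dualA k) = - contraction p \<phi> \<psi> t j k" if j: "j \<in> {1..p}" and k: "k \<in> {0..p}" for j k
  proof -
    have "(\<Sum>k=0..p. mat_scale (form L (lact L (B j) C) (dualA k)) (r (B k)))
        = (\<Sum>k=0..p. mat_scale (- contraction p \<phi>' \<psi>' t' j k) (r (B k)))"
      using X(6)[OF j] m.bc[OF j] j by (simp add: \<psi>s sum_negf)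
    from cb[OF this k] show ?thesis using j k by (simp add: w)
  qed
  \<comment> \<open>Commutation with K modulo the ideal; it is stable under sums, products and
    congruence, so it needs checking on A, B and C only.\<close>
  define P where "P f \<longleftrightarrow> f \<in> F \<and> K_free * f - f * K_free \<in> I" for f
  have P_scalar: "P (scalar d)" for d
    by (simp add: P_def free_alg_closed I_zero scalar_commute)
  have P_add: "P (f + g)" if "P f" "P g" for f g
    using that I_add[of "K_free * f - f * K_free" "K_free * g - g * K_free"]
    by (simp add: P_def free_alg_closed algebra_simps)
  have P_mult: "P (f * g)" if "P f" "P g" for f g
  proof -
    have "(K_free * f - f * K_free) * g + f * (K_free * g - g * K_free) \<in> I"
      using that by (intro I_add I_mult) (auto simp: P_def)
    then show ?thesis using that by (simp add: P_def free_alg_closed algebra_simps)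
  qed
  have P_cong: "P f" if "f - g \<in> I" "P g" "f \<in> F" for f g
  proof -
    have "K_free * (f - g) - (f - g) * K_free + (K_free * g - g * K_free) \<in> I"
      using that(2) I_diff[OF I_mult[OF that(1) K_free_in]] by (intro I_add) (auto simp: P_def)
    then show ?thesis using that by (simp add: P_def algebra_simps)
  qed
  have P_diff: "P (f - g)" if "P f" "P g" for f g
    using P_add[OF that(1) P_mult[OF P_scalar[of "- 1"] that(2)]] by (simp add: scalar_uminus scalar_one)
  have P_sum: "P (sum f J)" if "\<And>i. i \<in> J \<Longrightarrow> P (f i)" for f :: "nat \<Rightarrow> 'v list \<Rightarrow>\<^sub>0 complex" and J
    using that P_scalar[of 0] by (induction J rule: infinite_finite_induct) (auto simp: scalar_zero P_add)
  have unit: "scalar x * (gen (unit L) - 1) \<in> I" for x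
    by (rule I_mult(1)[OF gen_unit]) (rule free_alg_closed)
  have P_A: "P (gen (A j))" if j: "j \<in> {0..p}" for j
  proof (cases "j = 0")
    case True
    have "P (gen (unit L))"
      by (rule P_cong[of _ 1]) (use gen_unit P_scalar[of 1] in \<open>simp_all add: scalar_one free_alg_closed unit_in\<close>)
    then show ?thesis using True by (simp add: A0)
  next
    case False
    then have j: "j \<in> {1..p}" using that by auto
    define y where "y k = contraction p \<phi> \<psi> t k j" for k
    define X where "X = (\<Sum>k=1..p. sc (\<phi> j k 0) (B k))"
    define Y where "Y = (\<Sum>k=0..p. sc (y k) (A k))"
    have "(\<Sum>k=0..p. sc (form L (ract L C (A j)) (dualB k)) (A k)) = (\<Sum>k=0..p. - sc (y k) (A k))"
      using j by (intro sum.cong refl) (simp add: CA y_def)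
    then have "ract L C (A j) = X - Y"
      using ract_CA_expansion[OF j] by (simp add: X_def Y_def sum_negf)
    then have 1: "gen C * gen (A j) - gen (X - Y) \<in> I" using gen_ract[OF C_in A_in'[OF j]] by simp
    have "X \<in> Lsp L" "Y \<in> Lsp L" by (simp_all add: X_def Y_def lincomb_in_L)
    then have 2: "gen (X - Y) - (gen X - gen Y) \<in> I" by (rule gen_diff)
    have 3: "gen X - (\<Sum>k=1..p. scalar (\<phi> j k 0) * gen (B k)) \<in> I"
      unfolding X_def by (rule gen_lincomb) (simp add: B_inL)
    have 4: "gen Y - (\<Sum>k=0..p. scalar (y k) * gen (A k)) \<in> I"
      unfolding Y_def by (rule gen_lincomb) (simp add: A_inL)
    have "gen C * gen (A j) - gen (X - Y) + (gen (X - Y) - (gen X - gen Y)) + (gen X - (\<Sum>k=1..p. scalar (\<phi> j k 0) * gen (B k)))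
       - (gen Y - (\<Sum>k=0..p. scalar (y k) * gen (A k))) - scalar (y 0) * (gen (unit L) - 1) \<in> I"
      by (intro I_add I_diff 1 2 3 4 unit)
    then have "gen C * gen (A j) - ((\<Sum>k=1..p. scalar (\<phi> j k 0) * gen (B k))
       - scalar (y 0) - (\<Sum>k=1..p. scalar (y k) * gen (A k))) \<in> I"
      by (simp add: sum_atLeast0_atMost A0 algebra_simps)
    from I_add[OF K_free_commutator_A[OF j] this[unfolded y_def]] show ?thesis
      using j by (simp add: P_def free_alg_closed A_inL)
  qed
  have P_B: "P (gen (B j))" if j: "j \<in> {0..p}" for j
  proof (cases "j = 0")
    case True
    then show ?thesis using P_A[of 0] by (simp add: A0 B0)
  next
    case False
    then have j: "j \<in> {1..p}" using that by auto
    define y where "y k = contraction p \<phi> \<psi> t j k" for k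
    define X where "X = (\<Sum>k=1..p. sc (\<psi> k j 0) (A k))"
    define Y where "Y = (\<Sum>k=0..p. sc (y k) (B k))"
    have "(\<Sum>k=0..p. sc (form L (lact L (B j) C) (dualA k)) (B k)) = (\<Sum>k=0..p. - sc (y k) (B k))"
      using j by (intro sum.cong refl) (simp add: BC y_def)
    then have "lact L (B j) C = X - Y"
      using lact_BC_expansion[OF j] by (simp add: X_def Y_def sum_negf)
    then have 1: "gen (B j) * gen C - gen (X - Y) \<in> I" using gen_lact[OF B_in'[OF j] C_in] by simp
    have "X \<in> Lsp L" "Y \<in> Lsp L" by (simp_all add: X_def Y_def lincomb_in_L)
    then have 2: "gen (X - Y) - (gen X - gen Y) \<in> I" by (rule gen_diff)
    have 3: "gen X - (\<Sum>k=1..p. scalar (\<psi> k j 0) * gen (A k)) \<in> I"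
      unfolding X_def by (rule gen_lincomb) (simp add: A_inL)
    have 4: "gen Y - (\<Sum>k=0..p. scalar (y k) * gen (B k)) \<in> I"
      unfolding Y_def by (rule gen_lincomb) (simp add: B_inL)
    have "gen (B j) * gen C - gen (X - Y) + (gen (X - Y) - (gen X - gen Y)) + (gen X - (\<Sum>k=1..p. scalar (\<psi> k j 0) * gen (A k)))
       - (gen Y - (\<Sum>k=0..p. scalar (y k) * gen (B k))) - scalar (y 0) * (gen (unit L) - 1) \<in> I"
      by (intro I_add I_diff 1 2 3 4 unit)
    then have "gen (B j) * gen C - ((\<Sum>k=1..p. scalar (\<psi> k j 0) * gen (A k))
       - scalar (y 0) - (\<Sum>k=1..p. scalar (y k) * gen (B k))) \<in> I"
      by (simp add: sum_atLeast0_atMost B0 algebra_simps)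
    from I_uminus[OF I_add[OF K_free_commutator_B[OF j] this[unfolded y_def]]] show ?thesis
      using j by (simp add: P_def free_alg_closed B_inL)
  qed
  \<comment> \<open>If p is positive, the relation for \<open>B_1 A_1\<close> expresses C by
    elements already treated; if p = 0, then K is C.\<close>
  have P_C: "P (gen C)"
  proof (cases "p = 0")
    case True
    then have "K_free = gen C" unfolding K_free_def by simp
    then show ?thesis by (simp add: P_def free_alg_closed C_in I_zero)
  next
    case False
    then have 1: "1 \<in> {1..p}" by auto
    let ?s = "(\<Sum>k=1..p. scalar (\<psi> k 1 1) * gen (A k)) + (\<Sum>k=1..p. scalar (\<phi> 1 k 1) * gen (B k)) + scalar (t 1 1)"
    have "P (gen (B 1) * gen (A 1) - ?s)"
      using 1 by (intro P_diff P_add P_mult P_sum P_scalar P_A P_B) auto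
    moreover have "gen C - (gen (B 1) * gen (A 1) - ?s) \<in> I"
      using I_uminus[OF gen_BA[OF 1 1]] by (simp add: algebra_simps)
    ultimately show ?thesis using P_cong free_alg_closed(6)[OF C_in] by blast
  qed
  have "P (gen v)" if v: "v \<in> Lsp L" for v
  proof -
    define X where "X = (\<Sum>k=1..p. sc (form L v (B k)) (A k))"
    define Y where "Y = (\<Sum>k=0..p. sc (form L v (dualA k)) (B k))"
    define d where "d = form L v (unit L)"
    have XL: "X \<in> Lsp L" "Y \<in> Lsp L" by (simp_all add: X_def Y_def lincomb_in_L)
    have v': "v = X + Y + sc d C" unfolding X_def Y_def d_def by (rule expansion[OF v])
    have 1: "gen (X + Y + sc d C) - (gen (X + Y) + gen (sc d C)) \<in> I"
      by (rule gen_add) (simp_all add: XL L_closed C_in)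
    have 2: "gen (X + Y) - (gen X + gen Y) \<in> I" by (rule gen_add[OF XL])
    have 3: "gen X - (\<Sum>k=1..p. scalar (form L v (B k)) * gen (A k)) \<in> I"
      unfolding X_def by (rule gen_lincomb) (simp add: A_inL)
    have 4: "gen Y - (\<Sum>k=0..p. scalar (form L v (dualA k)) * gen (B k)) \<in> I"
      unfolding Y_def by (rule gen_lincomb) (simp add: B_inL)
    have 5: "gen (sc d C) - scalar d * gen C \<in> I" by (rule gen_scale[OF C_in])
    have 6: "gen v - ((\<Sum>k=1..p. scalar (form L v (B k)) * gen (A k)) + (\<Sum>k=0..p. scalar (form L v (dualA k)) * gen (B k))
        + scalar d * gen C) \<in> I"
      using I_add[OF I_add[OF I_add[OF I_add[OF 1 2] 3] 4] 5]
      unfolding v'[symmetric] by (simp add: algebra_simps)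
    have 7: "P (\<Sum>k=1..p. scalar (form L v (B k)) * gen (A k))" "P (\<Sum>k=0..p. scalar (form L v (dualA k)) * gen (B k))"
      by (rule P_sum; rule P_mult; simp add: P_scalar P_A P_B)+
    show ?thesis
      by (rule P_cong[OF 6 P_add[OF P_add[OF 7] P_mult[OF P_scalar P_C]] free_alg_closed(6)[OF v]])
  qed
  note P_gen = this
  have "P f" if "f \<in> F" for f
    by (rule free_alg_generated[OF that]; rule P_scalar P_gen P_add P_mult; assumption)
  then show ?thesis by (auto simp: K_elem_eq U_central_iff K_free_in P_def)
qed

end

section \<open>The product attached to a pair\<close>

definition pair_product :: "(complex \<Rightarrow> 'v::ab_group_add \<Rightarrow> 'v) \<Rightarrow> 'v M_data \<times> ('v, 'n::finite) rep \<Rightarrow>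
    complex^'n^'n \<Rightarrow> complex^'n^'n \<Rightarrow> complex^'n^'n" where
  "pair_product sc = (\<lambda>(L, \<rho>). SOME F. \<exists>p A B C. adapted_basis sc L p A B C \<and>
     F = M_product p (\<lambda>i. \<rho> (U_incl sc L (A i))) (\<lambda>i. \<rho> (U_incl sc L (B i))) (\<rho> (U_incl sc L C)))"

lemma M_rep_pairsD:
  assumes "(L, \<rho>) \<in> M_rep_pairs sc"
  shows "weak_M_structure sc L" "Defs.representation sc L \<rho>"
    "linear_rep sc L (\<lambda>v. \<rho> (U_incl sc L v))"
    "\<exists>p A B C. adapted_M_structure sc L p A B C \<and> U_central sc L (K_elem sc L p A B C)"
proof -
  show w: "weak_M_structure sc L" and \<rho>: "Defs.representation sc L \<rho>"
    using assms by (auto simp: M_rep_pairs_def M_structure_def nondegenerate_rep_def)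
  show "linear_rep sc L (\<lambda>v. \<rho> (U_incl sc L v))"
    by (rule weak_M_structure.linear_rep_of_representation[OF w \<rho>])
  show "\<exists>p A B C. adapted_M_structure sc L p A B C \<and> U_central sc L (K_elem sc L p A B C)"
    using assms w by (auto simp: M_rep_pairs_def M_structure_def adapted_M_structure_def adapted_M_structure_axioms_def)
qed

lemma M_rep_pairs_independent:
  assumes L: "(L, \<rho>) \<in> M_rep_pairs sc" and ad: "adapted_basis sc L p A B C"
  shows "lin_indep_family mat_scale {0..p} (\<lambda>i. \<rho> (U_incl sc L (A i)))"
    and "lin_indep_family mat_scale {0..p} (\<lambda>i. \<rho> (U_incl sc L (B i)))"
proof -
  note r = M_rep_pairsD(3)[OF L]
  obtain q A' B' C' where ad': "adapted_basis sc L q A' B' C'"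
    and ind: "lin_indep_family mat_scale {0..q} (\<lambda>i. \<rho> (U_incl sc L (A' i)))"
      "lin_indep_family mat_scale {0..q} (\<lambda>i. \<rho> (U_incl sc L (B' i)))"
    using L by (auto simp: M_rep_pairs_def nondegenerate_rep_def)
  interpret x: adapted_M_structure sc L p A B C
    using M_rep_pairsD(1)[OF L] ad by (simp add: adapted_M_structure_def adapted_M_structure_axioms_def)
  interpret y: adapted_M_structure sc L q A' B' C'
    using M_rep_pairsD(1)[OF L] ad' by (simp add: adapted_M_structure_def adapted_M_structure_axioms_def)
  show "lin_indep_family mat_scale {0..p} (\<lambda>i. \<rho> (U_incl sc L (A i)))"
    by (rule x.linear_rep_independent_A[OF r y.linear_rep_injective_A[OF r ind(1)]])
  show "lin_indep_family mat_scale {0..p} (\<lambda>i. \<rho> (U_incl sc L (B i)))"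
    by (rule x.linear_rep_independent_B[OF r y.linear_rep_injective_B[OF r ind(2)]])
qed

text \<open>All adapted bases give the same product, so the choice made in
  \<open>pair_product\<close> is immaterial.\<close>

lemma pair_product_eq:
  assumes L: "(L, \<rho>) \<in> M_rep_pairs sc" and ad: "adapted_basis sc L p A B C"
  shows "pair_product sc (L, \<rho>) = M_product p (\<lambda>i. \<rho> (U_incl sc L (A i))) (\<lambda>i. \<rho> (U_incl sc L (B i))) (\<rho> (U_incl sc L C))"
proof -
  interpret x: adapted_M_structure sc L p A B C
    using M_rep_pairsD(1)[OF L] ad by (simp add: adapted_M_structure_def adapted_M_structure_axioms_def)
  let ?P = "\<lambda>F. \<exists>p' A' B' C'. adapted_basis sc L p' A' B' C' \<and>
    F = M_product p' (\<lambda>i. \<rho> (U_incl sc L (A' i))) (\<lambda>i. \<rho> (U_incl sc L (B' i))) (\<rho> (U_incl sc L C'))"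
  have "?P (pair_product sc (L, \<rho>))"
    unfolding pair_product_def prod.case by (rule someI[of ?P]) (use ad in blast)
  then show ?thesis using x.M_product_adapted_basis[OF M_rep_pairsD(3)[OF L]] by auto
qed

lemma pair_product_compatible:
  assumes "X \<in> M_rep_pairs sc" shows "pair_product sc X \<in> assoc_products_compatible_with_mult"
proof -
  obtain L \<rho> where X: "X = (L, \<rho>)" by (cases X)
  note L = assms[unfolded X]
  obtain p A B C where ad: "adapted_M_structure sc L p A B C" and K: "U_central sc L (K_elem sc L p A B C)"
    using M_rep_pairsD(4)[OF L] by blast
  interpret adapted_M_structure sc L p A B C by fact
  show ?thesis
    unfolding X pair_product_eq[OF L adapted]
    by (rule matrix_relations.associative_compatible[OF central_imp_matrix_relations[OF M_rep_pairsD(3)[OF L] K]])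
qed

text \<open>Equal matrices give equal products. Conversely, equal products relate the two sets of
  matrices by a transformation; lifted to L, it gives an adapted basis with the same matrices as the
  one of L', and then the structure constants agree. Identification of pairs is thus the kernel of
  \<open>pair_product\<close>.\<close>

lemma pair_equiv_iff:
  fixes X Y :: "'v::ab_group_add M_data \<times> ('v, 'n::finite) rep"
  shows "(X, Y) \<in> pair_equiv sc \<longleftrightarrow> X \<in> M_rep_pairs sc \<and> Y \<in> M_rep_pairs sc \<and> pair_product sc X = pair_product sc Y"
proof
  obtain L \<rho> L' \<rho>' where X: "X = (L, \<rho>)" and Y: "Y = (L', \<rho>')" by (cases X, cases Y)
  assume "(X, Y) \<in> pair_equiv sc"
  then obtain p A B C A' B' C' where XY: "(L, \<rho>) \<in> M_rep_pairs sc" "(L', \<rho>') \<in> M_rep_pairs sc"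
    and ad: "adapted_basis sc L p A B C" "adapted_basis sc L' p A' B' C'"
    and eq: "\<And>i. i \<in> {1..p} \<Longrightarrow> \<rho> (U_incl sc L (A i)) = \<rho>' (U_incl sc L' (A' i))"
      "\<And>i. i \<in> {1..p} \<Longrightarrow> \<rho> (U_incl sc L (B i)) = \<rho>' (U_incl sc L' (B' i))"
      "\<rho> (U_incl sc L C) = \<rho>' (U_incl sc L' C')"
    by (auto simp: pair_equiv_def X Y)
  have "M_product p (\<lambda>i. \<rho> (U_incl sc L (A i))) (\<lambda>i. \<rho> (U_incl sc L (B i))) (\<rho> (U_incl sc L C))
      = M_product p (\<lambda>i. \<rho>' (U_incl sc L' (A' i))) (\<lambda>i. \<rho>' (U_incl sc L' (B' i))) (\<rho>' (U_incl sc L' C'))"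
    unfolding fun_eq_iff M_product_def eq(3)
    by (intro allI arg_cong2[of _ _ _ _ "(+)"] sum.cong refl) (simp add: eq(1,2))
  then show "X \<in> M_rep_pairs sc \<and> Y \<in> M_rep_pairs sc \<and> pair_product sc X = pair_product sc Y"
    using XY by (simp add: X Y pair_product_eq[OF XY(1) ad(1)] pair_product_eq[OF XY(2) ad(2)])
next
  obtain L \<rho> L' \<rho>' where X: "X = (L, \<rho>)" and Y: "Y = (L', \<rho>')" by (cases X, cases Y)
  assume "X \<in> M_rep_pairs sc \<and> Y \<in> M_rep_pairs sc \<and> pair_product sc X = pair_product sc Y"
  then have LX: "(L, \<rho>) \<in> M_rep_pairs sc" and LY: "(L', \<rho>') \<in> M_rep_pairs sc"
    and eq: "pair_product sc (L, \<rho>) = pair_product sc (L', \<rho>')" by (auto simp: X Y)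
  define r where "r v = \<rho> (U_incl sc L v)" for v
  define r' where "r' v = \<rho>' (U_incl sc L' v)" for v
  have r: "linear_rep sc L r" and r': "linear_rep sc L' r'"
    unfolding r_def r'_def by (rule M_rep_pairsD(3)[OF LX] M_rep_pairsD(3)[OF LY])+
  obtain p A B C where "adapted_M_structure sc L p A B C" using M_rep_pairsD(4)[OF LX] by blast
  then interpret x: adapted_M_structure sc L p A B C .
  obtain p' A' B' C' where "adapted_M_structure sc L' p' A' B' C'" using M_rep_pairsD(4)[OF LY] by blast
  then interpret y: adapted_M_structure sc L' p' A' B' C' .
  note indx = M_rep_pairs_independent[OF LX x.adapted, folded r_def]
    and indy = M_rep_pairs_independent[OF LY y.adapted, folded r'_def]
  have "M_product p (\<lambda>i. r (A i)) (\<lambda>i. r (B i)) (r C) = M_product p' (\<lambda>i. r' (A' i)) (\<lambda>i. r' (B' i)) (r' C')"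
    using eq unfolding pair_product_eq[OF LX x.adapted] pair_product_eq[OF LY y.adapted] r_def r'_def .
  from M_product_unique[OF this x.linear_rep_AB(1,2)[OF r] y.linear_rep_AB(1,2)[OF r'] indx indy]
  obtain g h u v where p': "p' = p"
    and a': "\<And>i. i \<in> {1..p} \<Longrightarrow> r' (A' i) = (\<Sum>k=1..p. mat_scale (g i k) (r (A k))) + mat_scale (u i) (mat 1)"
    and b': "\<And>i. i \<in> {1..p} \<Longrightarrow> r' (B' i) = (\<Sum>k=1..p. mat_scale (h i k) (r (B k))) + mat_scale (v i) (mat 1)"
    and gh: "\<And>i j. i \<in> {1..p} \<Longrightarrow> j \<in> {1..p} \<Longrightarrow> (\<Sum>k=1..p. g i k * h j k) = (if i = j then 1 else 0)"
    and c': "r' C' = r C - (\<Sum>i=1..p. mat_scale (u i) (r' (B' i))) - (\<Sum>i=1..p. mat_scale (v i) (r' (A' i)))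
           + mat_scale (\<Sum>i=1..p. u i * v i) (mat 1)"
    by blast
  have "\<exists>A'' B'' C''. adapted_basis sc L p A'' B'' C'' \<and> (\<forall>i\<in>{0..p}. r (A'' i) = r' (A' i) \<and> r (B'' i) = r' (B' i)) \<and> r C'' = r' C'"
    by (rule x.transformed_adapted_basis[where g = g and h = h and u = u and v = v, OF r])
      (use indy y.linear_rep_AB(1,2)[OF r'] a' b' gh c' in \<open>simp_all add: p'\<close>)
  then obtain A'' B'' C'' where ad'': "adapted_basis sc L p A'' B'' C''"
    and A'': "\<And>i. i \<in> {0..p} \<Longrightarrow> r (A'' i) = r' (A' i)" and B'': "\<And>i. i \<in> {0..p} \<Longrightarrow> r (B'' i) = r' (B' i)" and C'': "r C'' = r' C'"
    by blast
  have z: "adapted_M_structure sc L p A'' B'' C''"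
    using M_rep_pairsD(1)[OF LX] ad'' by (simp add: adapted_M_structure_def adapted_M_structure_axioms_def)
  have "same_structure_constants sc p L A'' B'' C'' L' A' B' C'"
    by (rule same_structure_constants_if_linear_rep[OF z y.adapted_M_structure_axioms[unfolded p'] r r'])
      (simp_all add: A'' B'' C'' M_rep_pairs_independent[OF LX ad'', folded r_def])
  moreover have "\<forall>i\<in>{1..p}. r (A'' i) = r' (A' i) \<and> r (B'' i) = r' (B' i)" using A'' B'' by simp
  ultimately show "(X, Y) \<in> pair_equiv sc"
    using LX LY ad'' y.adapted[unfolded p'] C'' unfolding pair_equiv_def X Y r_def r'_def by blast
qed

section \<open>The M-structure defined by matrix relations\<close>

lemma transpose_simps:
  fixes X Y :: "complex^'n^'n"
  shows "transpose (X + Y) = transpose X + transpose Y" "transpose (X - Y) = transpose X - transpose Y"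
    "transpose (mat_scale s X) = mat_scale s (transpose X)"
    "transpose (mat 1) = (mat 1 :: complex^'n^'n)" "transpose 0 = (0 :: complex^'n^'n)"
    "transpose (X ** Y) = transpose Y ** transpose X"
  by (simp_all add: transpose_def vec_eq_iff mat_scale_def matrix_transpose_mul[unfolded transpose_def vec_eq_iff])
    (auto simp: mat_def matrix_matrix_mult_def mult.commute)

lemma transpose_sum:
  fixes f :: "'i \<Rightarrow> complex^'n^'n"
  shows "transpose (sum f J) = (\<Sum>i\<in>J. transpose (f i))"
  by (induction J rule: infinite_finite_induct) (auto simp: transpose_simps)

text \<open>Transposition reverses products and so exchanges the two families, with \<phi> and
  \<psi> swapped and their first two indices interchanged. The contraction is symmetric under this,
  up to transposing its own indices.\<close>

lemma (in matrix_relations) transpose_relations: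
  "matrix_relations p (\<lambda>i. transpose (b i)) (\<lambda>i. transpose (a i)) (transpose c)
     (\<lambda>i j k. \<psi> j i k) (\<lambda>i j k. \<phi> j i k) (\<lambda>i j. t j i)"
proof -
  have w: "contraction p (\<lambda>i j k. \<psi> j i k) (\<lambda>i j k. \<phi> j i k) (\<lambda>i j. t j i) i j = contraction p \<phi> \<psi> t j i" for i j
    by (auto simp: contraction_def mult.commute)
  show ?thesis
  proof
    fix i j assume i: "i \<in> {1..p}" and j: "j \<in> {1..p}"
    show "transpose (b i) ** transpose (b j) = (\<Sum>k=0..p. mat_scale (\<psi> j i k) (transpose (b k)))"
      using arg_cong[OF bb[OF j i], of transpose] by (simp add: transpose_simps transpose_sum)
    show "transpose (a i) ** transpose (a j) = (\<Sum>k=0..p. mat_scale (\<phi> j i k) (transpose (a k)))"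
      using arg_cong[OF aa[OF j i], of transpose] by (simp add: transpose_simps transpose_sum)
    show "transpose (a i) ** transpose (b j) = (\<Sum>k=1..p. mat_scale (\<phi> i k j) (transpose (b k)))
        + (\<Sum>k=1..p. mat_scale (\<psi> k j i) (transpose (a k))) + mat_scale (t j i) (mat 1) + (if i = j then transpose c else 0)"
      using arg_cong[OF ba[OF j i], of transpose] by (auto simp: transpose_simps transpose_sum)
  next
    fix i assume i: "i \<in> {1..p}"
    show "transpose (a i) ** transpose c = (\<Sum>k=1..p. mat_scale (\<phi> i k 0) (transpose (b k)))
        - (\<Sum>j=0..p. mat_scale (contraction p (\<lambda>i j k. \<psi> j i k) (\<lambda>i j k. \<phi> j i k) (\<lambda>i j. t j i) i j) (transpose (a j)))"
      using arg_cong[OF ca[OF i], of transpose] by (simp add: transpose_simps transpose_sum w)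
    show "transpose c ** transpose (b i) = (\<Sum>k=1..p. mat_scale (\<psi> k i 0) (transpose (a k)))
        - (\<Sum>k=0..p. mat_scale (contraction p (\<lambda>i j k. \<psi> j i k) (\<lambda>i j k. \<phi> j i k) (\<lambda>i j. t j i) k i) (transpose (b k)))"
      using arg_cong[OF bc[OF i], of transpose] by (simp add: transpose_simps transpose_sum w)
  qed (simp_all add: a0 b0 transpose_simps)
qed

lemma transpose_independent:
  fixes a :: "'i \<Rightarrow> complex^'n^'n"
  assumes "lin_indep_family mat_scale J a" "finite J"
  shows "lin_indep_family mat_scale J (\<lambda>i. transpose (a i))"
proof -
  have "(\<Sum>i\<in>J. mat_scale (u i) (transpose (a i))) = transpose (\<Sum>i\<in>J. mat_scale (u i) (a i))" for u
    by (simp add: transpose_simps transpose_sum)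
  moreover have "transpose X = 0 \<longleftrightarrow> X = 0" for X :: "complex^'n^'n"
    by (metis transpose_simps(5) transpose_transpose)
  ultimately show ?thesis
    using assms by (simp add: lin_indep_family_iff[OF mat.vector_space_axioms])
qed

text \<open>
  The construction of an M-structure from matrices: \<open>\<alpha> k\<close>, \<open>\<beta> k\<close>, \<open>\<gamma>\<close> are the coordinates with respect to
  \<open>A k\<close>, \<open>B k\<close>, \<open>C\<close>, where \<open>A 0 = B 0\<close> is the unit. Passing to transposed matrices exchanges \<open>A\<close> and \<open>B\<close>,
  so that everything about the right action of \<open>A\<close> follows from the left action of \<open>B\<close>.
\<close>

locale M_construction = vector_space sc + matrix_relations p a b c \<phi> \<psi> t
  for sc :: "complex \<Rightarrow> 'v::ab_group_add \<Rightarrow> 'v"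
    and p :: nat and a b :: "nat \<Rightarrow> complex^'n^'n" and c :: "complex^'n^'n"
    and \<phi> \<psi> :: "nat \<Rightarrow> nat \<Rightarrow> nat \<Rightarrow> complex" and t :: "nat \<Rightarrow> nat \<Rightarrow> complex" +
  fixes A B :: "nat \<Rightarrow> 'v" and C :: 'v and \<alpha> \<beta> :: "nat \<Rightarrow> 'v \<Rightarrow> complex" and \<gamma> :: "'v \<Rightarrow> complex"
  assumes inda: "lin_indep_family mat_scale {0..p} a" and indb: "lin_indep_family mat_scale {0..p} b"
    and AB0: "A 0 = B 0" and \<alpha>\<beta>0: "\<alpha> 0 = \<beta> 0"
    and \<alpha>_add: "\<alpha> k (v + w) = \<alpha> k v + \<alpha> k w" and \<alpha>_scale: "\<alpha> k (sc s v) = s * \<alpha> k v"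
    and \<beta>_add: "\<beta> k (v + w) = \<beta> k v + \<beta> k w" and \<beta>_scale: "\<beta> k (sc s v) = s * \<beta> k v"
    and \<gamma>_add: "\<gamma> (v + w) = \<gamma> v + \<gamma> w" and \<gamma>_scale: "\<gamma> (sc s v) = s * \<gamma> v"
    and \<alpha>A: "\<lbrakk>k \<in> {0..p}; i \<in> {0..p}\<rbrakk> \<Longrightarrow> \<alpha> k (A i) = (if k = i then 1 else 0)"
    and \<beta>B: "\<lbrakk>k \<in> {0..p}; i \<in> {0..p}\<rbrakk> \<Longrightarrow> \<beta> k (B i) = (if k = i then 1 else 0)"
    and \<alpha>B: "\<lbrakk>k \<in> {1..p}; i \<in> {0..p}\<rbrakk> \<Longrightarrow> \<alpha> k (B i) = 0"
    and \<beta>A: "\<lbrakk>k \<in> {1..p}; i \<in> {0..p}\<rbrakk> \<Longrightarrow> \<beta> k (A i) = 0"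
    and \<alpha>C: "k \<in> {0..p} \<Longrightarrow> \<alpha> k C = 0" and \<beta>C: "k \<in> {0..p} \<Longrightarrow> \<beta> k C = 0"
    and \<gamma>A: "i \<in> {0..p} \<Longrightarrow> \<gamma> (A i) = 0" and \<gamma>B: "i \<in> {0..p} \<Longrightarrow> \<gamma> (B i) = 0" and \<gamma>C: "\<gamma> C = 1"
    and indAB: "independent (A ` {0..p} \<union> B ` {0..p})"
begin

section \<open>The space, its form and its map to matrices\<close>

definition LS :: "'v set" where "LS = span (insert C (A ` {0..p} \<union> B ` {0..p}))"
definition AS :: "'v set" where "AS = span (A ` {0..p})"
definition BS :: "'v set" where "BS = span (B ` {0..p})"

text \<open>The form for which \<open>A k\<close> and \<open>B k\<close> are dual to each other for
  positive k, and the unit is dual to C.\<close>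

definition fm :: "'v \<Rightarrow> 'v \<Rightarrow> complex" where
  "fm v w = (\<Sum>k=1..p. \<alpha> k v * \<beta> k w) + (\<Sum>k=1..p. \<beta> k v * \<alpha> k w) + \<beta> 0 v * \<gamma> w + \<gamma> v * \<beta> 0 w"

text \<open>The linear map with \<open>A k\<close>, \<open>B k\<close>, C sent to the given
  matrices. It may have a kernel, though not on A or on B.\<close>

definition r :: "'v \<Rightarrow> complex^'n^'n" where
  "r v = (\<Sum>k=1..p. mat_scale (\<alpha> k v) (a k)) + (\<Sum>k=1..p. mat_scale (\<beta> k v) (b k)) + mat_scale (\<beta> 0 v) (mat 1) + mat_scale (\<gamma> v) c"

text \<open>The matrix product is pulled back along \<open>r\<close>, which is injective on
  \<open>BS\<close> by independence of the \<open>b k\<close> and has an image closed under products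
  by the relations.\<close>

definition mulB' :: "'v \<Rightarrow> 'v \<Rightarrow> 'v" where
  "mulB' x y = (THE z. z \<in> BS \<and> r z = r x ** r y)"

text \<open>The condition on scalar products is the invariance axiom
  \<open>(y x, v) = (y, x v)\<close>; together with the matrix it leaves at most one
  candidate.\<close>

definition lact' :: "'v \<Rightarrow> 'v \<Rightarrow> 'v" where
  "lact' x v = (THE w. w \<in> LS \<and> r w = r x ** r v \<and> (\<forall>y\<in>BS. fm y w = fm (mulB' y x) v))"

lemma fm_add: "fm (v + v') w = fm v w + fm v' w" "fm v (w + w') = fm v w + fm v w'"
  and fm_scale: "fm (sc s v) w = s * fm v w" "fm v (sc s w) = s * fm v w"
  by (simp_all add: fm_def \<alpha>_add \<beta>_add \<gamma>_add \<alpha>_scale \<beta>_scale \<gamma>_scale sum.distrib sum_distrib_left algebra_simps)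

lemma coords_zero: "\<alpha> k 0 = 0" "\<beta> k 0 = 0" "\<gamma> 0 = 0"
  using \<alpha>_scale[of k 0 0] \<beta>_scale[of k 0 0] \<gamma>_scale[of 0 0] by simp_all

lemma fm_sym: "fm v w = fm w v"
  by (simp add: fm_def mult.commute)

lemma fm_zero: "fm 0 w = 0" "fm w 0 = 0"
  using fm_scale(1)[of 0 0 w] fm_scale(2)[of w 0 0] by simp_all

lemma fm_sum: "fm (sum f J) w = (\<Sum>i\<in>J. fm (f i) w)" "fm w (sum f J) = (\<Sum>i\<in>J. fm w (f i))"
  by (induction J rule: infinite_finite_induct) (simp_all add: fm_zero fm_add)

lemma fm_diff: "fm (v - v') w = fm v w - fm v' w" "fm v (w - w') = fm v w - fm v w'"
  using fm_add(1)[of "v - v'" v' w] by simp (use fm_add(2)[of v "w - w'" w'] in simp)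

lemma r_add: "r (v + w) = r v + r w" and r_scale: "r (sc s v) = mat_scale s (r v)"
  by (simp_all add: r_def \<alpha>_add \<beta>_add \<gamma>_add \<alpha>_scale \<beta>_scale \<gamma>_scale sum.distrib mat.scale_left_distrib mat_scale_expand add_ac)

lemma r_zero: "r 0 = 0" using r_scale[of 0 0] by simp

lemma r_sum: "r (sum f J) = (\<Sum>i\<in>J. r (f i))"
  by (induction J rule: infinite_finite_induct) (simp_all add: r_zero r_add)

lemma r_diff: "r (v - w) = r v - r w"
  using r_add[of "v - w" w] by simp

lemma \<alpha>\<beta>_values: "\<beta> 0 (A i) = (if i = 0 then 1 else 0)" if "i \<in> {0..p}"
  using \<alpha>A[of 0 i] that by (auto simp: \<alpha>\<beta>0)

lemma r_A: "i \<in> {0..p} \<Longrightarrow> r (A i) = a i"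
proof (cases "i = 0")
  case True
  assume i: "i \<in> {0..p}"
  have "(\<Sum>k=1..p. mat_scale (\<alpha> k (A 0)) (a k)) = 0" "(\<Sum>k=1..p. mat_scale (\<beta> k (A 0)) (b k)) = 0"
    by (intro sum.neutral; simp add: \<alpha>A \<beta>A)+
  then show ?thesis using True by (simp add: r_def \<alpha>\<beta>_values \<gamma>A a0)
next
  case False
  assume "i \<in> {0..p}"
  with False have i: "i \<in> {1..p}" by auto
  have "(\<Sum>k=1..p. mat_scale (\<alpha> k (A i)) (a k)) = a i"
    by (rule trans[OF sum_single[OF _ i]]) (use i in \<open>auto simp: \<alpha>A\<close>)
  moreover have "(\<Sum>k=1..p. mat_scale (\<beta> k (A i)) (b k)) = 0"
    using i by (intro sum.neutral) (simp add: \<beta>A)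
  ultimately show ?thesis using i by (simp add: r_def \<alpha>\<beta>_values \<gamma>A)
qed

lemma r_B: "i \<in> {0..p} \<Longrightarrow> r (B i) = b i"
proof (cases "i = 0")
  case True
  then show ?thesis using r_A[of 0] by (simp add: AB0 a0 b0)
next
  case False
  assume "i \<in> {0..p}"
  with False have i: "i \<in> {1..p}" by auto
  have "(\<Sum>k=1..p. mat_scale (\<beta> k (B i)) (b k)) = b i"
    by (rule trans[OF sum_single[OF _ i]]) (use i in \<open>auto simp: \<beta>B\<close>)
  moreover have "(\<Sum>k=1..p. mat_scale (\<alpha> k (B i)) (a k)) = 0"
    using i by (intro sum.neutral) (simp add: \<alpha>B)
  ultimately show ?thesis using i by (simp add: r_def \<beta>B \<gamma>B)
qed

lemma r_C: "r C = c"
  by (simp add: r_def \<alpha>C \<beta>C \<gamma>C)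

lemma fm_left: "fm (A i) v = (if i = 0 then \<gamma> v else \<beta> i v)" "fm (B i) v = (if i = 0 then \<gamma> v else \<alpha> i v)"
  if i: "i \<in> {0..p}"
proof -
  have z: "(\<Sum>k=1..p. \<beta> k (A i) * \<alpha> k v) = 0" "(\<Sum>k=1..p. \<alpha> k (B i) * \<beta> k v) = 0"
    using i by (simp_all add: \<beta>A \<alpha>B)
  have y: "(\<Sum>k=1..p. \<alpha> k (A i) * \<beta> k v) = (if i = 0 then 0 else \<beta> i v)"
    "(\<Sum>k=1..p. \<beta> k (B i) * \<alpha> k v) = (if i = 0 then 0 else \<alpha> i v)"
  proof -
    have "(\<Sum>k=1..p. \<alpha> k (A i) * \<beta> k v) = (\<Sum>k=1..p. if k = i then \<beta> i v else 0)"
      "(\<Sum>k=1..p. \<beta> k (B i) * \<alpha> k v) = (\<Sum>k=1..p. if k = i then \<alpha> i v else 0)"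
      by (rule sum.cong[OF refl]; use i in \<open>simp add: \<alpha>A \<beta>B\<close>)+
    then show "(\<Sum>k=1..p. \<alpha> k (A i) * \<beta> k v) = (if i = 0 then 0 else \<beta> i v)"
      "(\<Sum>k=1..p. \<beta> k (B i) * \<alpha> k v) = (if i = 0 then 0 else \<alpha> i v)"
      using i by auto
  qed
  show "fm (A i) v = (if i = 0 then \<gamma> v else \<beta> i v)" "fm (B i) v = (if i = 0 then \<gamma> v else \<alpha> i v)"
    using i \<beta>B[of 0 i] by (simp_all add: fm_def z y \<alpha>\<beta>_values \<gamma>A \<gamma>B)
qed

lemma fm_C: "fm C v = \<beta> 0 v"
proof -
  have "(\<Sum>k=1..p. \<alpha> k C * \<beta> k v) = 0" "(\<Sum>k=1..p. \<beta> k C * \<alpha> k v) = 0"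
    by (simp_all add: \<alpha>C \<beta>C)
  then show ?thesis by (simp add: fm_def \<beta>C \<gamma>C)
qed

lemma LS_expansion:
  assumes "v \<in> LS"
  shows "v = (\<Sum>k=1..p. sc (\<alpha> k v) (A k)) + (\<Sum>k=1..p. sc (\<beta> k v) (B k)) + sc (\<beta> 0 v) (B 0) + sc (\<gamma> v) C"
  using assms unfolding LS_def
proof (induction rule: span_induct_alt)
  case base
  show ?case by (simp add: coords_zero)
next
  case (step s x y)
  have "x = (\<Sum>k=1..p. sc (\<alpha> k x) (A k)) + (\<Sum>k=1..p. sc (\<beta> k x) (B k)) + sc (\<beta> 0 x) (B 0) + sc (\<gamma> x) C"
  proof -
    consider (C) "x = C" | (A) i where "x = A i" "i \<in> {1..p}" | (B) i where "x = B i" "i \<in> {1..p}" | (unit) "x = B 0"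
      using step(1) AB0 by (auto simp: Suc_le_eq) (metis gr_zeroI atLeastAtMost_iff Suc_leI One_nat_def)+
    then show ?thesis
    proof cases
      case C
      have "(\<Sum>k=1..p. sc (\<alpha> k C) (A k)) = 0" "(\<Sum>k=1..p. sc (\<beta> k C) (B k)) = 0"
        by (simp_all add: \<alpha>C \<beta>C)
      then show ?thesis by (simp add: C \<beta>C \<gamma>C)
    next
      case (A i)
      have "(\<Sum>k=1..p. sc (\<alpha> k (A i)) (A k)) = A i"
        by (rule trans[OF sum_single[OF _ A(2)]]) (use A(2) in \<open>auto simp: \<alpha>A\<close>)
      moreover have "(\<Sum>k=1..p. sc (\<beta> k (A i)) (B k)) = 0"
        using A(2) by (intro sum.neutral) (simp add: \<beta>A)
      ultimately show ?thesis using A by (simp add: \<alpha>\<beta>_values \<gamma>A)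
    next
      case (B i)
      have "(\<Sum>k=1..p. sc (\<beta> k (B i)) (B k)) = B i"
        by (rule trans[OF sum_single[OF _ B(2)]]) (use B(2) in \<open>auto simp: \<beta>B\<close>)
      moreover have "(\<Sum>k=1..p. sc (\<alpha> k (B i)) (A k)) = 0"
        using B(2) by (intro sum.neutral) (simp add: \<alpha>B)
      ultimately show ?thesis using B by (simp add: \<beta>B \<gamma>B)
    next
      case unit
      have "(\<Sum>k=1..p. sc (\<alpha> k (B 0)) (A k)) = 0" "(\<Sum>k=1..p. sc (\<beta> k (B 0)) (B k)) = 0"
        by (intro sum.neutral; simp add: \<alpha>B \<beta>B)+
      then show ?thesis by (simp add: unit \<beta>B \<gamma>B)
    qed
  qed
  moreover define G where "G z = (\<Sum>k=1..p. sc (\<alpha> k z) (A k)) + (\<Sum>k=1..p. sc (\<beta> k z) (B k)) + sc (\<beta> 0 z) (B 0) + sc (\<gamma> z) C" for z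
  ultimately have "x = G x" "y = G y" using step(2) by simp_all
  moreover have "G (sc s x + y) = sc s (G x) + G y"
    by (simp add: G_def \<alpha>_add \<beta>_add \<gamma>_add \<alpha>_scale \<beta>_scale \<gamma>_scale scale_left_distrib scale_right_distrib sum.distrib
        scale_sum_right add_ac)
  ultimately have "sc s x + y = G (sc s x + y)" by simp
  then show ?case by (simp only: G_def)
qed

lemma A_in_AS: "i \<in> {0..p} \<Longrightarrow> A i \<in> AS" and B_in_BS: "i \<in> {0..p} \<Longrightarrow> B i \<in> BS"
  unfolding AS_def BS_def by (auto intro: span_base)

lemma AS_LS: "AS \<subseteq> LS" and BS_LS: "BS \<subseteq> LS" and C_LS: "C \<in> LS"
  unfolding AS_def BS_def LS_def by (auto intro: span_base span_mono[THEN subsetD])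

lemma subspaces: "subspace LS" "subspace AS" "subspace BS"
  by (simp_all add: LS_def AS_def BS_def)

lemma BS_coords: "x \<in> BS \<Longrightarrow> \<gamma> x = 0 \<and> (\<forall>k\<in>{1..p}. \<alpha> k x = 0)"
  unfolding BS_def
proof (induction rule: span_induct_alt)
  case base
  then show ?case using \<alpha>_scale[of _ 0 0] \<gamma>_scale[of 0 0] by simp
next
  case (step s x y)
  then show ?case by (auto simp: \<alpha>_add \<alpha>_scale \<gamma>_add \<gamma>_scale \<gamma>B \<alpha>B)
qed

lemma fm_BB: "x \<in> BS \<Longrightarrow> y \<in> BS \<Longrightarrow> fm x y = 0"
  using BS_coords[of x] BS_coords[of y] by (simp add: fm_def)

lemma BS_expansion: "x \<in> BS \<Longrightarrow> x = (\<Sum>k=0..p. sc (\<beta> k x) (B k))"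
proof -
  assume x: "x \<in> BS"
  have "(\<Sum>k=1..p. sc (\<alpha> k x) (A k)) = 0" using BS_coords[OF x] by (intro sum.neutral) simp
  then show ?thesis using LS_expansion[of x] BS_LS x BS_coords[OF x] by (auto simp: sum_atLeast0_atMost add.commute)
qed

lemma r_inj_BS:
  assumes x: "x \<in> BS" and y: "y \<in> BS" and eq: "r x = r y" shows "x = y"
proof -
  have z: "x - y \<in> BS" using x y subspaces by (simp add: subspace_diff)
  have "r (x - y) = (\<Sum>k=0..p. mat_scale (\<beta> k (x - y)) (r (B k)))"
    by (subst BS_expansion[OF z]) (simp only: r_sum r_scale)
  also have "\<dots> = (\<Sum>k=0..p. mat_scale (\<beta> k (x - y)) (b k))" by (intro sum.cong refl) (simp add: r_B)
  finally have "(\<Sum>k=0..p. mat_scale (\<beta> k (x - y)) (b k)) = 0" using eq by (simp add: r_diff)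
  then have "\<forall>k\<in>{0..p}. \<beta> k (x - y) = 0"
    using spec[OF indb[unfolded lin_indep_family_iff[OF mat.vector_space_axioms finite_atLeastAtMost]],
        of "\<lambda>k. \<beta> k (x - y)"] by blast
  then have "x - y = 0" by (subst BS_expansion[OF z]) (simp add: sum.neutral)
  then show ?thesis by simp
qed

text \<open>Scalar products with the \<open>B k\<close> are the coordinates along the
  \<open>A k\<close> and C. If these agree, the difference lies in \<open>BS\<close>, where
  \<open>r\<close> is injective.\<close>

lemma LS_unique:
  assumes v: "v \<in> LS" and w: "w \<in> LS" and eq: "r v = r w" and f: "\<And>y. y \<in> BS \<Longrightarrow> fm y v = fm y w"
  shows "v = w"
proof -
  have u: "v - w \<in> LS" using v w subspaces by (simp add: subspace_diff)
  have f': "fm (B k) (v - w) = 0" if "k \<in> {0..p}" for k using f[OF B_in_BS[OF that]] by (simp add: fm_diff)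
  have "\<gamma> (v - w) = 0" using f'[of 0] by (simp add: fm_left)
  moreover have "\<alpha> k (v - w) = 0" if "k \<in> {1..p}" for k using f'[of k] that by (simp add: fm_left)
  ultimately have "v - w = (\<Sum>k=1..p. sc (\<beta> k (v - w)) (B k)) + sc (\<beta> 0 (v - w)) (B 0)"
    using LS_expansion[OF u] by simp
  moreover have "\<dots> \<in> BS" using subspaces B_in_BS by (intro subspace_add subspace_sum subspace_scale) auto
  ultimately have "v - w \<in> BS" by simp
  moreover have "0 \<in> BS" using subspaces by (simp add: subspace_0)
  ultimately have "v - w = 0" using eq by (intro r_inj_BS) (simp_all add: r_diff r_zero)
  then show ?thesis by simp
qed

lemma lincomb_BS: "(\<Sum>k=0..p. sc (x k) (B k)) \<in> BS" "(\<Sum>k=1..p. sc (x k) (B k)) \<in> BS"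
  using subspaces B_in_BS by (auto intro!: subspace_sum subspace_scale)

lemma lincomb_LS: "(\<Sum>k=1..p. sc (x k) (A k)) \<in> LS" "(\<Sum>k=1..p. sc (x k) (B k)) \<in> LS" "(\<Sum>k=0..p. sc (x k) (B k)) \<in> LS"
proof -
  have "(\<Sum>k=1..p. sc (x k) (A k)) \<in> AS"
    using subspaces A_in_AS by (auto intro!: subspace_sum subspace_scale)
  then show "(\<Sum>k=1..p. sc (x k) (A k)) \<in> LS" using AS_LS by auto
qed (use lincomb_BS BS_LS in auto)

section \<open>The product of B and its left action\<close>

lemma BS_induct [consumes 1, case_names zero step]:
  assumes "x \<in> BS" "P 0" "\<And>s i y. i \<in> {0..p} \<Longrightarrow> y \<in> BS \<Longrightarrow> P y \<Longrightarrow> P (sc s (B i) + y)"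
  shows "P x"
proof -
  have "x \<in> BS \<and> P x"
    using assms(1) unfolding BS_def
  proof (induction rule: span_induct_alt)
    case (step s x y)
    then show ?case using assms(3) subspaces(3) B_in_BS by (auto simp: BS_def[symmetric] subspace_add subspace_scale)
  qed (use assms(2) subspaces(3) in \<open>auto simp: BS_def[symmetric] subspace_0\<close>)
  then show ?thesis ..
qed

lemma mulB'_ex:
  assumes x: "x \<in> BS" and y: "y \<in> BS"
  shows "\<exists>z\<in>BS. r z = r x ** r y"
  using x
proof (induction rule: BS_induct)
  case zero
  show ?case using subspaces by (intro bexI[of _ 0]) (auto simp: r_zero subspace_0)
next
  case (step s i x)
  have "\<exists>z\<in>BS. r z = b i ** r y"
    using y
  proof (induction rule: BS_induct)
    case zero
    show ?case using subspaces by (intro bexI[of _ 0]) (auto simp: r_zero subspace_0)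
  next
    case (step s' j y)
    have "\<exists>z\<in>BS. r z = b i ** b j"
    proof (cases "i = 0 \<or> j = 0")
      case True
      then show ?thesis
      proof
        assume "i = 0" then show ?thesis using step(1) B_in_BS[of j] r_B[of j] by (auto simp: b0)
      next
        assume "j = 0" then show ?thesis using \<open>i \<in> {0..p}\<close> B_in_BS[of i] r_B[of i] by (auto simp: b0)
      qed
    next
      case False
      then have ij: "i \<in> {1..p}" "j \<in> {1..p}" using step(1) \<open>i \<in> {0..p}\<close> by auto
      have "r (\<Sum>k=0..p. sc (\<psi> i j k) (B k)) = b i ** b j"
        unfolding bb[OF ij] r_sum r_scale by (intro sum.cong refl) (simp add: r_B)
      then show ?thesis using lincomb_BS by blast
    qed
    then obtain z w where "z \<in> BS" "r z = b i ** b j" "w \<in> BS" "r w = b i ** r y" using step(3) by blast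
    then show ?case using step(1) subspaces
      by (intro bexI[of _ "sc s' z + w"]) (auto simp: r_add r_scale r_B matmul_expand subspace_add subspace_scale)
  qed
  then obtain z w where "z \<in> BS" "r z = b i ** r y" "w \<in> BS" "r w = r x ** r y" using step(3) by blast
  then show ?case using step(1) subspaces
    by (intro bexI[of _ "sc s z + w"]) (auto simp: r_add r_scale r_B matmul_expand subspace_add subspace_scale)
qed

lemma mulB': assumes "x \<in> BS" "y \<in> BS" shows "mulB' x y \<in> BS" "r (mulB' x y) = r x ** r y"
proof -
  have "\<exists>!z. z \<in> BS \<and> r z = r x ** r y"
    using mulB'_ex[OF assms] r_inj_BS by metis
  from theI'[OF this] show "mulB' x y \<in> BS" "r (mulB' x y) = r x ** r y" by (auto simp: mulB'_def)
qed

text \<open>Every identity for the product of B can be checked on matrices, where it is an instance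
  of matrix algebra.\<close>

lemma mulB'_eqI: "\<lbrakk>x \<in> BS; y \<in> BS; z \<in> BS; r z = r x ** r y\<rbrakk> \<Longrightarrow> mulB' x y = z"
  by (rule r_inj_BS) (simp_all add: mulB')

lemma mulB'_add: "\<lbrakk>x \<in> BS; y \<in> BS; z \<in> BS\<rbrakk> \<Longrightarrow> mulB' (x + y) z = mulB' x z + mulB' y z"
  "\<lbrakk>x \<in> BS; y \<in> BS; z \<in> BS\<rbrakk> \<Longrightarrow> mulB' z (x + y) = mulB' z x + mulB' z y"
  using subspaces by (auto intro!: mulB'_eqI simp: subspace_add mulB' r_add matmul_expand)

lemma mulB'_scale: "\<lbrakk>x \<in> BS; y \<in> BS\<rbrakk> \<Longrightarrow> mulB' (sc s x) y = sc s (mulB' x y)"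
  "\<lbrakk>x \<in> BS; y \<in> BS\<rbrakk> \<Longrightarrow> mulB' x (sc s y) = sc s (mulB' x y)"
  using subspaces by (auto intro!: mulB'_eqI simp: subspace_scale mulB' r_scale matmul_expand)

lemma mulB'_zero: "y \<in> BS \<Longrightarrow> mulB' 0 y = 0" "y \<in> BS \<Longrightarrow> mulB' y 0 = 0"
  using subspaces by (auto intro!: mulB'_eqI simp: subspace_0 r_zero)

lemma mulB'_unit: "x \<in> BS \<Longrightarrow> mulB' (A 0) x = x" "x \<in> BS \<Longrightarrow> mulB' x (A 0) = x"
  using B_in_BS[of 0] r_B[of 0] by (auto intro!: mulB'_eqI simp: AB0 b0)

lemma mulB'_assoc: "\<lbrakk>x \<in> BS; y \<in> BS; z \<in> BS\<rbrakk> \<Longrightarrow> mulB' (mulB' x y) z = mulB' x (mulB' y z)"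
  by (rule mulB'_eqI) (simp_all add: mulB' matmul_assoc)

lemma mulB'_BB: "\<lbrakk>i \<in> {1..p}; j \<in> {1..p}\<rbrakk> \<Longrightarrow> mulB' (B i) (B j) = (\<Sum>k=0..p. sc (\<psi> i j k) (B k))"
proof (rule mulB'_eqI)
  assume ij: "i \<in> {1..p}" "j \<in> {1..p}"
  then show "B i \<in> BS" "B j \<in> BS" by (simp_all add: B_in_BS)
  have "r (\<Sum>k=0..p. sc (\<psi> i j k) (B k)) = b i ** b j"
    unfolding bb[OF ij] r_sum r_scale by (intro sum.cong refl) (simp add: r_B)
  then show "r (\<Sum>k=0..p. sc (\<psi> i j k) (B k)) = r (B i) ** r (B j)" using ij by (simp add: r_B)
qed (rule lincomb_BS)

text \<open>The action as a relation. This form allows bilinearity to be proved before existence, so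
  that existence needs to be checked on basis vectors only.\<close>

definition is_lact :: "'v \<Rightarrow> 'v \<Rightarrow> 'v \<Rightarrow> bool" where
  "is_lact x v w \<longleftrightarrow> w \<in> LS \<and> r w = r x ** r v \<and> (\<forall>y\<in>BS. fm y w = fm (mulB' y x) v)"

lemma is_lact_combine:
  assumes "is_lact x v w" "is_lact x' v w'" "x \<in> BS" "x' \<in> BS"
  shows "is_lact (sc s x + x') v (sc s w + w')"
  using assms subspaces
  by (auto simp: is_lact_def subspace_add subspace_scale r_add r_scale matmul_expand mulB'_add mulB'_scale fm_add fm_scale)

lemma is_lact_combine_right:
  assumes "is_lact x v w" "is_lact x v' w'"
  shows "is_lact x (sc s v + v') (sc s w + w')"
  using assms subspaces
  by (auto simp: is_lact_def subspace_add subspace_scale r_add r_scale matmul_expand fm_add fm_scale)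

lemma is_lact_BB: assumes "x \<in> BS" "v \<in> BS" shows "is_lact x v (mulB' x v)"
  unfolding is_lact_def using assms BS_LS by (auto simp: mulB' fm_BB)

lemma is_lact_unit: assumes "v \<in> LS" shows "is_lact (B 0) v v"
  unfolding is_lact_def using assms mulB'_unit r_B[of 0] by (auto simp: AB0 b0)

lemma is_lactI:
  assumes i: "i \<in> {1..p}" and w: "w \<in> LS" "r w = b i ** r v"
    and 0: "fm (B 0) w = fm (B i) v" and l: "\<And>l. l \<in> {1..p} \<Longrightarrow> fm (B l) w = fm (mulB' (B l) (B i)) v"
  shows "is_lact (B i) v w"
proof -
  have BI: "B i \<in> BS" using i by (simp add: B_in_BS)
  have "fm (B l) w = fm (mulB' (B l) (B i)) v" if "l \<in> {0..p}" for l
    using that 0 l[of l] BI by (cases "l = 0") (auto simp: mulB'_unit AB0[symmetric])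
  note l = this
  have "fm y w = fm (mulB' y (B i)) v" if "y \<in> BS" for y
    using that
  proof (induction y rule: BS_induct)
    case zero
    show ?case using BI by (simp add: fm_zero mulB'_zero)
  next
    case (step s j y)
    then show ?case using BI
      by (simp add: fm_add fm_scale mulB'_add mulB'_scale B_in_BS l subspaces subspace_scale)
  qed
  then show ?thesis using w i by (simp add: is_lact_def r_B)
qed

lemma fm_B_lincomb:
  assumes l: "l \<in> {1..p}"
  shows "fm (B l) (\<Sum>k=1..p. sc (x k) (A k)) = x l" "fm (B l) (\<Sum>k=0..p. sc (x k) (A k)) = x l"
proof -
  have l0: "l \<in> {0..p}" using l by auto
  show "fm (B l) (\<Sum>k=1..p. sc (x k) (A k)) = x l"
    unfolding fm_sum fm_scale by (rule trans[OF sum_single[OF _ l]]) (use l in \<open>auto simp: fm_left \<alpha>A\<close>)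
  show "fm (B l) (\<Sum>k=0..p. sc (x k) (A k)) = x l"
    unfolding fm_sum fm_scale by (rule trans[OF sum_single[OF _ l0]]) (use l in \<open>auto simp: fm_left \<alpha>A\<close>)
qed

lemma fm_B_BS: "l \<in> {0..p} \<Longrightarrow> x \<in> BS \<Longrightarrow> fm (B l) x = 0"
  by (simp add: fm_BB B_in_BS)

lemma fm_unit_lincomb: "fm (B 0) (\<Sum>k=1..p. sc (x k) (A k)) = 0"
  unfolding fm_sum fm_scale by (intro sum.neutral) (simp add: fm_left \<gamma>A)

lemma fm_lincomb_A:
  assumes j: "j \<in> {1..p}" shows "fm (\<Sum>k=0..p. sc (x k) (B k)) (A j) = x j"
proof -
  have j0: "j \<in> {0..p}" using j by auto
  show ?thesis
    unfolding fm_sum fm_scale by (rule trans[OF sum_single[OF _ j0]]) (use j in \<open>auto simp: fm_left \<alpha>A \<gamma>A\<close>)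
qed

lemma fm_lincomb_C: "fm (\<Sum>k=0..p. sc (x k) (B k)) C = x 0"
  unfolding fm_sum fm_scale by (rule trans[OF sum_single[of _ 0]]) (auto simp: fm_left \<alpha>C \<gamma>C)

lemma r_lincomb: "r (\<Sum>k=1..p. sc (x k) (A k)) = (\<Sum>k=1..p. mat_scale (x k) (a k))"
  "r (\<Sum>k=1..p. sc (x k) (B k)) = (\<Sum>k=1..p. mat_scale (x k) (b k))"
  "r (\<Sum>k=0..p. sc (x k) (B k)) = (\<Sum>k=0..p. mat_scale (x k) (b k))"
  unfolding r_sum r_scale by (intro sum.cong refl; simp add: r_A r_B)+

definition lact_BA :: "nat \<Rightarrow> nat \<Rightarrow> 'v" where
  "lact_BA i j = (\<Sum>k=1..p. sc (\<psi> k i j) (A k)) + (\<Sum>k=1..p. sc (\<phi> j k i) (B k)) + sc (t i j) (B 0) + (if i = j then C else 0)"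

definition lact_BC :: "nat \<Rightarrow> 'v" where
  "lact_BC i = (\<Sum>k=1..p. sc (\<psi> k i 0) (A k)) - (\<Sum>k=0..p. sc (contraction p \<phi> \<psi> t i k) (B k))"

text \<open>The relation for \<open>b i ** a j\<close> says that the candidate has the right matrix,
  and its coefficients along the \<open>A k\<close> and C are the ones that invariance of the form
  requires.\<close>

lemma is_lact_BA:
  assumes i: "i \<in> {1..p}" and j: "j \<in> {1..p}"
  shows "is_lact (B i) (A j) (lact_BA i j)"
proof (rule is_lactI[OF i])
  have B0: "B 0 \<in> BS" by (simp add: B_in_BS)
  then show "lact_BA i j \<in> LS"
    unfolding lact_BA_def using subspaces(1) lincomb_LS C_LS BS_LS
    by (intro subspace_add subspace_scale) (auto simp: subspace_0)
  have "r (if i = j then C else 0) = (if i = j then c else 0)" by (simp add: r_C r_zero)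
  then show "r (lact_BA i j) = b i ** r (A j)"
    using j by (simp add: lact_BA_def ba[OF i j] r_A r_add r_lincomb r_scale r_B b0)
  have "fm (B 0) (if i = j then C else 0) = (if i = j then 1 else 0)" by (simp add: fm_left \<gamma>C coords_zero)
  then show "fm (B 0) (lact_BA i j) = fm (B i) (A j)"
    using i j B0 by (simp add: lact_BA_def fm_add fm_unit_lincomb fm_B_BS lincomb_BS fm_scale fm_left \<alpha>A)
  fix l assume l: "l \<in> {1..p}"
  have "fm (B l) (if i = j then C else 0) = 0" using l by (simp add: fm_left \<alpha>C coords_zero)
  then show "fm (B l) (lact_BA i j) = fm (mulB' (B l) (B i)) (A j)"
    using l i j B0 by (simp add: lact_BA_def fm_add fm_B_lincomb fm_B_BS lincomb_BS fm_scale mulB'_BB fm_lincomb_A)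
qed

lemma is_lact_BC:
  assumes i: "i \<in> {1..p}"
  shows "is_lact (B i) C (lact_BC i)"
proof (rule is_lactI[OF i])
  show "lact_BC i \<in> LS"
    unfolding lact_BC_def using subspaces(1) lincomb_LS by (intro subspace_diff)
  show "r (lact_BC i) = b i ** r C"
    by (simp add: lact_BC_def bc[OF i] r_C r_diff r_lincomb)
  show "fm (B 0) (lact_BC i) = fm (B i) C"
    using i by (simp add: lact_BC_def fm_diff fm_unit_lincomb fm_B_BS lincomb_BS fm_left(2)[of i] \<alpha>C)
  fix l assume l: "l \<in> {1..p}"
  then show "fm (B l) (lact_BC i) = fm (mulB' (B l) (B i)) C"
    using i by (simp add: lact_BC_def fm_diff fm_B_lincomb fm_B_BS lincomb_BS mulB'_BB fm_lincomb_C)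
qed

lemma is_lact_zero: "is_lact 0 v 0" if "v \<in> LS" for v
  using subspaces that by (simp add: is_lact_def subspace_0 r_zero mulB'_zero fm_zero)

lemma is_lact_zero_right: "is_lact x 0 0"
  using subspaces by (simp add: is_lact_def subspace_0 r_zero fm_zero)

lemma is_lact_ex:
  assumes x: "x \<in> BS" and v: "v \<in> LS"
  shows "\<exists>w. is_lact x v w"
  using x
proof (induction rule: BS_induct)
  case zero
  then show ?case using is_lact_zero[OF v] by blast
next
  case (step s i x)
  have "\<exists>w. is_lact (B i) v w"
  proof (cases "i = 0")
    case True
    then show ?thesis using is_lact_unit[OF v] by blast
  next
    case False
    then have i: "i \<in> {1..p}" using step(1) by auto
    show ?thesis
      using v unfolding LS_def
    proof (induction rule: span_induct_alt)
      case base
      show ?case using is_lact_zero_right by blast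
    next
      case (step s y v)
      have "\<exists>w. is_lact (B i) y w"
      proof -
        consider "y = C" | j where "y = A j" "j \<in> {1..p}" | j where "y = B j" "j \<in> {0..p}"
          using step(1) AB0 by (auto simp: Suc_le_eq) (metis gr_zeroI atLeastAtMost_iff Suc_leI One_nat_def le0)+
        then show ?thesis
        proof cases
          case 1
          then show ?thesis using is_lact_BC[OF i] by blast
        next
          case (2 j)
          then show ?thesis using is_lact_BA[OF i] by blast
        next
          case (3 j)
          then show ?thesis using is_lact_BB[of "B i" "B j"] B_in_BS i by auto
        qed
      qed
      then show ?case using step(2) is_lact_combine_right by blast
    qed
  qed
  then show ?case using step is_lact_combine B_in_BS by blast
qed

lemma lact'_eqI:
  assumes "is_lact x v w" shows "lact' x v = w"
  unfolding lact'_def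
proof (rule the_equality)
  show "w \<in> LS \<and> r w = r x ** r v \<and> (\<forall>y\<in>BS. fm y w = fm (mulB' y x) v)" using assms by (simp add: is_lact_def)
  show "z = w" if "z \<in> LS \<and> r z = r x ** r v \<and> (\<forall>y\<in>BS. fm y z = fm (mulB' y x) v)" for z
    using assms that by (intro LS_unique) (auto simp: is_lact_def)
qed

lemma is_lact_lact': "\<lbrakk>x \<in> BS; v \<in> LS\<rbrakk> \<Longrightarrow> is_lact x v (lact' x v)"
  using is_lact_ex lact'_eqI by blast

lemma lact':
  assumes "x \<in> BS" "v \<in> LS"
  shows "lact' x v \<in> LS" "r (lact' x v) = r x ** r v" "y \<in> BS \<Longrightarrow> fm y (lact' x v) = fm (mulB' y x) v"
  using is_lact_lact'[OF assms] by (auto simp: is_lact_def)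

lemma lact'_add: "\<lbrakk>x \<in> BS; x' \<in> BS; v \<in> LS\<rbrakk> \<Longrightarrow> lact' (x + x') v = lact' x v + lact' x' v"
  "\<lbrakk>x \<in> BS; v \<in> LS; v' \<in> LS\<rbrakk> \<Longrightarrow> lact' x (v + v') = lact' x v + lact' x v'"
  using is_lact_combine[where s = 1] is_lact_combine_right[where s = 1] is_lact_lact'
  by (metis lact'_eqI scale_one)+

lemma lact'_scale: "\<lbrakk>x \<in> BS; v \<in> LS\<rbrakk> \<Longrightarrow> lact' (sc s x) v = sc s (lact' x v)"
  "\<lbrakk>x \<in> BS; v \<in> LS\<rbrakk> \<Longrightarrow> lact' x (sc s v) = sc s (lact' x v)"
  using is_lact_combine[OF is_lact_lact' is_lact_zero _ subspace_0[OF subspaces(3)], of x v s]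
    is_lact_combine_right[OF is_lact_lact' is_lact_zero_right, of x v s]
  by (auto intro!: lact'_eqI)

lemma lact'_unit: "v \<in> LS \<Longrightarrow> lact' (A 0) v = v"
  unfolding AB0 by (rule lact'_eqI) (rule is_lact_unit)

lemma lact'_BB: "\<lbrakk>x \<in> BS; y \<in> BS\<rbrakk> \<Longrightarrow> lact' x y = mulB' x y"
  by (rule lact'_eqI) (rule is_lact_BB)

text \<open>Both sides have the same matrix, and their scalar products with z in B are those of v
  with z x y, by associativity in B.\<close>

lemma lact'_mul: "\<lbrakk>x \<in> BS; y \<in> BS; v \<in> LS\<rbrakk> \<Longrightarrow> lact' (mulB' x y) v = lact' x (lact' y v)"
  by (rule LS_unique) (simp_all add: lact' mulB' matmul_assoc mulB'_assoc)

lemma lact'_BA: "\<lbrakk>i \<in> {1..p}; j \<in> {1..p}\<rbrakk> \<Longrightarrow> lact' (B i) (A j) = lact_BA i j"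
  by (rule lact'_eqI) (rule is_lact_BA)

lemma lact'_BC: "i \<in> {1..p} \<Longrightarrow> lact' (B i) C = lact_BC i"
  by (rule lact'_eqI) (rule is_lact_BC)

lemma dual: "M_construction sc p (\<lambda>i. transpose (b i)) (\<lambda>i. transpose (a i)) (transpose c)
   (\<lambda>i j k. \<psi> j i k) (\<lambda>i j k. \<phi> j i k) (\<lambda>i j. t j i) B A C \<beta> \<alpha> \<gamma>"
  unfolding M_construction_def
proof (intro conjI)
  show "M_construction_axioms sc p (\<lambda>i. transpose (b i)) (\<lambda>i. transpose (a i)) B A C \<beta> \<alpha> \<gamma>"
    by unfold_locales
      (auto simp: AB0 \<alpha>\<beta>0 \<alpha>_add \<alpha>_scale \<beta>_add \<beta>_scale \<gamma>_add \<gamma>_scale \<alpha>A \<alpha>B \<alpha>C \<beta>A \<beta>B \<beta>C \<gamma>A \<gamma>B \<gamma>C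
        transpose_independent[OF inda] transpose_independent[OF indb] indAB[unfolded Un_commute[of "A ` _"]])
qed (rule transpose_relations vector_space_axioms)+

end

section \<open>The right action by transposition, and commutation of the actions\<close>

lemma contraction_transpose:
  "contraction p (\<lambda>i j k. \<psi> j i k) (\<lambda>i j k. \<phi> j i k) (\<lambda>i j. t j i) i j = contraction p \<phi> \<psi> t j i"
  by (auto simp: contraction_def mult.commute)

context M_construction
begin

interpretation dual: M_construction sc p "\<lambda>i. transpose (b i)" "\<lambda>i. transpose (a i)" "transpose c"
   "\<lambda>i j k. \<psi> j i k" "\<lambda>i j k. \<phi> j i k" "\<lambda>i j. t j i" B A C \<beta> \<alpha> \<gamma>
  by (rule dual)

text \<open>Transposition reverses the order of factors, hence the exchanged arguments.\<close>

definition mulA' :: "'v \<Rightarrow> 'v \<Rightarrow> 'v" where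
  "mulA' x y = dual.mulB' y x"

definition ract' :: "'v \<Rightarrow> 'v \<Rightarrow> 'v" where
  "ract' v x = dual.lact' x v"

lemma dual_spaces: "dual.LS = LS" "dual.BS = AS" "dual.AS = BS"
  by (simp_all add: dual.LS_def LS_def dual.BS_def AS_def dual.AS_def BS_def Un_commute)

lemma dual_fm: "dual.fm v w = fm v w"
  by (simp add: dual.fm_def fm_def \<alpha>\<beta>0)

lemma dual_r: "dual.r v = transpose (r v)"
  by (simp add: dual.r_def r_def transpose_simps transpose_sum \<alpha>\<beta>0)

lemmas dual_simps = dual_spaces dual_fm dual_r

lemma dual_mulB': "dual.mulB' y x = mulA' x y"
  by (simp add: mulA'_def)

lemma dual_lact': "dual.lact' x v = ract' v x"
  by (simp add: ract'_def)

lemmas dual_ops = dual_simps dual_mulB' dual_lact' AB0[symmetric]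

lemmas mulA' = dual.mulB'[unfolded dual_ops]
lemmas mulA'_add = dual.mulB'_add[unfolded dual_ops]
lemmas mulA'_scale = dual.mulB'_scale[unfolded dual_ops]
lemmas mulA'_unit = dual.mulB'_unit[unfolded dual_ops]
lemmas mulA'_assoc = dual.mulB'_assoc[unfolded dual_ops]
lemmas mulA'_AA = dual.mulB'_BB[unfolded dual_ops]
lemmas ract' = dual.lact'[unfolded dual_ops]
lemmas ract'_add = dual.lact'_add[unfolded dual_ops]
lemmas ract'_scale = dual.lact'_scale[unfolded dual_ops]
lemmas ract'_unit = dual.lact'_unit[unfolded dual_ops]
lemmas ract'_AA = dual.lact'_BB[unfolded dual_ops]
lemmas ract'_mul = dual.lact'_mul[unfolded dual_ops]
lemmas ract'_AB = dual.lact'_BA[unfolded dual_ops]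
lemmas ract'_AC = dual.lact'_BC[unfolded dual_ops]
lemmas fm_AA = dual.fm_BB[unfolded dual_ops]
lemmas AS_expansion = dual.BS_expansion[unfolded dual_ops]
lemmas AS_induct = dual.BS_induct[unfolded dual_ops, consumes 1, case_names zero step]
lemmas lincomb_AS = dual.lincomb_BS[unfolded dual_ops]
lemmas fm_A_lincomb = dual.fm_B_lincomb[unfolded dual_ops]
lemmas fm_A_AS = dual.fm_B_BS[unfolded dual_ops]

lemma r_ract':
  assumes "v \<in> LS" "x \<in> AS" shows "r (ract' v x) = r v ** r x"
proof -
  have eq: "X = Y ** Z" if "transpose X = transpose Z ** transpose Y" for X Y Z :: "complex^'n^'n"
    using that by (metis matrix_transpose_mul transpose_transpose)
  show ?thesis by (rule eq) (rule ract'(2)[OF assms(2,1)])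
qed

lemma dual_lact_BA: "dual.lact_BA i j = (\<Sum>k=1..p. sc (\<phi> i k j) (B k)) + (\<Sum>k=1..p. sc (\<psi> k j i) (A k)) + sc (t j i) (A 0) + (if i = j then C else 0)"
  by (simp add: dual.lact_BA_def)

lemma dual_lact_BC: "dual.lact_BC i = (\<Sum>k=1..p. sc (\<phi> i k 0) (B k)) - (\<Sum>k=0..p. sc (contraction p \<phi> \<psi> t k i) (A k))"
  by (simp add: dual.lact_BC_def contraction_transpose[of p \<psi> \<phi> t])

lemma LS_induct [consumes 1, case_names zero step]:
  assumes "x \<in> LS" "P 0"
    and "\<And>s u v. u = C \<or> (\<exists>j\<in>{1..p}. u = A j) \<or> (\<exists>j\<in>{0..p}. u = B j) \<Longrightarrow> u \<in> LS \<Longrightarrow> v \<in> LS \<Longrightarrow> P v \<Longrightarrow> P (sc s u + v)"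
  shows "P x"
proof -
  have "x \<in> LS \<and> P x"
    using assms(1) unfolding LS_def
  proof (induction rule: span_induct_alt)
    case (step s u v)
    have uL: "u \<in> LS" unfolding LS_def using step(1) by (rule span_base)
    have "u = C \<or> (\<exists>j\<in>{1..p}. u = A j) \<or> (\<exists>j\<in>{0..p}. u = B j)"
      using step(1)
    proof (elim insertE UnE imageE)
      fix j assume j: "u = A j" "j \<in> {0..p}"
      then show ?thesis by (cases "j = 0") (auto simp: AB0)
    qed auto
    then show ?case using step(2) assms(3)[OF _ uL] uL subspaces(1) by (auto simp: LS_def[symmetric] subspace_add subspace_scale)
  qed (use assms(2) subspaces(1) in \<open>auto simp: LS_def[symmetric] subspace_0\<close>)
  then show ?thesis ..
qed

text \<open>Both sides are the trilinear form \<open>(1, x v y)\<close>.\<close>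

lemma fm_lact_ract:
  assumes x: "x \<in> BS" and v: "v \<in> LS" and y: "y \<in> AS"
  shows "fm (lact' x v) y = fm x (ract' v y)"
proof -
  have unitL: "fm (lact' (B 0) v) y = fm (B 0) (ract' v y)" if "v \<in> LS" "y \<in> AS" for v y
    using that lact'_unit[of v] ract'(3)[of y v "A 0"] A_in_AS[of 0] by (simp add: AB0[symmetric] mulA'_unit fm_sym)
  have unitR: "fm (lact' x v) (A 0) = fm x (ract' v (A 0))" if "x \<in> BS" "v \<in> LS" for x v
    using that ract'_unit[of v] lact'(3)[of x v "B 0"] B_in_BS[of 0]
    by (simp add: AB0 mulB'_unit[unfolded AB0] fm_sym[of _ "B 0"])
  have combine: "fm (lact' x (sc s u + v)) y = fm x (ract' (sc s u + v) y)"
    if "x \<in> BS" "y \<in> AS" "u \<in> LS" "v \<in> LS" "fm (lact' x u) y = fm x (ract' u y)" "fm (lact' x v) y = fm x (ract' v y)"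
    for x y u v s
    using that subspaces by (simp add: lact'_add lact'_scale ract'_add ract'_scale subspace_scale fm_add fm_scale)
  have gen: "fm (lact' (B i) v) (A k) = fm (B i) (ract' v (A k))" if i: "i \<in> {1..p}" and k: "k \<in> {1..p}" and v: "v \<in> LS" for i k v
    using v
  proof (induction rule: LS_induct)
    case zero
    have "lact' (B i) 0 = 0" "ract' 0 (A k) = 0"
      using lact'_scale(2)[of "B i" 0 0] ract'_scale(2)[of "A k" 0 0] i k subspaces
      by (simp_all add: B_in_BS A_in_AS subspace_0)
    then show ?case by (simp add: fm_zero)
  next
    case (step s u v)
    have Bi: "B i \<in> BS" and Ak: "A k \<in> AS" and A0: "A 0 \<in> AS" and B0: "B 0 \<in> BS"
      using i k by (simp_all add: B_in_BS A_in_AS)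
    have "fm (A k) C = 0" "fm (B i) C = 0" using i k by (simp_all add: fm_left \<alpha>C \<beta>C)
    then have AC: "fm (A k) (if q then C else 0) = 0" "fm (B i) (if q then C else 0) = 0" for q by (simp_all add: fm_zero)
    have AB: "fm (A k) (B 0) = 0" "fm (B i) (A 0) = 0"
      using fm_AA[OF Ak A0] fm_BB[OF Bi B0] by (simp_all add: AB0)
    \<comment> \<open>Both numbers are read off from explicit products. For C they agree because
      \<open>contraction p \<phi> \<psi> t i k\<close> occurs both in \<open>B i C\<close> and in
      \<open>C A k\<close>; for \<open>A j\<close> both are \<open>\<phi> j k i\<close>, for
      \<open>B j\<close> with j > 0 both are \<open>\<psi> i j k\<close>.\<close>
    from step(1) have "fm (A k) (lact' (B i) u) = fm (B i) (ract' u (A k))"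
    proof (elim disjE bexE)
      assume "u = C"
      then show ?thesis
        using i k by (simp add: lact'_BC ract'_AC lact_BC_def dual_lact_BC fm_diff fm_A_lincomb fm_A_AS lincomb_AS
           fm_B_lincomb fm_B_BS lincomb_BS)
    next
      fix j assume j: "j \<in> {1..p}" "u = A j"
      have "A j \<in> AS" using j by (simp add: A_in_AS)
      then show ?thesis
        using i k j Ak by (simp add: lact'_BA lact_BA_def ract'_AA mulA'_AA fm_add fm_scale AC AB fm_A_lincomb fm_A_AS lincomb_AS
           fm_B_lincomb fm_B_BS lincomb_BS)
    next
      fix j assume j: "j \<in> {0..p}" "u = B j"
      show ?thesis
      proof (cases "j = 0")
        case True
        then have "lact' (B i) u = B i" using j Bi lact'_BB[OF Bi B0] mulB'_unit(2)[OF Bi] by (simp add: AB0)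
        moreover have "ract' u (A k) = A k" using True j Ak ract'_AA[OF Ak A0] mulA'_unit[OF Ak] by (simp add: AB0)
        ultimately show ?thesis by (simp add: fm_sym)
      next
        case False
        then have j1: "j \<in> {1..p}" using j by auto
        have "B j \<in> BS" using j by (simp add: B_in_BS)
        then show ?thesis
          using i k j1 j(2) Bi by (simp add: lact'_BB mulB'_BB ract'_AB dual_lact_BA fm_add fm_scale AC AB fm_A_lincomb fm_A_AS lincomb_AS
             fm_B_lincomb fm_B_BS lincomb_BS)
      qed
    qed
    then show ?case using step Bi Ak by (intro combine) (simp_all add: fm_sym)
  qed
  have gen': "fm (lact' (B i) v) y = fm (B i) (ract' v y)" if i: "i \<in> {0..p}" for i
  proof (cases "i = 0")
    case True
    then show ?thesis using unitL v y by simp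
  next
    case False
    then have i1: "i \<in> {1..p}" using i by auto
    have Bi: "B i \<in> BS" using i by (simp add: B_in_BS)
    show ?thesis
      using y
    proof (induction rule: AS_induct)
      case zero
      have "ract' v 0 = 0" using ract'_scale(1)[of 0 v 0] v subspaces by (simp add: subspace_0)
      then show ?case by (simp add: fm_zero)
    next
      case (step s k y)
      have "fm (lact' (B i) v) (A k) = fm (B i) (ract' v (A k))"
        using step(1) gen[OF i1 _ v, of k] unitR[OF Bi v] by (cases "k = 0") auto
      moreover have "A k \<in> AS" using step(1) by (simp add: A_in_AS)
      ultimately show ?case
        using step v subspaces by (simp add: ract'_add ract'_scale subspace_scale fm_add fm_scale)
    qed
  qed
  show ?thesis
    using x
  proof (induction rule: BS_induct)
    case zero
    have "lact' 0 v = 0" using lact'_scale(1)[of 0 v 0] v subspaces by (simp add: subspace_0)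
    then show ?case by (simp add: fm_zero)
  next
    case (step s i x)
    then show ?case
      using v subspaces gen' by (simp add: lact'_add lact'_scale subspace_scale fm_add fm_scale B_in_BS)
  qed
qed

end

lemma matrix_relations_cong:
  assumes "matrix_relations p a b c \<phi> \<psi> t"
    and a: "\<And>i. i \<in> {0..p} \<Longrightarrow> a' i = a i" and b: "\<And>i. i \<in> {0..p} \<Longrightarrow> b' i = b i"
  shows "matrix_relations p a' b' c \<phi> \<psi> t"
proof -
  interpret matrix_relations p a b c \<phi> \<psi> t by fact
  have sums: "(\<Sum>k=0..p. mat_scale (x k) (a' k)) = (\<Sum>k=0..p. mat_scale (x k) (a k))"
    "(\<Sum>k=0..p. mat_scale (x k) (b' k)) = (\<Sum>k=0..p. mat_scale (x k) (b k))"
    "(\<Sum>k=1..p. mat_scale (x k) (a' k)) = (\<Sum>k=1..p. mat_scale (x k) (a k))"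
    "(\<Sum>k=1..p. mat_scale (x k) (b' k)) = (\<Sum>k=1..p. mat_scale (x k) (b k))" for x
    by (intro sum.cong refl; simp add: a b)+
  show ?thesis
    by unfold_locales (simp_all only: sums, simp_all add: a b a0 b0 aa bb ba bc ca)
qed

context M_construction
begin

text \<open>The matrices of both sides agree by associativity of the matrix product. Scalar products
  with z in B agree because the trilinear form moves \<open>y\<close> across, where the left factors
  z and x are combined and separated again.\<close>

lemma actions_commute: "\<lbrakk>x \<in> BS; v \<in> LS; y \<in> AS\<rbrakk> \<Longrightarrow> ract' (lact' x v) y = lact' x (ract' v y)"
proof (rule LS_unique)
  fix z assume x: "x \<in> BS" and v: "v \<in> LS" and y: "y \<in> AS" and z: "z \<in> BS"
  have "fm z (lact' x (ract' v y)) = fm (mulB' z x) (ract' v y)"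
    using x v y z by (intro lact'(3)) (simp_all add: ract')
  also have "\<dots> = fm (lact' (mulB' z x) v) y"
    using x v y z by (simp add: fm_lact_ract mulB')
  also have "\<dots> = fm (lact' z (lact' x v)) y"
    using x v z by (simp add: lact'_mul)
  also have "\<dots> = fm z (ract' (lact' x v) y)"
    using x v y z by (simp add: fm_lact_ract lact')
  finally show "fm z (ract' (lact' x v) y) = fm z (lact' x (ract' v y))" by simp
qed (simp_all add: ract' lact' r_ract' matmul_assoc)

definition LL :: "'v M_data" where
  "LL = \<lparr>Lsp = LS, Asp = AS, Bsp = BS, unit = A 0, form = fm, mulA = mulA', mulB = mulB', lact = lact', ract = ract'\<rparr>"

lemma LL_simps [simp]: "Lsp LL = LS" "Asp LL = AS" "Bsp LL = BS" "unit LL = A 0" "form LL = fm"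
  "mulA LL = mulA'" "mulB LL = mulB'" "lact LL = lact'" "ract LL = ract'"
  by (simp_all add: LL_def)

lemma fm_nondegenerate:
  assumes v: "v \<in> LS" and "\<And>w. w \<in> LS \<Longrightarrow> fm v w = 0"
  shows "v = 0"
proof -
  have 0: "fm w v = 0" if "w \<in> LS" for w using assms(2)[OF that] by (simp only: fm_sym[of w v])
  have in_LS: "A k \<in> LS" "B k \<in> LS" if "k \<in> {0..p}" for k
    using that A_in_AS B_in_BS AS_LS BS_LS by blast+
  have "\<alpha> k v = 0" "\<beta> k v = 0" if "k \<in> {1..p}" for k
    using that fm_left[of k v] 0[OF in_LS(1), of k] 0[OF in_LS(2), of k] by auto
  moreover have "\<gamma> v = 0" "\<beta> 0 v = 0"
    using fm_left[of 0 v] 0[OF in_LS(1), of 0] fm_C[of v] 0[OF C_LS] by auto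
  ultimately have "v = (\<Sum>k=1..p. sc 0 (A k)) + (\<Sum>k=1..p. sc 0 (B k)) + sc 0 (B 0) + sc 0 C"
    using LS_expansion[OF v] by simp
  then show ?thesis by simp
qed

lemma AS_inter_BS: "AS \<inter> BS = span {A 0}"
proof (intro subset_antisym subsetI)
  fix x assume x: "x \<in> AS \<inter> BS"
  then have "\<forall>k\<in>{1..p}. \<alpha> k x = 0" using BS_coords by blast
  moreover have "x = (\<Sum>k=0..p. sc (\<alpha> k x) (A k))" using x by (intro AS_expansion) auto
  ultimately have "x = sc (\<alpha> 0 x) (A 0)" by (simp add: sum_atLeast0_atMost)
  then show "x \<in> span {A 0}" by (auto simp: span_singleton)
next
  fix x assume "x \<in> span {A 0}"
  then show "x \<in> AS \<inter> BS"
    using subspaces A_in_AS[of 0] B_in_BS[of 0] by (auto simp: span_singleton AB0 subspace_scale)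
qed

lemma A0_nonzero: "A 0 \<noteq> 0"
  using \<alpha>A[of 0 0] coords_zero(1)[of 0] by auto

lemma dim_AS_inter_BS: "dim (AS \<inter> BS) = 1"
  unfolding AS_inter_BS using A0_nonzero by (simp add: dim_eq_card_independent)

text \<open>The coordinate \<open>\<gamma>\<close> vanishes on A and B but not on C, so adding C to
  a basis of the sum of A and B gives a basis of \<open>LS\<close>.\<close>

lemma codim_AS_BS: "dim LS = dim {a + b |a b. a \<in> AS \<and> b \<in> BS} + 1"
proof -
  let ?G = "A ` {0..p} \<union> B ` {0..p}"
  have sum: "{a + b |a b. a \<in> AS \<and> b \<in> BS} = span ?G"
    unfolding AS_def BS_def span_Un by blast
  have zero: "\<gamma> x = 0" if "x \<in> span ?G" for x
    using that
  proof (induction rule: span_induct_alt)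
    case (step s x y)
    then show ?case by (auto simp: \<gamma>_add \<gamma>_scale \<gamma>A \<gamma>B)
  qed (simp add: coords_zero)
  then have C: "C \<notin> span ?G" using \<gamma>C by force
  have "independent (insert C ?G)" using indAB C by (simp add: independent_insert)
  then have "dim LS = card (insert C ?G)" unfolding LS_def by (simp add: dim_eq_card_independent)
  also have "\<dots> = card ?G + 1" using C span_base[of C ?G] by (subst card_insert_disjoint) auto
  also have "\<dots> = dim (span ?G) + 1" using indAB by (simp add: dim_eq_card_independent)
  finally show ?thesis by (simp only: sum)
qed

lemma fm_mulA': "\<lbrakk>v \<in> LS; x \<in> AS; y \<in> AS\<rbrakk> \<Longrightarrow> fm v (mulA' x y) = fm (ract' v x) y"
  using ract'(3)[of x v y] by (simp only: fm_sym[of v] fm_sym[of "ract' v x"])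

lemma weak_M_structure_LL: "weak_M_structure sc LL"
proof (rule weak_M_structure.intro[OF vector_space_axioms], rule weak_M_structure_axioms.intro, unfold LL_simps)
  show "\<exists>S. finite S \<and> span S = LS"
    by (rule exI[of _ "insert C (A ` {0..p} \<union> B ` {0..p})"]) (simp add: LS_def)
  show "A 0 \<in> AS \<inter> BS" using A_in_AS[of 0] B_in_BS[of 0] AB0 by auto
  show "bilinear_on sc sc (*) LS LS fm" by (auto simp: bilinear_on_def fm_add fm_scale)
  show "bilinear_on sc sc sc AS AS mulA'" by (auto simp: bilinear_on_def mulA'_add mulA'_scale)
  show "bilinear_on sc sc sc BS BS mulB'" by (auto simp: bilinear_on_def mulB'_add mulB'_scale)
  show "bilinear_on sc sc sc BS LS lact'" by (auto simp: bilinear_on_def lact'_add lact'_scale)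
  show "bilinear_on sc sc sc LS AS ract'" by (auto simp: bilinear_on_def ract'_add ract'_scale)
  show "assoc_on AS mulA'" by (auto simp: assoc_on_def mulA'_assoc)
  show "assoc_on BS mulB'" by (auto simp: assoc_on_def mulB'_assoc)
  show "fm x y = 0" if "x \<in> AS" "y \<in> AS" for x y using that by (rule fm_AA)
  show "fm x y = 0" if "x \<in> BS" "y \<in> BS" for x y using that by (rule fm_BB)
  show "fm v w = fm w v" for v w by (rule fm_sym)
qed (simp_all only: subspaces AS_LS BS_LS mulA' mulB' mulA'_unit mulB'_unit lact' ract' lact'_unit ract'_unit lact'_mul ract'_mul
    lact'_BB ract'_AA actions_commute fm_nondegenerate dim_AS_inter_BS AS_inter_BS[symmetric] codim_AS_BS fm_mulA')

lemma independent_A: "lin_indep_family sc {0..p} A" and independent_B: "lin_indep_family sc {0..p} B"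
proof -
  have "u k = 0" if "(\<Sum>i=0..p. sc (u i) (A i)) = 0" and k: "k \<in> {0..p}" for u k
  proof -
    have "\<alpha> k (\<Sum>i\<in>J. sc (u i) (A i)) = (\<Sum>i\<in>J. u i * \<alpha> k (A i))" for J
      by (induction J rule: infinite_finite_induct) (simp_all add: coords_zero \<alpha>_add \<alpha>_scale)
    moreover have "(\<Sum>i=0..p. u i * \<alpha> k (A i)) = u k"
      by (rule trans[OF sum_single[OF _ k]]) (use k in \<open>auto simp: \<alpha>A\<close>)
    ultimately show ?thesis using that by (metis coords_zero(1))
  qed
  then show "lin_indep_family sc {0..p} A"
    unfolding lin_indep_family_iff[OF vector_space_axioms finite_atLeastAtMost] by blast
  have "u k = 0" if "(\<Sum>i=0..p. sc (u i) (B i)) = 0" and k: "k \<in> {0..p}" for u k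
  proof -
    have "\<beta> k (\<Sum>i\<in>J. sc (u i) (B i)) = (\<Sum>i\<in>J. u i * \<beta> k (B i))" for J
      by (induction J rule: infinite_finite_induct) (simp_all add: coords_zero \<beta>_add \<beta>_scale)
    moreover have "(\<Sum>i=0..p. u i * \<beta> k (B i)) = u k"
      by (rule trans[OF sum_single[OF _ k]]) (use k in \<open>auto simp: \<beta>B\<close>)
    ultimately show ?thesis using that by (metis coords_zero(2))
  qed
  then show "lin_indep_family sc {0..p} B"
    unfolding lin_indep_family_iff[OF vector_space_axioms finite_atLeastAtMost] by blast
qed

lemma adapted_basis_LL: "adapted_basis sc LL p A B C"
  unfolding adapted_basis_def LL_simps
proof (intro conjI ballI)
  show "lin_indep_family sc {0..p} A" "lin_indep_family sc {0..p} B" by (rule independent_A, rule independent_B)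
  show "span (A ` {0..p}) = AS" "span (B ` {0..p}) = BS" by (simp_all add: AS_def BS_def)
  show "fm (A i) (B j) = (if i = j then 1 else 0)" if "i \<in> {1..p}" "j \<in> {1..p}" for i j
    using that by (simp add: fm_left \<beta>B)
qed (simp_all add: AB0 C_LS fm_C fm_left(2)[of 0] \<gamma>C \<beta>C \<alpha>\<beta>_values \<beta>B)

lemma linear_rep_LL: "linear_rep sc LL r"
  using r_A[of 0] by (simp add: linear_rep_def r_add r_scale a0 lact' r_ract')

lemma M_rep_pair:
  "\<exists>X \<in> (M_rep_pairs sc :: ('v M_data \<times> ('v, 'n) rep) set). pair_product sc X = M_product p a b c"
proof -
  interpret L: adapted_M_structure sc LL p A B C
    using weak_M_structure_LL adapted_basis_LL by (simp add: adapted_M_structure_def adapted_M_structure_axioms_def)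
  have rA: "lin_indep_family mat_scale {0..p} (\<lambda>i. r (A i))" and rB: "lin_indep_family mat_scale {0..p} (\<lambda>i. r (B i))"
    using inda indb r_A r_B unfolding lin_indep_family_iff[OF mat.vector_space_axioms finite_atLeastAtMost] by simp_all
  have "matrix_relations p (\<lambda>i. r (A i)) (\<lambda>i. r (B i)) (r C) \<phi> \<psi> t"
    unfolding r_C by (rule matrix_relations_cong[OF matrix_relations_axioms]) (simp_all add: r_A r_B)
  then have "U_central sc LL (K_elem sc LL p A B C)"
    by (rule L.central_if_matrix_relations[OF linear_rep_LL rA rB])
  then have M: "M_structure sc LL"
    using weak_M_structure_LL adapted_basis_LL by (auto simp: M_structure_def)
  obtain \<rho> where \<rho>: "Defs.representation sc LL \<rho>" and "\<forall>v. v \<in> Lsp LL \<longrightarrow> \<rho> (U_incl sc LL v) = r v"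
    using L.representation_of_linear_rep[OF linear_rep_LL] by blast
  then have \<rho>_r: "\<rho> (U_incl sc LL v) = r v" if "v \<in> LS" for v using that by simp
  have \<rho>A: "\<rho> (U_incl sc LL (A i)) = a i" and \<rho>B: "\<rho> (U_incl sc LL (B i)) = b i" if "i \<in> {0..p}" for i
    using that A_in_AS AS_LS B_in_BS BS_LS by (auto simp: \<rho>_r r_A r_B subset_iff)
  have "lin_indep_family mat_scale {0..p} (\<lambda>i. \<rho> (U_incl sc LL (A i)))"
    "lin_indep_family mat_scale {0..p} (\<lambda>i. \<rho> (U_incl sc LL (B i)))"
    using inda indb \<rho>A \<rho>B unfolding lin_indep_family_iff[OF mat.vector_space_axioms finite_atLeastAtMost] by simp_all
  then have "nondegenerate_rep sc LL \<rho>"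
    using \<rho> adapted_basis_LL unfolding nondegenerate_rep_def by blast
  with M have X: "(LL, \<rho>) \<in> M_rep_pairs sc" by (simp add: M_rep_pairs_def)
  moreover have "pair_product sc (LL, \<rho>) = M_product p a b c"
    unfolding pair_product_eq[OF X adapted_basis_LL]
    by (intro ext) (simp add: M_product_def \<rho>A \<rho>B \<rho>_r C_LS r_C)
  ultimately show ?thesis by blast
qed

end

section \<open>The correspondence\<close>

text \<open>The number of terms of a presentation is not bounded beforehand when n varies, so the
  ambient space supplies an infinite sequence of independent vectors with linear coordinates on the
  whole space.\<close>

lemma (in vector_space) coordinate_functionals:
  assumes "\<nexists>S. finite S \<and> span S = UNIV"
  shows "\<exists>(e :: nat \<Rightarrow> 'b) \<kappa>. independent (range e) \<and> (\<forall>m n. \<kappa> n (e m) = (if m = n then 1 else 0)) \<and>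
    (\<forall>n v w. \<kappa> n (v + w) = \<kappa> n v + \<kappa> n w) \<and> (\<forall>n s v. \<kappa> n (scale s v) = s * \<kappa> n v)"
proof -
  obtain S where S: "independent S" "span S = UNIV"
    using basis_exists[of UNIV] by (metis top.extremum_uniqueI)
  then have "infinite S" using assms by blast
  then obtain e :: "nat \<Rightarrow> 'b" where e: "inj e" "range e \<subseteq> S"
    using infinite_countable_subset by blast
  show ?thesis
  proof (intro exI conjI allI)
    show "independent (range e)" using independent_mono[OF S(1) e(2)] .
    show "local.representation S (e m) (e n) = (if m = n then 1 else 0)" for m n
      using representation_basis[OF S(1) subsetD[OF e(2) rangeI], of m] e by (auto simp: inj_eq)
    show "local.representation S (v + w) (e n) = local.representation S v (e n) + local.representation S w (e n)" for n v w
      using S by (simp add: representation_add)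
    show "local.representation S (scale s v) (e n) = s * local.representation S v (e n)" for n s v
      using S by (simp add: representation_scale)
  qed
qed

lemma pair_product_surj:
  fixes sc :: "complex \<Rightarrow> 'v::ab_group_add \<Rightarrow> 'v"
    and F :: "complex^'n^'n \<Rightarrow> complex^'n^'n \<Rightarrow> complex^'n^'n"
  assumes sc: "vector_space sc" and inf: "\<nexists>S. finite S \<and> module.span sc S = UNIV"
    and F: "F \<in> assoc_products_compatible_with_mult"
  shows "\<exists>X \<in> (M_rep_pairs sc :: ('v M_data \<times> ('v, 'n) rep) set). pair_product sc X = F"
proof -
  interpret vector_space sc by fact
  have bil: "mbilin F" and assoc: "F (F x y) z = F x (F y z)"
    and cocycle: "F (x ** y) z + F x y ** z = F x (y ** z) + x ** F y z" for x y z
    using F by (auto simp: assoc_product_compatible_iff)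
  obtain T where T: "mlin T" "\<And>x y. F x y = T x ** y + x ** T y - T (x ** y)"
    using matrix_cocycle_coboundary[OF bil cocycle] by blast
  obtain p a b c where P: "F = M_product p a b c" and a0: "a 0 = mat 1" and b0: "b 0 = mat 1"
    and inda: "lin_indep_family mat_scale {0..p} a" and indb: "lin_indep_family mat_scale {0..p} b"
    using M_product_minimal[OF M_product_exists[OF T]] by blast
  obtain \<phi> \<psi> t where rel: "matrix_relations p a b c \<phi> \<psi> t"
    using relations_if_associative[OF assoc[unfolded P] a0 b0 inda indb] by blast
  obtain e :: "nat \<Rightarrow> 'v" and \<kappa> where e: "independent (range e)" and \<kappa>: "\<And>m n. \<kappa> n (e m) = (if m = n then 1 else 0)"
    and \<kappa>_lin: "\<And>n v w. \<kappa> n (v + w) = \<kappa> n v + \<kappa> n w" "\<And>n s v. \<kappa> n (sc s v) = s * \<kappa> n v"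
    using coordinate_functionals[OF inf] by blast
  \<comment> \<open>The vectors with indices 0 to p serve as the \<open>A i\<close>, those with
    indices p + 1 to 2p as the other \<open>B i\<close>, and the next one as C; \<open>e 0\<close>
    is the common unit. The coordinates follow the same numbering.\<close>
  define B where "B i = (if i = 0 then e 0 else e (p + i))" for i
  define \<beta> where "\<beta> i = (if i = 0 then \<kappa> 0 else \<kappa> (p + i))" for i
  have "independent (e ` {0..p} \<union> B ` {0..p})"
    by (rule independent_mono[OF e]) (auto simp: B_def)
  then have "M_construction sc p a b c \<phi> \<psi> t e B (e (p + p + 1)) \<kappa> \<beta> (\<kappa> (p + p + 1))"
    unfolding M_construction_def M_construction_axioms_def
    using vector_space_axioms rel inda indb by (auto simp: B_def \<beta>_def \<kappa> \<kappa>_lin)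
  then show ?thesis unfolding P by (rule M_construction.M_rep_pair)
qed

theorem theorem2p3:
  fixes sc :: "complex \<Rightarrow> 'v::ab_group_add \<Rightarrow> 'v"
  assumes "vector_space sc"
    and "\<nexists>S. finite S \<and> module.span sc S = UNIV"
  shows "equiv (M_rep_pairs sc) (pair_equiv sc ::
           (('v M_data \<times> ('v, 'n::finite) rep) \<times> ('v M_data \<times> ('v, 'n) rep)) set) \<and>
    (\<exists>\<Phi>. bij_betw \<Phi>
            ((M_rep_pairs sc :: ('v M_data \<times> ('v, 'n) rep) set) // pair_equiv sc)
            (assoc_products_compatible_with_mult ::
              (complex^'n^'n \<Rightarrow> complex^'n^'n \<Rightarrow> complex^'n^'n) set) \<and>
          (\<forall>L (\<rho> :: ('v, 'n) rep) p A B C.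
             (L, \<rho>) \<in> M_rep_pairs sc \<longrightarrow> adapted_basis sc L p A B C \<longrightarrow>
             \<Phi> (pair_equiv sc `` {(L, \<rho>)}) =
               M_product p (\<lambda>i. \<rho> (U_incl sc L (A i))) (\<lambda>i. \<rho> (U_incl sc L (B i)))
                 (\<rho> (U_incl sc L C))))"
proof -
  let ?M = "M_rep_pairs sc :: ('v M_data \<times> ('v, 'n) rep) set"
  let ?E = "pair_equiv sc :: (('v M_data \<times> ('v, 'n) rep) \<times> ('v M_data \<times> ('v, 'n) rep)) set"
  let ?P = "pair_product sc :: 'v M_data \<times> ('v, 'n) rep \<Rightarrow> _"
  \<comment> \<open>As the kernel of \<open>pair_product\<close>, the relation is an equivalence and
    the induced map on classes is injective; only surjectivity calls on the construction.\<close>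
  have E: "?E = {(X, Y). X \<in> ?M \<and> Y \<in> ?M \<and> ?P X = ?P Y}" by (auto simp: pair_equiv_iff)
  have equiv: "equiv ?M ?E"
    unfolding E by (rule equivI) (auto simp: refl_on_def sym_def trans_def)
  define \<Phi> where "\<Phi> Q = ?P (SOME X. X \<in> Q)" for Q
  have \<Phi>: "\<Phi> (?E `` {X}) = ?P X" if "X \<in> ?M" for X
    unfolding \<Phi>_def by (rule someI2[of _ X]) (use that in \<open>auto simp: E\<close>)
  have "inj_on \<Phi> (?M // ?E)"
  proof (rule inj_onI)
    fix Q R assume "Q \<in> ?M // ?E" "R \<in> ?M // ?E" and eq: "\<Phi> Q = \<Phi> R"
    then obtain X Y where "X \<in> ?M" "Q = ?E `` {X}" "Y \<in> ?M" "R = ?E `` {Y}"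
      by (auto simp: quotient_def)
    with eq \<Phi> show "Q = R" by (auto simp: E)
  qed
  moreover have "\<Phi> ` (?M // ?E) = ?P ` ?M"
    by (auto simp: quotient_def \<Phi> image_iff)
  moreover have "?P ` ?M = assoc_products_compatible_with_mult"
    using pair_product_surj[OF assms, where 'n = 'n] pair_product_compatible by (fastforce simp: image_iff)
  ultimately have "bij_betw \<Phi> (?M // ?E) assoc_products_compatible_with_mult"
    by (simp add: bij_betw_def)
  moreover have "\<Phi> (?E `` {(L, \<rho>)}) = M_product p (\<lambda>i. \<rho> (U_incl sc L (A i))) (\<lambda>i. \<rho> (U_incl sc L (B i))) (\<rho> (U_incl sc L C))"
    if "(L, \<rho>) \<in> ?M" "adapted_basis sc L p A B C" for L \<rho> p A B C
    using \<Phi>[OF that(1)] pair_product_eq[OF that] by simp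
  ultimately show ?thesis using equiv by blast
qed

end
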